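(* Let $A=\mathbb{F}_q[t]$ with $q$ odd, $K\subset\mathbb{C}_\infty$ an imaginary quadratic extension of $k$ with maximal order $\mathcal{O}_K$, $\phi$ the rank $2$ Drinfeld $A$-module associated to the lattice $\mathcal{O}_K$, defined over a finite extension $F/k$ with everywhere good reduction and with $\mathrm{End}_F(\phi)=\mathrm{End}_R(\mathscr{M})=\mathcal{O}_K$, where $R$ is the integral closure of $A$ in $F$ and $\mathscr{M}$ the minimal model of $\phi$ over $R$. Let $P\in A$ be a prime with $P\mathcal{O}_K=\mathfrak{P}\mathfrak{P}'$, $\mathfrak{P}\ne\mathfrak{P}'$, and let $v\in\mathrm{Spec}(R)$ lie over $P$. Suppose the lift $\pi\in\mathcal{O}_K$ of the Frobenius endomorphism $\bar\pi$ of $\phi^v$ lies in $\mathfrak{P}$. Then the reduction map $\theta:\mathscr{M}[P](\bar A)\to\phi^v[P](\overline{\mathbb{F}_q})$ is surjective, and its kernel is isomorphic to $\mathcal{O}_K/\mathfrak{P}$.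
   Context: $k=\mathbb{F}_q(t)$, $\mathbb{C}_\infty$ the completion of an algebraic closure of $\mathbb{F}_q((1/t))$, $\bar A$ the integral closure of $A$ in $\mathbb{C}_\infty$. Everywhere good reduction: at each nonzero prime of $R$, $\phi$ is isomorphic to a module with integral coefficients and unit leading coefficient; then $\mathscr{M}$ is a Drinfeld module over $R$ and $\phi^v$ is its fibre over the residue field $\kappa(v)$. $\mathscr{M}[P]=\ker(\phi_P)$, so $\mathscr{M}[P](\bar A)\cong\mathcal{O}_K/P\mathcal{O}_K$; $\phi^v[P]=\ker(\phi^v_P)$. The Frobenius endomorphism of $\phi^v$ is $\bar\pi=\tau^{[\kappa(v):\mathbb{F}_q]}$; by the reduction isomorphism $\mathrm{End}_F(\phi)\cong\mathrm{End}_{\kappa(v)}(\phi^v)$ it has a unique lift $\pi\in\mathcal{O}_K$. $\theta$ is the map induced by reducing points modulo a prime above $v$. *)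

theory Defs
  imports
    "HOL-Analysis.Analysis"
    "HOL-Algebra.Algebraic_Closure_Type"
    "HOL-Algebra.Ideal_Product"
    "HOL-Algebra.QuotRing"
begin

text \<open>
  Conventions: the finite field of \<open>q = CARD('a)\<close> elements is a type \<open>'a :: {finite,field}\<close>,
  \<open>A\<close> is \<open>'a poly\<close>, and the completion of \<open>k\<close> at infinity is \<open>'a fls\<close>, whose variable
  \<open>fls_X\<close> plays the role of \<open>1/t\<close>; the metric of \<open>'a fls\<close> is given by the absolute value
  \<open>2 ^ (- subdegree)\<close>. Extensions of \<open>A\<close> and \<open>k\<close> are subsets of a field \<open>'c\<close>, and
  \<open>'a alg_closure\<close> is the algebraic closure of the finite field.
\<close>

abbreviation subring_of :: "'b::field set \<Rightarrow> 'b ring" where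
  "subring_of B \<equiv> ring_of_type_algebra\<lparr>carrier := B\<rparr>"


subsection \<open>Function fields and their completion at infinity\<close>

text \<open>
  The type \<open>'c\<close> with the embedding \<open>\<iota>\<close> is a completion of an algebraic closure of \<open>'a fls\<close>:
  it is algebraically closed and complete (by its type class), its metric comes from a
  non-archimedean absolute value \<open>x \<mapsto> dist x 0\<close> extending the one of \<open>'a fls\<close>, and the
  elements algebraic over \<open>'a fls\<close> are dense. This determines \<open>('c, \<iota>)\<close> up to isometric
  isomorphism.
\<close>

definition C_infinity ::
    "('a::{finite,field} fls \<Rightarrow> 'c::{alg_closed_field,complete_space}) \<Rightarrow> bool" where
  "C_infinity \<iota> \<longleftrightarrow>
     \<iota> \<in> ring_hom ring_of_type_algebra ring_of_type_algebra \<and>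
     (\<forall>f g. dist (\<iota> f) (\<iota> g) = dist f g) \<and>
     (\<forall>x y z :: 'c. dist (x + z) (y + z) = dist x y) \<and>
     (\<forall>x y :: 'c. dist (x * y) 0 = dist x 0 * dist y 0) \<and>
     (\<forall>x y z :: 'c. dist x z \<le> max (dist x y) (dist y z)) \<and>
     closure {x. \<exists>p. p \<noteq> 0 \<and> poly (map_poly \<iota> p) x = 0} = UNIV"

definition A_emb :: "('a::{finite,field} fls \<Rightarrow> 'c::field) \<Rightarrow> 'a poly \<Rightarrow> 'c" where
  "A_emb \<iota> a = \<iota> (poly (map_poly fls_const a) fls_X_inv)"

definition k_field :: "('a::{finite,field} fls \<Rightarrow> 'c::field) \<Rightarrow> 'c set" where
  "k_field \<iota> = {A_emb \<iota> a / A_emb \<iota> b |a b. b \<noteq> 0}"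

definition finite_ext_k :: "('a::{finite,field} fls \<Rightarrow> 'c::field) \<Rightarrow> 'c set \<Rightarrow> bool" where
  "finite_ext_k \<iota> F \<longleftrightarrow>
     subfield F ring_of_type_algebra \<and> k_field \<iota> \<subseteq> F \<and>
     ring.finite_dimension ring_of_type_algebra (k_field \<iota>) F"

definition abs_value_on :: "'c::field set \<Rightarrow> ('c \<Rightarrow> real) \<Rightarrow> bool" where
  "abs_value_on L N \<longleftrightarrow>
     (\<forall>x\<in>L. N x \<ge> 0 \<and> (N x = 0 \<longleftrightarrow> x = 0)) \<and>
     (\<forall>x\<in>L. \<forall>y\<in>L. N (x * y) = N x * N y \<and> N (x + y) \<le> max (N x) (N y))"

text \<open>
  Imaginary: there is exactly one place of \<open>K\<close> above infinity, i.e. the restriction of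
  the absolute value of \<open>'c\<close> is the only absolute value on \<open>K\<close> extending that of \<open>k\<close>.
\<close>

definition imaginary_quadratic ::
    "('a::{finite,field} fls \<Rightarrow> 'c::{field,metric_space}) \<Rightarrow> 'c set \<Rightarrow> bool" where
  "imaginary_quadratic \<iota> K \<longleftrightarrow>
     subfield K ring_of_type_algebra \<and> k_field \<iota> \<subseteq> K \<and>
     ring.dimension ring_of_type_algebra 2 (k_field \<iota>) K \<and>
     (\<forall>N. abs_value_on K N \<and> (\<forall>x\<in>k_field \<iota>. N x = dist x 0) \<longrightarrow> (\<forall>x\<in>K. N x = dist x 0))"

text \<open>
  The integral closure of \<open>A\<close> in \<open>L\<close>: this is the maximal order for \<open>L = K\<close>, the ring \<open>R\<close>
  for \<open>L = F\<close>, and the ring of all algebraic integers for \<open>L = UNIV\<close>.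
\<close>

definition int_closure :: "('a::{finite,field} fls \<Rightarrow> 'c::field) \<Rightarrow> 'c set \<Rightarrow> 'c set" where
  "int_closure \<iota> L =
     {x \<in> L. \<exists>p. Polynomial.lead_coeff p = 1 \<and>
                (\<forall>i. Polynomial.coeff p i \<in> range (A_emb \<iota>)) \<and> poly p x = 0}"

definition localization :: "'c::field set \<Rightarrow> 'c set \<Rightarrow> 'c set" where
  "localization B v = {a / s |a s. a \<in> B \<and> s \<in> B \<and> s \<notin> v}"


subsection \<open>Drinfeld modules\<close>

text \<open>
  The twisted polynomial \<open>\<Sum>i. b i \<tau>^i\<close> over \<open>B\<close> is represented by the \<open>q\<close>-linear polynomial
  \<open>\<Sum>i. b i x^(q^i)\<close>; its product is composition, \<open>\<tau>^0\<close> is \<open>[:0, 1:]\<close>, and its constant term in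
  \<open>\<tau>\<close> is the coefficient of \<open>x\<close>.
\<close>

definition tau_polys :: "nat \<Rightarrow> 'b::field set \<Rightarrow> 'b poly set" where
  "tau_polys q B =
     {f. \<forall>n. Polynomial.coeff f n \<in> B \<and> (Polynomial.coeff f n \<noteq> 0 \<longrightarrow> (\<exists>i. n = q ^ i))}"

text \<open>
  Drinfeld modules of rank \<open>r\<close> over the subring \<open>B\<close> of a field, for the structure map \<open>\<gamma>\<close>, with
  the additive group as underlying group scheme.
\<close>

definition drinfeld_module ::
    "('a::{finite,field} poly \<Rightarrow> 'b::field) \<Rightarrow> 'b set \<Rightarrow> nat \<Rightarrow> ('a poly \<Rightarrow> 'b poly) \<Rightarrow> bool" where
  "drinfeld_module \<gamma> B r \<phi> \<longleftrightarrow>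
     (\<forall>a. \<phi> a \<in> tau_polys CARD('a) B) \<and>
     \<phi> 1 = [:0, 1:] \<and>
     (\<forall>a b. \<phi> (a + b) = \<phi> a + \<phi> b) \<and>
     (\<forall>a b. \<phi> (a * b) = \<phi> a \<circ>\<^sub>p \<phi> b) \<and>
     (\<forall>a. Polynomial.coeff (\<phi> a) 1 = \<gamma> a) \<and>
     (\<forall>a. a \<noteq> 0 \<longrightarrow>
        Polynomial.degree (\<phi> a) = CARD('a) ^ (r * Polynomial.degree a) \<and>
        Polynomial.lead_coeff (\<phi> a) \<in> Units (subring_of B))"

text \<open>
  The twisted polynomial \<open>u f u^-1\<close>: multiplication by \<open>u\<close> is an isomorphism from \<open>\<phi>\<close> to
  \<open>\<lambda>a. twist u (\<phi> a)\<close>.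
\<close>

definition twist :: "'b::field \<Rightarrow> 'b poly \<Rightarrow> 'b poly" where
  "twist u f = Polynomial.smult u (f \<circ>\<^sub>p [:0, inverse u:])"

text \<open>The infinite product \<open>z \<Prod>(1 - z / l)\<close> over the nonzero elements \<open>l\<close> of the lattice.\<close>

definition lattice_exp :: "'c::{field,t2_space} set \<Rightarrow> 'c \<Rightarrow> 'c" where
  "lattice_exp \<Lambda> z =
     z * Lim (finite_subsets_at_top (\<Lambda> - {0})) (\<lambda>S. \<Prod>l\<in>S. 1 - z / l)"

definition lattice_drinfeld_module ::
    "('a::{finite,field} fls \<Rightarrow> 'c::{field,t2_space}) \<Rightarrow> nat \<Rightarrow> 'c set \<Rightarrow> ('a poly \<Rightarrow> 'c poly) \<Rightarrow> bool"
  where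
  "lattice_drinfeld_module \<iota> r \<Lambda> \<psi> \<longleftrightarrow>
     drinfeld_module (A_emb \<iota>) UNIV r \<psi> \<and>
     (\<forall>a z. lattice_exp \<Lambda> (A_emb \<iota> a * z) = poly (\<psi> a) (lattice_exp \<Lambda> z))"

definition End_over :: "'c::field set \<Rightarrow> ('a::{finite,field} poly \<Rightarrow> 'c poly) \<Rightarrow> 'c poly set" where
  "End_over F \<phi> = {f \<in> tau_polys CARD('a) F. \<forall>a. f \<circ>\<^sub>p \<phi> a = \<phi> a \<circ>\<^sub>p f}"

text \<open>
  Endomorphism rings in generic characteristic are identified with subrings of \<open>'c\<close> through
  their action on the tangent space, \<open>f \<mapsto> coeff f 1\<close>. Under this identification
  \<open>endo F \<phi> \<alpha>\<close> is the endomorphism (over \<open>F\<close>) corresponding to \<open>\<alpha>\<close>.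
\<close>

abbreviation tangent :: "'c::field poly \<Rightarrow> 'c" where
  "tangent f \<equiv> Polynomial.coeff f 1"

definition endo :: "'c::field set \<Rightarrow> ('a::{finite,field} poly \<Rightarrow> 'c poly) \<Rightarrow> 'c \<Rightarrow> 'c poly" where
  "endo F \<phi> = the_inv_into (End_over F \<phi>) tangent"


subsection \<open>Integral models\<close>

definition nonzero_prime :: "'c::field set \<Rightarrow> 'c set \<Rightarrow> bool" where
  "nonzero_prime R v \<longleftrightarrow> primeideal v (subring_of R) \<and> v \<noteq> {0}"

text \<open>
  Good reduction at \<open>v\<close>: \<open>\<phi>\<close> is isomorphic over \<open>F\<close> to a module with coefficients in the
  local ring at \<open>v\<close> and with leading coefficients that are units there.
\<close>

definition good_reduction ::
    "('a::{finite,field} fls \<Rightarrow> 'c::field) \<Rightarrow> 'c set \<Rightarrow> nat \<Rightarrow> ('a poly \<Rightarrow> 'c poly) \<Rightarrow> 'c set \<Rightarrow> bool"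
  where
  "good_reduction \<iota> F r \<phi> v \<longleftrightarrow>
     (\<exists>u\<in>F - {0}. drinfeld_module (A_emb \<iota>) (localization (int_closure \<iota> F) v) r
                    (\<lambda>a. twist u (\<phi> a)))"

text \<open>
  A coordinate \<open>u x\<close> gives a model of \<open>\<phi>\<close> over the local ring \<open>B\<close> if \<open>u \<phi> u^-1\<close> has coefficients
  in \<open>B\<close>; it is minimal if every other model maps to it (the map from the model with coordinate
  \<open>u' x\<close> to the one with coordinate \<open>u x\<close> being multiplication by \<open>u / u'\<close>).
\<close>

definition model_coord ::
    "'c::field set \<Rightarrow> 'c set \<Rightarrow> ('a::{finite,field} poly \<Rightarrow> 'c poly) \<Rightarrow> 'c \<Rightarrow> bool" where
  "model_coord F B \<phi> u \<longleftrightarrow>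
     u \<in> F \<and> u \<noteq> 0 \<and> (\<forall>a. twist u (\<phi> a) \<in> tau_polys CARD('a) B)"

definition minimal_coord ::
    "'c::field set \<Rightarrow> 'c set \<Rightarrow> ('a::{finite,field} poly \<Rightarrow> 'c poly) \<Rightarrow> 'c \<Rightarrow> bool" where
  "minimal_coord F B \<phi> u \<longleftrightarrow>
     model_coord F B \<phi> u \<and> (\<forall>u'. model_coord F B \<phi> u' \<longrightarrow> u / u' \<in> B)"

text \<open>
  As \<open>R\<close> need not be a principal ideal domain, the additive group underlying the minimal model over
  \<open>R\<close> is only locally the
  standard one: it is the line bundle given by the fractional ideal
  \<open>minimal_line\<close>, which at every \<open>v\<close> is generated by \<open>u^-1\<close> for a minimal coordinate \<open>u x\<close>.
  Its points with values in a torsion-free \<open>R\<close>-algebra \<open>B\<close> are \<open>minimal_line \<otimes> B\<close>,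
  i.e. the \<open>B\<close>-span of \<open>minimal_line\<close>.
\<close>

definition minimal_line ::
    "('a::{finite,field} fls \<Rightarrow> 'c::field) \<Rightarrow> 'c set \<Rightarrow> ('a poly \<Rightarrow> 'c poly) \<Rightarrow> 'c set" where
  "minimal_line \<iota> F \<phi> =
     {x \<in> F. \<forall>v u. nonzero_prime (int_closure \<iota> F) v \<longrightarrow>
                minimal_coord F (localization (int_closure \<iota> F) v) \<phi> u \<longrightarrow>
                u * x \<in> localization (int_closure \<iota> F) v}"

definition minimal_model_points ::
    "('a::{finite,field} fls \<Rightarrow> 'c::field) \<Rightarrow> 'c set \<Rightarrow> ('a poly \<Rightarrow> 'c poly) \<Rightarrow> 'c set \<Rightarrow> 'c set" where
  "minimal_model_points \<iota> F \<phi> B =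
     {(\<Sum>(b, x)\<in>S. b * x) |S. finite S \<and> S \<subseteq> B \<times> minimal_line \<iota> F \<phi>}"

definition End_minimal_model ::
    "('a::{finite,field} fls \<Rightarrow> 'c::field) \<Rightarrow> 'c set \<Rightarrow> ('a poly \<Rightarrow> 'c poly) \<Rightarrow> 'c poly set" where
  "End_minimal_model \<iota> F \<phi> =
     {f \<in> End_over F \<phi>. \<forall>v u. nonzero_prime (int_closure \<iota> F) v \<longrightarrow>
         minimal_coord F (localization (int_closure \<iota> F) v) \<phi> u \<longrightarrow>
         twist u f \<in> tau_polys CARD('a) (localization (int_closure \<iota> F) v)}"

definition minimal_model_torsion ::
    "('a::{finite,field} fls \<Rightarrow> 'c::field) \<Rightarrow> 'c set \<Rightarrow> ('a poly \<Rightarrow> 'c poly) \<Rightarrow> 'a poly \<Rightarrow> 'c set" where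
  "minimal_model_torsion \<iota> F \<phi> P =
     {x \<in> minimal_model_points \<iota> F \<phi> (int_closure \<iota> UNIV). poly (\<phi> P) x = 0}"


subsection \<open>Reduction\<close>

text \<open>
  For a prime \<open>w\<close> of the ring of all algebraic integers, \<open>red\<close> is the residue map of the local
  ring at \<open>w\<close>, its residue field being identified with \<open>'a alg_closure\<close>. Being surjective
  onto a field, it has the maximal ideal of the local ring as its kernel. Outside of the local
  ring, the values of \<open>red\<close> are irrelevant.
\<close>

definition residue_map ::
    "('a::{finite,field} fls \<Rightarrow> 'c::field) \<Rightarrow> 'c set \<Rightarrow> ('c \<Rightarrow> 'a alg_closure) \<Rightarrow> bool" where
  "residue_map \<iota> w red \<longleftrightarrow>
     red \<in> ring_hom (subring_of (localization (int_closure \<iota> UNIV) w)) ring_of_type_algebra \<and>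
     red ` localization (int_closure \<iota> UNIV) w = UNIV \<and>
     (\<forall>c. red (A_emb \<iota> [:c:]) = to_ac c)"

text \<open>
  Reduction in the coordinate \<open>u x\<close>, on points and on twisted polynomials. The fibre of the
  minimal model at \<open>v\<close> is \<open>\<lambda>a. red_tau red u (\<phi> a)\<close> for a minimal coordinate \<open>u x\<close> at \<open>v\<close>.
\<close>

definition red_point :: "('c::field \<Rightarrow> 'd::field) \<Rightarrow> 'c \<Rightarrow> 'c \<Rightarrow> 'd" where
  "red_point red u x = red (u * x)"

definition red_tau :: "('c::field \<Rightarrow> 'd::field) \<Rightarrow> 'c \<Rightarrow> 'c poly \<Rightarrow> 'd poly" where
  "red_tau red u f = map_poly red (twist u f)"

definition fibre_torsion ::
    "('c::field \<Rightarrow> 'd::field) \<Rightarrow> 'c \<Rightarrow> ('a::{finite,field} poly \<Rightarrow> 'c poly) \<Rightarrow> 'a poly \<Rightarrow> 'd set" where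
  "fibre_torsion red u \<phi> P = {y. poly (red_tau red u (\<phi> P)) y = 0}"

definition residue_degree ::
    "('a::{finite,field} fls \<Rightarrow> 'c::field) \<Rightarrow> 'c set \<Rightarrow> 'c set \<Rightarrow> ('c \<Rightarrow> 'a alg_closure) \<Rightarrow> nat" where
  "residue_degree \<iota> F v red =
     ring.dim ring_of_type_algebra (range to_ac) (red ` localization (int_closure \<iota> F) v)"

definition frobenius_endo ::
    "('a::{finite,field} fls \<Rightarrow> 'c::field) \<Rightarrow> 'c set \<Rightarrow> 'c set \<Rightarrow> ('c \<Rightarrow> 'a alg_closure)
       \<Rightarrow> 'a alg_closure poly" where
  "frobenius_endo \<iota> F v red = Polynomial.monom 1 (CARD('a) ^ residue_degree \<iota> F v red)"


subsection \<open>Isomorphisms with quotients by an ideal\<close>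

text \<open>
  The additive subgroup \<open>N\<close>, with \<open>\<alpha> \<in> O'\<close> acting as the function \<open>act \<alpha>\<close>, is isomorphic to \<open>O'/I\<close>
  as an \<open>O'\<close>-module.
\<close>

definition iso_to_quotient ::
    "'c::field set \<Rightarrow> 'c set \<Rightarrow> ('c \<Rightarrow> 'c \<Rightarrow> 'c) \<Rightarrow> 'c set \<Rightarrow> bool" where
  "iso_to_quotient O' I act N \<longleftrightarrow>
     (\<exists>h. bij_betw h (carrier (subring_of O' Quot I)) N \<and>
        (\<forall>S\<in>carrier (subring_of O' Quot I). \<forall>T\<in>carrier (subring_of O' Quot I).
           h (S \<oplus>\<^bsub>subring_of O' Quot I\<^esub> T) = h S + h T) \<and>
        (\<forall>\<alpha>\<in>O'. \<forall>S\<in>carrier (subring_of O' Quot I).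
           h ((I +>\<^bsub>subring_of O'\<^esub> \<alpha>) \<otimes>\<^bsub>subring_of O' Quot I\<^esub> S) = act \<alpha> (h S)))"

end

theory Submission
  imports Defs "Jordan_Normal_Form.Char_Poly"
begin

text \<open>
  Write \<open>T = \<phi>[P]\<close>, \<open>d = deg P\<close> and \<open>\<O>\<close> for the maximal order of \<open>K\<close>; no analytic uniformization
  is needed. Since \<open>\<phi>\<^sub>P\<close> is separable, an endomorphism killing \<open>T\<close> is a multiple of \<open>\<phi>\<^sub>P\<close>, so
  \<open>\<O> / P \<O>\<close> acts faithfully on the \<open>q\<^bsup>2d\<^esup>\<close> points of \<open>T\<close>. By counting, \<open>T\<close> is the sum of \<open>T[\<PP>]\<close> and
  \<open>T[\<PP>']\<close>, each of which has \<open>q\<^bsup>d\<^esup>\<close> points and is a simple module, generated by any nonzero point.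

  In a minimal coordinate, \<open>\<phi>\<^sub>P\<close> has integral coefficients and a unit as leading coefficient at \<open>v\<close>.
  Reducing its factorization into linear factors shows that the reduction of points is surjective.
  As \<open>\<pi> \<in> \<PP>\<close> reduces to the Frobenius, which is injective, the kernel contains \<open>T[\<PP>]\<close>, so by
  simplicity it is \<open>T[\<PP>]\<close> or \<open>T\<close>.

  The kernel is not \<open>T\<close>: otherwise \<open>\<phi>\<^sup>v\<^sub>P = c \<tau>\<^bsup>2d\<^esup>\<close>, and the split algebra \<open>K \<otimes> k\<^sub>P\<close> would embed into
  a division algebra. Concretely, elements of \<open>\<PP>\<^bsup>m\<^esup>\<close>, say, reduce to multiples of \<open>\<tau>\<^bsup>2dm\<^esup>\<close>, while every
  element of \<open>\<O>\<close> is congruent modulo \<open>\<PP>\<^bsup>m\<^esup>\<close> to a polynomial of degree less than \<open>dm\<close>, whose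
  \<open>\<tau>\<close>-degree is less than \<open>2dm\<close>. For large \<open>m\<close> this forces \<open>\<O> = A\<close>.
\<close>

hide_const (open) up_ring.coeff up_ring.monom Polynomials.lead_coeff Polynomials.degree
  Coset.order module.smult

section \<open>Twisted polynomials\<close>

lemma finite_field_power_card:
  fixes x :: "'a::{finite,field}"
  shows "x ^ CARD('a) = x"
proof (cases "x = 0")
  case False
  \<comment> \<open>Multiplication by \<open>x\<close> permutes the nonzero elements; cancelling the
    common product leaves \<open>x ^ (q - 1) = 1\<close>.\<close>
  have "(\<Prod>y\<in>UNIV-{0}. x * y) = (\<Prod>y\<in>UNIV-{0}. y)"
    by (rule prod.reindex_bij_witness[of _ "\<lambda>y. y / x" "\<lambda>y. x * y"]) (use False in auto)
  hence "x ^ (CARD('a) - 1) = 1"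
    by (simp add: prod.distrib)
  moreover have "CARD('a) = Suc (CARD('a) - 1)"
    using finite_UNIV_card_ge_0[where ?'a = 'a] by simp
  ultimately show ?thesis
    by (metis power_Suc mult.right_neutral)
qed (use finite_UNIV_card_ge_0[where ?'a = 'a] in auto)

lemma card_field_gt_1: "CARD('a::{finite,field}) > 1"
proof -
  have "card {0, 1 :: 'a} \<le> CARD('a)"
    by (rule card_mono) auto
  thus ?thesis by simp
qed

text \<open>The polynomial (1 + X)^q - X^q - 1 has degree less than q, yet it vanishes at all q
  elements of the field, so it is zero. Its coefficients are the binomials in question, which avoids
  writing q as a power of the characteristic.\<close>

lemma of_nat_binomial_card_eq_0:
  assumes "0 < i" "i < CARD('a::{finite,field})"
  shows "of_nat (CARD('a) choose i) = (0 :: 'a)"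
proof -
  define q where "q = CARD('a)"
  define f :: "'a poly" where "f = [:1, 1:] ^ q - Polynomial.monom 1 q - 1"
  have q: "q > 1"
    using card_field_gt_1 unfolding q_def .
  have coeff_f: "coeff f n = of_nat (q choose n) - (if n = q then 1 else 0) - (if n = 0 then 1 else 0)" for n
  proof (cases "n \<le> q")
    case False
    have "coeff ([:1, 1 :: 'a:] ^ q) n = 0"
      by (rule coeff_eq_0) (use False in \<open>simp add: degree_power_eq\<close>)
    thus ?thesis using False by (simp add: f_def binomial_eq_0)
  qed (simp add: f_def coeff_linear_poly_power)
  have "f = 0"
  proof (rule ccontr)
    assume "f \<noteq> 0"
    have "degree f < q"
    proof (rule degree_lessI)
      show "\<forall>k\<ge>q. coeff f k = 0"
        using q by (auto simp: coeff_f binomial_eq_0)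
    qed (use \<open>f \<noteq> 0\<close> in auto)
    moreover have "{x. poly f x = 0} = UNIV"
      by (auto simp: f_def poly_monom q_def finite_field_power_card)
    ultimately show False
      using card_poly_roots_bound[OF \<open>f \<noteq> 0\<close>] by (simp add: q_def)
  qed
  thus ?thesis
    using coeff_f[of i] assms by (simp add: q_def)
qed

section \<open>Composition, tangents and divisibility by powers of X\<close>

lemma pcompose_conv_sum: "f \<circ>\<^sub>p g = (\<Sum>n\<le>degree f. smult (coeff f n) (g ^ n))"
proof -
  have "f \<circ>\<^sub>p g = (\<Sum>n\<le>degree f. monom (coeff f n) n) \<circ>\<^sub>p g"
    by (simp add: poly_as_sum_of_monoms)
  also have "\<dots> = (\<Sum>n\<le>degree f. smult (coeff f n) (g ^ n))"
    by (simp add: pcompose_sum monom_altdef pcompose_smult pcompose_hom.hom_power pcompose_pCons)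
  finally show ?thesis .
qed

text \<open>This is the chain rule at the fixed point 0, with the linear coefficient read as the
  derivative there.\<close>

lemma tangent_pcompose:
  fixes f g :: "'b::idom poly"
  assumes "coeff g 0 = 0"
  shows "coeff (f \<circ>\<^sub>p g) 1 = coeff f 1 * coeff g 1"
proof -
  have *: "coeff p 1 = poly (pderiv p) 0" for p :: "'b poly"
    by (simp add: poly_0_coeff_0 coeff_pderiv)
  have "poly g 0 = 0"
    using assms by (simp add: poly_0_coeff_0)
  thus ?thesis
    by (simp only: * pderiv_pcompose poly_pcompose poly_mult)
qed

lemma monom_1_conv: "monom 1 N = [:- 0, 1 :: 'b::idom:] ^ N"
  by (simp add: monom_altdef)

lemma monom_dvd_pcompose_left:
  fixes f g :: "'b::idom poly"
  assumes "monom 1 N dvd f" "coeff g 0 = 0"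
  shows "monom 1 N dvd f \<circ>\<^sub>p g"
proof -
  obtain h where h: "f = monom 1 N * h"
    using assms(1) by blast
  have "f \<circ>\<^sub>p g = g ^ N * (h \<circ>\<^sub>p g)"
    by (simp add: h pcompose_mult monom_altdef pcompose_hom.hom_power pcompose_pCons)
  moreover have "[:0, 1:] dvd g"
    using assms(2) by (metis minus_zero poly_0_coeff_0 poly_eq_0_iff_dvd)
  hence "monom 1 N dvd g ^ N"
    by (simp add: monom_altdef dvd_power_same)
  ultimately show ?thesis by simp
qed

text \<open>Write f = X h with h(0) nonzero. Then f o g = g (h o g), where h o g does not vanish at
  0, so f o g and g have the same order at 0. In terms of tau, a separable left factor can be
  cancelled.\<close>

lemma monom_dvd_pcompose_cancel:
  fixes f g :: "'b::field poly"
  assumes "coeff f 0 = 0" "coeff f 1 \<noteq> 0" "coeff g 0 = 0" "monom 1 N dvd f \<circ>\<^sub>p g"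
  shows "monom 1 N dvd g"
proof (cases "g = 0")
  case False
  obtain h where h: "f = pCons 0 h"
    using assms(1) by (cases f) auto
  have fg: "f \<circ>\<^sub>p g = g * (h \<circ>\<^sub>p g)"
    by (simp add: h pcompose_pCons)
  have "poly (h \<circ>\<^sub>p g) 0 \<noteq> 0"
    using assms by (simp add: h poly_pcompose poly_0_coeff_0)
  hence "order 0 (h \<circ>\<^sub>p g) = 0" and nz: "h \<circ>\<^sub>p g \<noteq> 0"
    using order_root by auto
  hence "order 0 (f \<circ>\<^sub>p g) = order 0 g"
    using False by (simp add: fg order_mult)
  moreover have "f \<circ>\<^sub>p g \<noteq> 0"
    using False nz by (simp add: fg)
  ultimately show ?thesis
    using assms(4) unfolding monom_1_conv order_divides by auto
qed auto

lemma monom_dvd_imp_eq_0: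
  fixes f :: "'b::field poly"
  assumes "monom 1 N dvd f" "degree f < N"
  shows "f = 0"
proof (rule ccontr)
  assume "f \<noteq> 0"
  hence "degree (monom (1::'b) N) \<le> degree f"
    using assms(1) by (intro dvd_imp_degree_le) auto
  thus False using assms(2) by (simp add: degree_monom_eq)
qed

section \<open>Subrings as plain sets, and polynomials supported on powers of q\<close>

definition is_subring :: "'b::comm_ring_1 set \<Rightarrow> bool" where
  "is_subring B \<longleftrightarrow> 1 \<in> B \<and> (\<forall>x\<in>B. \<forall>y\<in>B. x - y \<in> B \<and> x * y \<in> B)"

context
  fixes B :: "'b::comm_ring_1 set"
  assumes B: "is_subring B"
begin

lemma subring_1: "1 \<in> B"
  and subring_diff: "x \<in> B \<Longrightarrow> y \<in> B \<Longrightarrow> x - y \<in> B"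
  and subring_mult: "x \<in> B \<Longrightarrow> y \<in> B \<Longrightarrow> x * y \<in> B"
  using B by (auto simp: is_subring_def)

lemma subring_0: "0 \<in> B"
  using subring_diff[OF subring_1 subring_1] by simp

lemma subring_uminus: "x \<in> B \<Longrightarrow> - x \<in> B"
  using subring_diff[OF subring_0] by simp

lemma subring_add: "x \<in> B \<Longrightarrow> y \<in> B \<Longrightarrow> x + y \<in> B"
  using subring_diff[OF _ subring_uminus] by force

lemma subring_power: "x \<in> B \<Longrightarrow> x ^ n \<in> B"
  by (induction n) (auto intro: subring_1 subring_mult)

lemma subring_sum: "(\<And>i. i \<in> I \<Longrightarrow> f i \<in> B) \<Longrightarrow> sum f I \<in> B"
  by (induction I rule: infinite_finite_induct) (auto intro: subring_0 subring_add)

end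

lemma tau_polysD:
  assumes "f \<in> tau_polys q B"
  shows "coeff f n \<in> B" "coeff f n \<noteq> 0 \<Longrightarrow> \<exists>i. n = q ^ i"
  using assms by (auto simp: tau_polys_def)

lemma tau_polys_mono: "B \<subseteq> C \<Longrightarrow> f \<in> tau_polys q B \<Longrightarrow> f \<in> tau_polys q C"
  by (auto simp: tau_polys_def)

lemma tau_polys_coeff_0: "q > 0 \<Longrightarrow> f \<in> tau_polys q B \<Longrightarrow> coeff f 0 = 0"
  using tau_polysD(2)[of f q B 0] by fastforce

lemma tau_polys_poly_0: "q > 0 \<Longrightarrow> f \<in> tau_polys q B \<Longrightarrow> poly f 0 = 0"
  using tau_polys_coeff_0 by (simp add: poly_0_coeff_0)

lemma tau_polys_degree:
  assumes "f \<in> tau_polys q B" "f \<noteq> 0"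
  obtains i where "degree f = q ^ i"
  using tau_polysD(2)[OF assms(1), of "degree f"] assms(2) by auto

context
  fixes B :: "'b::field set"
  assumes B: "is_subring B"
begin

lemma tau_polys_0: "0 \<in> tau_polys q B"
  using subring_0[OF B] by (simp add: tau_polys_def)

lemma tau_polys_diff:
  assumes "f \<in> tau_polys q B" "g \<in> tau_polys q B"
  shows "f - g \<in> tau_polys q B"
  using assms subring_diff[OF B] by (simp add: tau_polys_def) (metis diff_0_right)

lemma tau_polys_uminus: "f \<in> tau_polys q B \<Longrightarrow> - f \<in> tau_polys q B"
  using tau_polys_diff[OF tau_polys_0] by simp

lemma tau_polys_add: "f \<in> tau_polys q B \<Longrightarrow> g \<in> tau_polys q B \<Longrightarrow> f + g \<in> tau_polys q B"
  using tau_polys_diff[OF _ tau_polys_uminus] by force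

lemma tau_polys_sum: "(\<And>i. i \<in> I \<Longrightarrow> f i \<in> tau_polys q B) \<Longrightarrow> sum f I \<in> tau_polys q B"
  by (induction I rule: infinite_finite_induct) (auto intro: tau_polys_0 tau_polys_add)

lemma tau_polys_monom: "c \<in> B \<Longrightarrow> monom c (q ^ i) \<in> tau_polys q B"
  using subring_0[OF B] by (auto simp: tau_polys_def)

lemma tau_polys_smult: "c \<in> B \<Longrightarrow> f \<in> tau_polys q B \<Longrightarrow> smult c f \<in> tau_polys q B"
  using subring_mult[OF B] by (auto simp: tau_polys_def)

end

text \<open>Additivity is asked for polynomials: constant polynomials then give it for values, and
  general ones give it for compositions of twisted polynomials.\<close>

locale frobenius_additive =
  fixes q :: nat and type :: "'b::field itself"
  assumes q_gt_1: "q > 1"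
    and frob_add: "\<And>f g :: 'b poly. (f + g) ^ q = f ^ q + g ^ q"
begin

lemma q_pos: "q > 0"
  using q_gt_1 by simp

lemma frob_power_add: "(f + g :: 'b poly) ^ (q ^ i) = f ^ (q ^ i) + g ^ (q ^ i)"
  by (induction i arbitrary: f g) (simp_all add: power_mult frob_add)

lemma frob_sum: "sum f I ^ q = (\<Sum>i\<in>I. f i ^ q :: 'b poly)"
  by (induction I rule: infinite_finite_induct) (use q_pos in \<open>auto simp: frob_add\<close>)

lemma tau_pcompose_add:
  fixes f g h :: "'b poly"
  assumes "f \<in> tau_polys q B"
  shows "f \<circ>\<^sub>p (g + h) = f \<circ>\<^sub>p g + f \<circ>\<^sub>p h"
proof -
  have "smult (coeff f n) ((g + h) ^ n) = smult (coeff f n) (g ^ n) + smult (coeff f n) (h ^ n)" for n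
  proof (cases "coeff f n = 0")
    case False
    then obtain i where "n = q ^ i"
      using tau_polysD(2)[OF assms] by blast
    thus ?thesis by (simp add: frob_power_add smult_add_right)
  qed auto
  thus ?thesis
    by (simp add: pcompose_conv_sum sum.distrib)
qed

lemma tau_pcompose_diff:
  fixes f g h :: "'b poly"
  assumes "f \<in> tau_polys q B"
  shows "f \<circ>\<^sub>p (g - h) = f \<circ>\<^sub>p g - f \<circ>\<^sub>p h"
  using tau_pcompose_add[OF assms, of "g - h" h] by simp

lemma tau_poly_add:
  assumes "f \<in> tau_polys q B"
  shows "poly f (x + y :: 'b) = poly f x + poly f y"
proof -
  have "[:poly f (x + y):] = f \<circ>\<^sub>p ([:x:] + [:y:])"
    by (simp add: pcompose_pCons_0)
  also have "\<dots> = [:poly f x + poly f y:]"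
    by (simp only: tau_pcompose_add[OF assms] pcompose_pCons_0) simp
  finally show ?thesis by simp
qed

text \<open>By additivity the q-th power can be taken monomial by monomial; it turns the exponent
  \<open>q ^ i\<close> into \<open>q ^ Suc i\<close>. Left multiplication by tau thus preserves
  twisted polynomials.\<close>

lemma tau_polys_frob:
  fixes g :: "'b poly"
  assumes B: "is_subring B" and g: "g \<in> tau_polys q B"
  shows "g ^ q \<in> tau_polys q B"
proof -
  have "g ^ q = (\<Sum>n\<le>degree g. monom (coeff g n) n) ^ q"
    by (simp add: poly_as_sum_of_monoms)
  also have "\<dots> = (\<Sum>n\<le>degree g. monom (coeff g n ^ q) (n * q))"
    by (simp add: frob_sum monom_power mult.commute)
  also have "\<dots> \<in> tau_polys q B"
  proof (rule tau_polys_sum[OF B])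
    fix n
    show "monom (coeff g n ^ q) (n * q) \<in> tau_polys q B"
    proof (cases "coeff g n = 0")
      case True
      thus ?thesis using q_pos tau_polys_0[OF B] by (simp add: power_0_left)
    next
      case False
      then obtain i where "n = q ^ i"
        using tau_polysD(2)[OF g] by blast
      thus ?thesis
        using tau_polys_monom[OF B subring_power[OF B tau_polysD(1)[OF g]], of n q q "Suc i"]
        by (simp add: mult.commute)
    qed
  qed
  finally show ?thesis .
qed

lemma tau_polys_pcompose:
  fixes f g :: "'b poly"
  assumes B: "is_subring B" and f: "f \<in> tau_polys q B" and g: "g \<in> tau_polys q B"
  shows "f \<circ>\<^sub>p g \<in> tau_polys q B"
  unfolding pcompose_conv_sum
proof (rule tau_polys_sum[OF B])
  fix n
  have frob_power: "g ^ (q ^ i) \<in> tau_polys q B" for i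
  proof (induction i)
    case (Suc i)
    have "g ^ q ^ Suc i = (g ^ q ^ i) ^ q"
      by (simp add: mult.commute flip: power_mult)
    thus ?case using tau_polys_frob[OF B Suc.IH] by simp
  qed (use g in simp)
  show "smult (coeff f n) (g ^ n) \<in> tau_polys q B"
    using tau_polysD[OF f, of n] frob_power tau_polys_smult[OF B] tau_polys_0[OF B]
    by (cases "coeff f n = 0") auto
qed

text \<open>Compare the coefficients of X in (X + 1)^q = X^q + 1.\<close>

lemma of_nat_q: "of_nat q = (0 :: 'b)"
proof -
  have "coeff (([:0, 1:] + [:1:] :: 'b poly) ^ q) 1 = coeff ([:0, 1:] ^ q + [:1:] ^ q :: 'b poly) 1"
    by (simp only: frob_add)
  moreover have "[:0, 1:] + [:1:] = [:1, 1 :: 'b:]" "[:1:] ^ q = (1 :: 'b poly)"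
    by (simp, simp flip: one_pCons)
  moreover have "coeff ([:0, 1 :: 'b:] ^ q) 1 = 0" "coeff ([:1, 1 :: 'b:] ^ q) 1 = of_nat q"
    using q_gt_1 by (simp_all only: coeff_linear_poly_power less_imp_le) (simp_all add: power_0_left)
  ultimately show ?thesis by simp
qed

text \<open>All exponents other than 1 are multiples of q, hence zero in the field. The derivative
  is therefore the constant given by the tangent, and a nonzero tangent means separability.\<close>

lemma pderiv_tau:
  fixes f :: "'b poly"
  assumes "f \<in> tau_polys q B"
  shows "pderiv f = [:coeff f 1:]"
proof (rule poly_eqI)
  fix n
  have "of_nat (Suc n) * coeff f (Suc n) = 0" if "n > 0"
  proof (cases "coeff f (Suc n) = 0")
    case False
    then obtain i where i: "Suc n = q ^ i"
      using tau_polysD(2)[OF assms] by blast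
    moreover from this that have "i \<noteq> 0"
      by (intro notI) simp
    ultimately have "of_nat (Suc n) = (0 :: 'b)"
      using of_nat_q by (simp only: of_nat_power) (simp add: power_0_left)
    thus ?thesis by (simp only: mult_zero_left)
  qed simp
  thus "coeff (pderiv f) n = coeff [:coeff f 1:] n"
    by (cases n) (simp_all only: coeff_pderiv coeff_pCons_0 coeff_pCons_Suc, simp_all)
qed

text \<open>The twisted polynomial ring over a field has a right division algorithm: leading terms
  of \<open>f\<close> are removed by left multiples of \<open>h\<close>.\<close>

lemma tau_right_division:
  fixes f h :: "'b poly"
  assumes B: "is_subring B" and inv: "\<And>x. x \<in> B \<Longrightarrow> inverse x \<in> B"
    and f: "f \<in> tau_polys q B" and h: "h \<in> tau_polys q B" "h \<noteq> 0"
  shows "\<exists>g\<in>tau_polys q B. f - g \<circ>\<^sub>p h = 0 \<or> degree (f - g \<circ>\<^sub>p h) < degree h"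
  using f
proof (induction "degree f" arbitrary: f rule: less_induct)
  case less
  show ?case
  proof (cases "f = 0 \<or> degree f < degree h")
    case True
    thus ?thesis using tau_polys_0[OF B] by (intro bexI[of _ 0]) auto
  next
    case False
    obtain k where k: "degree h = q ^ k"
      using tau_polys_degree h by blast
    obtain i where i: "degree f = q ^ i"
      using tau_polys_degree[OF less.prems] False by blast
    have "k \<le> i"
      using False i k q_gt_1 by (simp add: not_less)
    \<comment> \<open>The factor tau^(i - k) raises the leading coefficient of \<open>h\<close> to
      the power \<open>q ^ (i - k)\<close>, so this is what \<open>c\<close> must divide by for the
      leading terms to agree.\<close>
    define c where "c = lead_coeff f * inverse (lead_coeff h ^ (q ^ (i - k)))"
    define g where "g = monom c (q ^ (i - k))"
    have "c \<in> B"
      unfolding c_def using tau_polysD(1)[OF less.prems] tau_polysD(1)[OF h(1)]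
      by (intro subring_mult[OF B] inv subring_power[OF B]) auto
    hence g: "g \<in> tau_polys q B"
      unfolding g_def by (rule tau_polys_monom[OF B])
    have "g \<circ>\<^sub>p h = smult c (h ^ (q ^ (i - k)))"
      by (simp add: g_def monom_altdef pcompose_smult pcompose_hom.hom_power pcompose_pCons)
    moreover have "c \<noteq> 0"
      using False h by (simp add: c_def)
    ultimately have deg_gh: "degree (g \<circ>\<^sub>p h) = q ^ i"
      using \<open>k \<le> i\<close> h(2) by (simp add: degree_power_eq k flip: power_add)
    have "lead_coeff h \<noteq> 0"
      using h(2) by simp
    hence "lead_coeff (g \<circ>\<^sub>p h) = lead_coeff f"
      unfolding \<open>g \<circ>\<^sub>p h = smult c (h ^ (q ^ (i - k)))\<close> lead_coeff_smult lead_coeff_power c_def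
      by (simp del: leading_coeff_0_iff)
    with deg_gh have gh: "degree (g \<circ>\<^sub>p h) = degree f" "lead_coeff (g \<circ>\<^sub>p h) = lead_coeff f"
      by (simp_all add: i)
    define f' where "f' = f - g \<circ>\<^sub>p h"
    have f': "f' \<in> tau_polys q B"
      unfolding f'_def by (intro tau_polys_diff[OF B] tau_polys_pcompose[OF B] less.prems g h)
    have "\<exists>g'\<in>tau_polys q B. f' - g' \<circ>\<^sub>p h = 0 \<or> degree (f' - g' \<circ>\<^sub>p h) < degree h"
    proof (cases "f' = 0")
      case True
      thus ?thesis using tau_polys_0[OF B] by (intro bexI[of _ 0]) auto
    next
      case False
      have "degree f' < degree f"
      proof (rule degree_lessI)
        show "\<forall>j\<ge>degree f. coeff f' j = 0"
        proof safe
          fix j assume "j \<ge> degree f"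
          thus "coeff f' j = 0"
            using gh by (cases "j = degree f") (auto simp: f'_def coeff_eq_0)
        qed
      qed (use False in auto)
      thus ?thesis using less.hyps f' by blast
    qed
    then obtain g' where g': "g' \<in> tau_polys q B" "f' - g' \<circ>\<^sub>p h = 0 \<or> degree (f' - g' \<circ>\<^sub>p h) < degree h"
      by blast
    have "f - (g + g') \<circ>\<^sub>p h = f' - g' \<circ>\<^sub>p h"
      by (simp add: f'_def pcompose_add)
    thus ?thesis
      using g'(2) tau_polys_add[OF B g g'(1)] by (intro bexI[of _ "g + g'"]) auto
  qed
qed

text \<open>The remainder of right division by \<open>h\<close> vanishes at every root of
  \<open>h\<close>; since \<open>h\<close> has as many roots as its degree, the remainder is
  zero.\<close>

lemma tau_factor_through:
  fixes f h :: "'b poly"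
  assumes B: "is_subring B" "\<And>x. x \<in> B \<Longrightarrow> inverse x \<in> B"
    and f: "f \<in> tau_polys q B" and h: "h \<in> tau_polys q B" "h \<noteq> 0"
    and card: "card {x. poly h x = 0} = degree h"
    and vanish: "\<And>x. poly h x = 0 \<Longrightarrow> poly f x = 0"
  obtains g where "g \<in> tau_polys q B" "f = g \<circ>\<^sub>p h"
proof -
  obtain g where g: "g \<in> tau_polys q B" "f - g \<circ>\<^sub>p h = 0 \<or> degree (f - g \<circ>\<^sub>p h) < degree h"
    using tau_right_division[OF B f h] by blast
  have "f - g \<circ>\<^sub>p h = 0"
  proof (rule ccontr)
    assume nz: "f - g \<circ>\<^sub>p h \<noteq> 0"
    have "{x. poly h x = 0} \<subseteq> {x. poly (f - g \<circ>\<^sub>p h) x = 0}"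
      using vanish tau_polys_poly_0[OF q_pos g(1)] by (auto simp: poly_pcompose)
    hence "card {x. poly h x = 0} \<le> card {x. poly (f - g \<circ>\<^sub>p h) x = 0}"
      by (intro card_mono poly_roots_finite nz)
    also have "\<dots> \<le> degree (f - g \<circ>\<^sub>p h)"
      by (rule card_poly_roots_bound[OF nz])
    finally show False
      using g(2) nz card by simp
  qed
  thus ?thesis using that g(1) by simp
qed

end

lemma frobenius_additive_hom:
  assumes hom: "\<And>n. of_nat n = (0 :: 'a::{finite,field}) \<Longrightarrow> of_nat n = (0 :: 'b::field)"
  shows "frobenius_additive TYPE('b) CARD('a)"
proof
  show gt: "CARD('a) > 1"
    by (rule card_field_gt_1)
  fix f g :: "'b poly"
  define q where "q = CARD('a)"
  have binom: "of_nat (q choose i) = (0 :: 'b poly)" if "0 < i" "i < q" for i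
    using hom[OF of_nat_binomial_card_eq_0] that by (simp add: q_def of_nat_poly)
  have "(f + g) ^ q = (\<Sum>i\<le>q. of_nat (q choose i) * f ^ i * g ^ (q - i))"
    by (rule binomial_ring)
  also have "\<dots> = (\<Sum>i\<in>{0, q}. of_nat (q choose i) * f ^ i * g ^ (q - i))"
    by (rule sum.mono_neutral_right) (auto simp: binom)
  also have "\<dots> = f ^ q + g ^ q"
    using gt by (simp add: q_def add.commute)
  finally show "(f + g) ^ CARD('a) = f ^ CARD('a) + g ^ CARD('a)"
    by (simp add: q_def)
qed

text \<open>A repeated root would also be a root of the derivative, which is a nonzero
  constant.\<close>

lemma card_roots_separable:
  fixes f :: "'b::alg_closed_field poly"
  assumes "pderiv f = [:c:]" "c \<noteq> 0"
  shows "card {x. poly f x = 0} = degree f"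
    and "f = smult (lead_coeff f) (\<Prod>x\<in>{x. poly f x = 0}. [:- x, 1:])"
proof -
  have "f \<noteq> 0"
    using assms by auto
  then obtain A where A: "size A = degree f" "f = smult (lead_coeff f) (\<Prod>x\<in>#A. [:- x, 1:])"
    using alg_closed_imp_factorization by blast
  have set_A: "set_mset A = {x. poly f x = 0}"
    using \<open>f \<noteq> 0\<close> by (subst A(2)) (auto simp: poly_prod_mset prod_mset_zero_iff)
  have "count A x = 1" if "x \<in># A" for x
  proof (rule ccontr)
    assume "count A x \<noteq> 1"
    hence "count A x \<ge> 2"
      using that by (metis One_nat_def Suc_1 count_eq_zero_iff less_2_cases_iff not_less)
    hence "replicate_mset 2 x \<subseteq># A"
      by (simp add: count_le_replicate_mset_subset_eq)
    then obtain C where "A = add_mset x (add_mset x C)"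
      by (metis add_mset_add_single mset_subset_eq_exists_conv numeral_2_eq_2 replicate_mset_Suc
          replicate_mset_0 union_mset_add_mset_left add_mset_commute empty_neutral(1))
    hence "f = [:- x, 1:] * ([:- x, 1:] * smult (lead_coeff f) (\<Prod>y\<in>#C. [:- y, 1:]))"
      by (subst A(2)) simp
    then obtain g where g: "f = [:- x, 1:] * ([:- x, 1:] * g)" by blast
    have "poly (pderiv f) x = 0"
      unfolding g pderiv_mult poly_add poly_mult by simp
    thus False using assms by simp
  qed
  hence "A = mset_set (set_mset A)"
    by (intro multiset_eqI) (metis count_mset_set(1) count_mset_set(3) finite_set_mset not_in_iff)
  thus "f = smult (lead_coeff f) (\<Prod>x\<in>{x. poly f x = 0}. [:- x, 1:])"
    using A(2) set_A by (metis prod_unfold_prod_mset)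
  show "card {x. poly f x = 0} = degree f"
    using A(1) set_A \<open>A = mset_set (set_mset A)\<close> by (metis size_mset_set)
qed

section \<open>Integral elements\<close>

locale integral_over = comm_ring_hom e for e :: "'r::comm_ring_1 \<Rightarrow> 'c::field"
begin

definition integral :: "'c \<Rightarrow> bool" where
  "integral x \<longleftrightarrow> (\<exists>p. lead_coeff p = 1 \<and> (\<forall>i. coeff p i \<in> range e) \<and> poly p x = 0)"

sublocale alg: Modules.module "\<lambda>a x. e a * x"
  by unfold_locales (auto simp: algebra_simps hom_distribs)

text \<open>The determinant trick: multiplication by \<open>z\<close> on the generators
  \<open>G\<close> is given by a matrix over the base ring, the vector of generators is an
  eigenvector for \<open>z\<close>, and the characteristic polynomial is monic.\<close>

lemma integral_charpoly:
  assumes G: "finite G" "g0 \<in> G" "g0 \<noteq> 0" and stable: "\<And>g. g \<in> G \<Longrightarrow> z * g \<in> alg.span G"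
  shows "integral z"
proof -
  obtain gs where gs: "set gs = G" "distinct gs"
    using G(1) finite_distinct_list by blast
  define n where "n = length gs"
  have "\<exists>c. z * g = (\<Sum>h\<in>G. e (c h) * h)" if "g \<in> G" for g
    using stable[OF that] by (auto simp: alg.span_finite[OF G(1)])
  then obtain c where c: "\<And>g. g \<in> G \<Longrightarrow> z * g = (\<Sum>h\<in>G. e (c g h) * h)"
    by metis
  \<comment> \<open>The entries are taken in the base ring, so that the coefficients of the
    characteristic polynomial land in \<open>range e\<close> after applying
    \<open>e\<close>.\<close>
  define M where "M = mat n n (\<lambda>(i, j). c (gs ! i) (gs ! j))"
  define x where "x = vec n (\<lambda>i. gs ! i)"
  have M: "M \<in> carrier_mat n n"
    by (simp add: M_def)
  have "map_mat e M *\<^sub>v x = z \<cdot>\<^sub>v x"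
  proof (rule eq_vecI)
    fix i assume "i < dim_vec (z \<cdot>\<^sub>v x)"
    hence i: "i < n" by (simp add: x_def)
    have "(map_mat e M *\<^sub>v x) $ i = (\<Sum>j<n. e (c (gs ! i) (gs ! j)) * gs ! j)"
      using i M by (subst index_mult_mat_vec)
        (auto simp: M_def x_def scalar_prod_def lessThan_atLeast0 intro!: sum.cong)
    also have "\<dots> = (\<Sum>h\<in>G. e (c (gs ! i) h) * h)"
      by (rule sum.reindex_bij_betw)
         (use bij_betw_nth[OF gs(2)] gs(1) in \<open>simp add: n_def\<close>)
    also have "\<dots> = z * gs ! i"
      using c[of "gs ! i"] i gs(1) by (auto simp: n_def)
    finally show "(map_mat e M *\<^sub>v x) $ i = (z \<cdot>\<^sub>v x) $ i"
      using i by (simp add: x_def)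
  qed (simp add: M_def x_def)
  moreover have "x \<noteq> 0\<^sub>v n"
  proof
    assume "x = 0\<^sub>v n"
    moreover obtain i where "i < n" "gs ! i = g0"
      using G(2) gs(1) by (metis in_set_conv_nth n_def)
    moreover from this have "x $ i = g0"
      by (simp add: x_def)
    ultimately show False using G(3) by simp
  qed
  ultimately have "eigenvalue (map_mat e M) z"
    using M unfolding eigenvalue_def eigenvector_def by (intro exI[of _ x]) (auto simp: x_def M_def)
  hence "poly (map_poly e (char_poly M)) z = 0"
    using eigenvalue_root_char_poly[of "map_mat e M" n z] M by (simp add: char_poly_hom[OF M])
  moreover have "lead_coeff (map_poly e (char_poly M)) = 1"
    using degree_monic_char_poly[of "map_mat e M" n] M by (simp add: char_poly_hom[OF M])
  ultimately show ?thesis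
    unfolding integral_def by (intro exI[of _ "map_poly e (char_poly M)"]) simp
qed

text \<open>The span of \<open>G\<close> is a subring of the field that is finitely generated as a
  module over the base ring.\<close>

definition finite_algebra :: "'c set \<Rightarrow> bool" where
  "finite_algebra G \<longleftrightarrow> finite G \<and> 1 \<in> alg.span G \<and> (\<forall>x\<in>alg.span G. \<forall>y\<in>alg.span G. x * y \<in> alg.span G)"

lemma finite_algebra_range: "finite_algebra G \<Longrightarrow> e a \<in> alg.span G"
  using alg.span_scale[of 1 G a] by (simp add: finite_algebra_def)

lemma finite_algebra_integral:
  assumes "finite_algebra G" "z \<in> alg.span G"
  shows "integral z"
proof -
  have "\<exists>g\<in>G. g \<noteq> 0"
  proof (rule ccontr)
    assume "\<not> (\<exists>g\<in>G. g \<noteq> 0)"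
    hence "alg.span G \<subseteq> alg.span {0}"
      by (intro alg.span_mono) auto
    moreover have "alg.span {0} = {0}"
      by (simp add: alg.span_finite image_def)
    ultimately show False using assms(1) by (auto simp: finite_algebra_def)
  qed
  then obtain g where "g \<in> G" "g \<noteq> 0" by blast
  thus ?thesis
    using assms by (intro integral_charpoly[of G g]) (auto simp: finite_algebra_def alg.span_base)
qed

text \<open>If b runs over the span of \<open>G\<close>, the products b z^i with i below the degree
  of the monic equation of \<open>z\<close> already span the ring obtained by adjoining
  \<open>z\<close>.\<close>

lemma finite_algebra_adjoin:
  assumes G: "finite_algebra G" and p: "lead_coeff p = 1" "\<And>i. coeff p i \<in> alg.span G" "poly p z = 0"
  obtains G' where "finite_algebra G'" "alg.span G \<subseteq> alg.span G'" "z \<in> alg.span G'"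
proof -
  define n where "n = degree p"
  define B where "B = alg.span G"
  define G' where "G' = (\<lambda>(g, i). g * z ^ i) ` (G \<times> {..<n})"
  define B' where "B' = alg.span G'"
  have B_mult: "x * y \<in> B" if "x \<in> B" "y \<in> B" for x y
    using G that by (simp add: B_def finite_algebra_def)
  have "1 \<in> B"
    using G by (simp add: B_def finite_algebra_def)
  have "n > 0"
  proof (rule ccontr)
    assume "\<not> n > 0"
    hence "p = 1"
      using p(1) by (auto simp: n_def one_pCons elim!: degree_eq_zeroE)
    thus False using p(3) by simp
  qed
  have low: "b * z ^ i \<in> B'" if "b \<in> B" "i < n" for b i
    using that(1) unfolding B_def
  proof (induction b rule: alg.span_induct_alt)
    case (step c x y)
    have "x * z ^ i \<in> B'"
      unfolding B'_def using step(1) that(2) by (intro alg.span_base) (auto simp: G'_def)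
    thus ?case
      using step(2) alg.span_add[of "e c * (x * z ^ i)" G' "y * z ^ i"] alg.span_scale[of "x * z ^ i" G' c]
      by (simp add: B'_def algebra_simps)
  qed (simp add: B'_def alg.span_zero)
  \<comment> \<open>Higher powers of \<open>z\<close> are lowered by the monic equation, whose
    coefficients lie in \<open>B\<close>; each resulting exponent is strictly below
    \<open>m\<close>.\<close>
  have high: "b * z ^ m \<in> B'" if "b \<in> B" for b m
    using that
  proof (induction m arbitrary: b rule: less_induct)
    case (less m)
    show ?case
    proof (cases "m < n")
      case False
      have "(\<Sum>i\<le>n. coeff p i * z ^ i) = 0"
        using p(3) by (simp add: poly_altdef n_def)
      moreover have "{..n} = insert n {..<n}" by auto
      ultimately have "z ^ n = - (\<Sum>i<n. coeff p i * z ^ i)"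
        using p(1) by (simp add: n_def eq_neg_iff_add_eq_0)
      hence "b * z ^ n * z ^ (m - n) = - (\<Sum>i<n. b * coeff p i * z ^ (i + (m - n)))"
        by (simp add: power_add sum_distrib_left sum_distrib_right mult_ac)
      moreover have "b * z ^ n * z ^ (m - n) = b * z ^ m"
        using False by (simp add: mult.assoc flip: power_add)
      moreover have "b * coeff p i * z ^ (i + (m - n)) \<in> B'" if "i < n" for i
        using that False less.prems p(2) by (intro less.IH B_mult) (auto simp: B_def)
      ultimately show ?thesis
        unfolding B'_def using alg.span_neg alg.span_sum by (metis (no_types, lifting) lessThan_iff)
    qed (use low less.prems in auto)
  qed
  have "x * y \<in> B'" if "x \<in> B'" "y \<in> B'" for x y
    using that(1) unfolding B'_def
  proof (induction x rule: alg.span_induct_alt)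
    case base
    thus ?case by (simp add: alg.span_zero)
  next
    case (step c x x')
    then obtain g i where x: "x = g * z ^ i" "g \<in> G"
      by (auto simp: G'_def)
    have "x * y \<in> B'"
      using that(2) unfolding B'_def
    proof (induction y rule: alg.span_induct_alt)
      case base
      thus ?case by (simp add: alg.span_zero)
    next
      case (step d y y')
      then obtain h j where y: "y = h * z ^ j" "h \<in> G"
        by (auto simp: G'_def)
      have "g * h * z ^ (i + j) \<in> B'"
        using x y by (intro high B_mult) (auto simp: B_def alg.span_base)
      moreover have "g * h * z ^ (i + j) = x * y"
        by (simp add: x y power_add)
      ultimately have "x * y \<in> B'" by simp
      thus ?case
        using step(2) alg.span_add[of "e d * (x * y)" G' "x * y'"] alg.span_scale[of "x * y" G' d]
        by (simp add: B'_def algebra_simps)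
    qed
    thus ?case
      using step(2) alg.span_add[of "e c * (x * y)" G' "x' * y"] alg.span_scale[of "x * y" G' c]
      by (simp add: B'_def algebra_simps)
  qed
  moreover have "1 \<in> B'"
    using high[OF \<open>1 \<in> B\<close>, of 0] by simp
  moreover have "finite G'"
    using G by (simp add: G'_def finite_algebra_def)
  ultimately have "finite_algebra G'"
    by (simp add: finite_algebra_def B'_def)
  moreover have "B \<subseteq> B'"
    using high[of _ 0] by auto
  moreover have "z \<in> B'"
    using high[OF \<open>1 \<in> B\<close>, of 1] by simp
  ultimately show ?thesis using that by (simp add: B_def B'_def)
qed

lemma finite_algebra_containing:
  assumes "finite S" "\<And>x. x \<in> S \<Longrightarrow> integral x"
  shows "\<exists>G. finite_algebra G \<and> S \<subseteq> alg.span G"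
  using assms
proof (induction S rule: finite_induct)
  case empty
  have "alg.span {1} = range e"
    by (auto simp: alg.span_finite image_iff intro: exI[of _ "\<lambda>_. _"])
  moreover have "1 \<in> range e"
    using hom_one by (metis rangeI)
  moreover have "x * y \<in> range e" if "x \<in> range e" "y \<in> range e" for x y
    using that by (auto simp flip: hom_mult)
  ultimately have "finite_algebra {1}"
    by (simp add: finite_algebra_def)
  thus ?case by blast
next
  case (insert x S)
  then obtain G where G: "finite_algebra G" "S \<subseteq> alg.span G" by auto
  obtain p where p: "lead_coeff p = 1" "\<And>i. coeff p i \<in> range e" "poly p x = 0"
    using insert.prems[of x] by (auto simp: integral_def)
  have "coeff p i \<in> alg.span G" for i
    using p(2)[of i] finite_algebra_range[OF G(1)] by auto
  then obtain G' where "finite_algebra G'" "alg.span G \<subseteq> alg.span G'" "x \<in> alg.span G'"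
    using finite_algebra_adjoin[OF G(1) p(1) _ p(3)] by blast
  thus ?case using G(2) by blast
qed

text \<open>Transitivity of integrality: the finitely many coefficients lie in one finite algebra,
  and adjoining \<open>z\<close> to it gives a finite algebra again.\<close>

lemma integral_root:
  assumes "lead_coeff p = 1" "\<And>i. integral (coeff p i)" "poly p z = 0"
  shows "integral z"
proof -
  obtain G where G: "finite_algebra G" "coeff p ` {..degree p} \<subseteq> alg.span G"
    using finite_algebra_containing[of "coeff p ` {..degree p}"] assms(2) by auto
  have "coeff p i \<in> alg.span G" for i
    using G(2) alg.span_zero[of G] by (cases "i \<le> degree p") (auto simp: coeff_eq_0)
  then obtain G' where "finite_algebra G'" "z \<in> alg.span G'"
    using finite_algebra_adjoin[OF G(1) assms(1) _ assms(3)] by blast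
  thus ?thesis using finite_algebra_integral by blast
qed

text \<open>Substituting X^n into a monic equation of \<open>z ^ n\<close> gives one for
  \<open>z\<close>, still monic because \<open>n\<close> is positive.\<close>

lemma integral_of_power:
  assumes "integral (z ^ n)" "n > 0"
  shows "integral z"
proof -
  obtain p where p: "lead_coeff p = 1" "\<And>i. coeff p i \<in> range e" "poly p (z ^ n) = 0"
    using assms(1) by (auto simp: integral_def)
  have rng: "0 \<in> range e" "1 \<in> range e"
    using hom_zero hom_one by (metis rangeI)+
  define r where "r = p \<circ>\<^sub>p monom 1 n"
  have "lead_coeff r = 1"
    using assms(2) p(1) unfolding r_def by (subst lead_coeff_comp) (auto simp: degree_monom_eq)
  moreover have "coeff r i \<in> range e" for i
    unfolding r_def by (rule coeff_pcompose_semiring_closed)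
      (use rng p(2) in \<open>auto simp: simp flip: hom_mult hom_add\<close>)
  moreover have "poly r z = 0"
    using p(3) by (simp add: r_def poly_pcompose poly_monom)
  ultimately show ?thesis by (auto simp: integral_def)
qed

end

section \<open>The embedding of A into the ambient field\<close>

lemma comm_ring_hom_A_emb:
  assumes "\<iota> \<in> Ring.ring_hom ring_of_type_algebra ring_of_type_algebra"
  shows "comm_ring_hom (A_emb \<iota>)"
proof -
  have add: "\<iota> (x + y) = \<iota> x + \<iota> y" and mult: "\<iota> (x * y) = \<iota> x * \<iota> y" and one: "\<iota> 1 = 1" for x y
    using assms by (auto simp: Ring.ring_hom_def ring_of_type_algebra_def)
  have zero: "\<iota> 0 = 0"
    using add[of 0 0] by (metis add.right_neutral add_left_cancel)
  interpret fc: comm_ring_hom "fls_const :: 'a \<Rightarrow> 'a fls"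
    by unfold_locales (auto simp: fls_eq_iff)
  interpret mp: map_poly_comm_ring_hom "fls_const :: 'a \<Rightarrow> 'a fls" ..
  show ?thesis
    by unfold_locales (auto simp: A_emb_def add mult one zero mp.hom_add mp.hom_mult)
qed

text \<open>The map \<iota> is injective as a homomorphism from a field. Since
  \<open>fls_X_inv\<close> stands for t, the coefficient of t^n is found at position -n of the
  Laurent series.\<close>

lemma A_emb_eq_0_iff:
  assumes "\<iota> \<in> Ring.ring_hom ring_of_type_algebra ring_of_type_algebra"
  shows "A_emb \<iota> a = 0 \<longleftrightarrow> a = 0"
proof
  assume "A_emb \<iota> a = 0"
  have mult: "\<iota> (x * y) = \<iota> x * \<iota> y" and one: "\<iota> 1 = 1" for x y
    using assms by (auto simp: Ring.ring_hom_def ring_of_type_algebra_def)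
  define f where "f = poly (map_poly fls_const a) fls_X_inv"
  have "\<iota> f = 0"
    using \<open>A_emb \<iota> a = 0\<close> by (simp add: A_emb_def f_def)
  have "f = 0"
  proof (rule ccontr)
    assume "f \<noteq> 0"
    hence "\<iota> f * \<iota> (inverse f) = 1"
      by (simp add: one flip: mult)
    thus False by (simp add: \<open>\<iota> f = 0\<close>)
  qed
  have "coeff a n = 0" for n
  proof (cases "n \<le> degree a")
    case True
    have "degree (map_poly fls_const a) = degree a"
      by (rule degree_map_poly) simp
    hence "f = (\<Sum>i\<le>degree a. fls_const (coeff a i) * fls_X_inv ^ i)"
      by (simp add: f_def poly_altdef coeff_map_poly)
    hence "fls_nth f (- int n) = (\<Sum>i\<le>degree a. coeff a i * (if i = n then 1 else 0))"
      by (auto simp: fls_nth_sum intro!: sum.cong)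
    also have "\<dots> = coeff a n"
      using True by (simp add: if_distrib[of "\<lambda>x. _ * x"] cong: if_cong)
    finally show ?thesis using \<open>f = 0\<close> by simp
  qed (simp add: coeff_eq_0)
  thus "a = 0" by (simp add: poly_eq_iff)
next
  interpret comm_ring_hom "A_emb \<iota>"
    using comm_ring_hom_A_emb[OF assms] .
  assume "a = 0" thus "A_emb \<iota> a = 0" by simp
qed

section \<open>Localizations and reduction\<close>

text \<open>The form of \<open>primeideal\<close> for plain sets with type class operations;
  \<open>primeideal_subring_of\<close> identifies the two, and all later ideal arguments use this
  one.\<close>

definition prime_in :: "'b::comm_ring_1 set \<Rightarrow> 'b set \<Rightarrow> bool" where
  "prime_in R v \<longleftrightarrow> is_subring R \<and> v \<subseteq> R \<and> 0 \<in> v \<and> 1 \<notin> v \<and>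
     (\<forall>x\<in>v. \<forall>y\<in>v. x - y \<in> v) \<and> (\<forall>x\<in>R. \<forall>y\<in>v. x * y \<in> v) \<and>
     (\<forall>x\<in>R. \<forall>y\<in>R. x * y \<in> v \<longrightarrow> x \<in> v \<or> y \<in> v)"

lemma cring_subring_of:
  fixes R :: "'b::field set"
  shows "cring (subring_of R) \<longleftrightarrow> is_subring R"
proof
  assume "cring (subring_of R)"
  then interpret cring "subring_of R" .
  have one: "1 \<in> R"
    using one_closed by (simp add: ring_of_type_algebra_def)
  have add: "x + y \<in> R" and mult: "x * y \<in> R" if "x \<in> R" "y \<in> R" for x y
    using that a_closed[of x y] m_closed[of x y] by (simp_all add: ring_of_type_algebra_def)
  have neg: "- x \<in> R" if "x \<in> R" for x
  proof -
    have "\<ominus>\<^bsub>subring_of R\<^esub> x \<in> R" "x + \<ominus>\<^bsub>subring_of R\<^esub> x = 0"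
      using a_inv_closed[of x] r_neg[of x] that by (simp_all add: ring_of_type_algebra_def)
    thus ?thesis by (metis add_eq_0_iff)
  qed
  show "is_subring R"
    using one mult add[OF _ neg] by (simp add: is_subring_def)
next
  assume R: "is_subring R"
  note closed = subring_0[OF R] subring_1[OF R] subring_add[OF R] subring_mult[OF R] subring_uminus[OF R]
  have "\<exists>y\<in>R. y + x = 0" if "x \<in> R" for x
    using closed(5)[OF that] by (intro bexI[of _ "- x"]) auto
  thus "cring (subring_of R)"
    by (intro cringI abelian_groupI comm_monoidI)
       (auto simp: ring_of_type_algebra_def closed algebra_simps)
qed

lemma primeideal_subring_of:
  fixes R v :: "'b::field set"
  shows "primeideal v (subring_of R) \<longleftrightarrow> prime_in R v"
proof
  assume v: "primeideal v (subring_of R)"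
  then interpret primeideal v "subring_of R" .
  have R: "is_subring R"
    using cring_axioms cring_subring_of by blast
  have sub: "v \<subseteq> R"
    using a_subset by simp
  have 0: "0 \<in> v"
    using additive_subgroup.zero_closed[OF is_additive_subgroup] by (simp add: ring_of_type_algebra_def)
  have mult: "x * y \<in> v" if "x \<in> R" "y \<in> v" for x y
    using I_l_closed[of y x] that by (simp add: ring_of_type_algebra_def)
  have "x + y \<in> v" if "x \<in> v" "y \<in> v" for x y
    using additive_subgroup.a_closed[OF is_additive_subgroup that] by (simp add: ring_of_type_algebra_def)
  moreover have "- x \<in> v" if "x \<in> v" for x
    using mult[of "- 1" x] that subring_uminus[OF R] subring_1[OF R] by simp
  ultimately have diff: "x - y \<in> v" if "x \<in> v" "y \<in> v" for x y
    using that by (metis uminus_add_conv_diff add.commute)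
  have "1 \<notin> v"
  proof
    assume "1 \<in> v"
    hence "v = R" using mult[of _ 1] sub by auto
    thus False using I_notcarr by simp
  qed
  moreover have "x \<in> v \<or> y \<in> v" if "x \<in> R" "y \<in> R" "x * y \<in> v" for x y
    using I_prime[of x y] that by (simp add: ring_of_type_algebra_def)
  ultimately show "prime_in R v"
    using R sub 0 mult diff by (auto simp: prime_in_def)
next
  assume v: "prime_in R v"
  hence R: "is_subring R" and sub: "v \<subseteq> R" and diff: "\<And>x y. x \<in> v \<Longrightarrow> y \<in> v \<Longrightarrow> x - y \<in> v"
    and mult: "\<And>x y. x \<in> R \<Longrightarrow> y \<in> v \<Longrightarrow> x * y \<in> v"
    by (auto simp: prime_in_def)
  interpret cring "subring_of R"
    using R cring_subring_of by blast
  have 0: "0 \<in> v" using v by (simp add: prime_in_def)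
  have neg: "- x \<in> v" if "x \<in> v" for x
    using diff[OF 0 that] by simp
  have add: "x + y \<in> v" if "x \<in> v" "y \<in> v" for x y
    using diff[OF that(1) neg[OF that(2)]] by simp
  have mult': "y * x \<in> v" if "x \<in> R" "y \<in> v" for x y
    using mult[OF that] by (simp add: mult.commute)
  have "ideal v (subring_of R)"
  proof (rule idealI)
    show "ring (subring_of R)" ..
    show "subgroup v (add_monoid (subring_of R))"
    proof (rule add.subgroupI)
      show "v \<subseteq> carrier (subring_of R)" using sub by simp
      show "v \<noteq> {}" using 0 by auto
    next
      fix x assume "x \<in> v"
      hence "x \<in> R" using sub by auto
      have "\<ominus>\<^bsub>subring_of R\<^esub> x \<in> R" "x + \<ominus>\<^bsub>subring_of R\<^esub> x = 0"
        using a_inv_closed[of x] r_neg[of x] \<open>x \<in> R\<close> by (simp_all add: ring_of_type_algebra_def)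
      hence "\<ominus>\<^bsub>subring_of R\<^esub> x = - x" by (metis add_eq_0_iff)
      thus "\<ominus>\<^bsub>subring_of R\<^esub> x \<in> v"
        using neg[OF \<open>x \<in> v\<close>] by simp
    next
      fix x y assume "x \<in> v" "y \<in> v"
      thus "x \<oplus>\<^bsub>subring_of R\<^esub> y \<in> v"
        using add by (simp add: ring_of_type_algebra_def)
    qed
  qed (use mult mult' in \<open>auto simp: ring_of_type_algebra_def\<close>)
  thus "primeideal v (subring_of R)"
    by (intro primeidealI cring_axioms) (use v subring_1[OF R] in \<open>auto simp: prime_in_def ring_of_type_algebra_def\<close>)
qed

context
  fixes R v :: "'b::comm_ring_1 set"
  assumes v: "prime_in R v"
begin

lemma prime_in_subring: "is_subring R"
  and prime_in_subset: "v \<subseteq> R"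
  and prime_in_0: "0 \<in> v"
  and prime_in_1: "1 \<notin> v"
  and prime_in_diff: "x \<in> v \<Longrightarrow> y \<in> v \<Longrightarrow> x - y \<in> v"
  and prime_in_mult: "x \<in> R \<Longrightarrow> y \<in> v \<Longrightarrow> x * y \<in> v"
  and prime_in_prime: "x \<in> R \<Longrightarrow> y \<in> R \<Longrightarrow> x * y \<in> v \<Longrightarrow> x \<in> v \<or> y \<in> v"
  using v by (auto simp: prime_in_def)

lemma prime_in_add: "x \<in> v \<Longrightarrow> y \<in> v \<Longrightarrow> x + y \<in> v"
  using prime_in_diff[OF _ prime_in_diff[OF prime_in_0]] by force

lemma prime_in_notin_mult:
  "x \<in> R \<Longrightarrow> x \<notin> v \<Longrightarrow> y \<in> R \<Longrightarrow> y \<notin> v \<Longrightarrow> x * y \<in> R \<and> x * y \<notin> v"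
  using prime_in_prime subring_mult[OF prime_in_subring] by blast

lemma prime_in_power: "x \<in> R \<Longrightarrow> x ^ n \<in> v \<Longrightarrow> x \<in> v"
  by (induction n) (use prime_in_1 prime_in_prime subring_power[OF prime_in_subring] in auto)

end

context
  fixes R v :: "'b::field set"
  assumes v: "prime_in R v"
begin

lemma localizationI: "a \<in> R \<Longrightarrow> s \<in> R \<Longrightarrow> s \<notin> v \<Longrightarrow> a / s \<in> localization R v"
  unfolding localization_def by blast

lemma localization_superset: "a \<in> R \<Longrightarrow> a \<in> localization R v"
  using localizationI[of a 1] subring_1[OF prime_in_subring[OF v]] prime_in_1[OF v] by simp

lemma localizationE:
  assumes "x \<in> localization R v"
  obtains a s where "x = a / s" "a \<in> R" "s \<in> R" "s \<notin> v" "s \<noteq> 0"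
  using assms prime_in_0[OF v] unfolding localization_def by blast

lemma is_subring_localization: "is_subring (localization R v)"
proof -
  note R = prime_in_subring[OF v]
  have "x - y \<in> localization R v \<and> x * y \<in> localization R v"
    if "x \<in> localization R v" "y \<in> localization R v" for x y
  proof -
    obtain a s where x: "x = a / s" "a \<in> R" "s \<in> R" "s \<notin> v" "s \<noteq> 0"
      using \<open>x \<in> _\<close> by (rule localizationE)
    obtain b t where y: "y = b / t" "b \<in> R" "t \<in> R" "t \<notin> v" "t \<noteq> 0"
      using \<open>y \<in> _\<close> by (rule localizationE)
    have st: "s * t \<in> R" "s * t \<notin> v"
      using prime_in_notin_mult[OF v x(3,4) y(3,4)] by auto
    have "a * t - b * s \<in> R"
      using x y by (intro subring_diff[OF R] subring_mult[OF R])
    moreover have "x - y = (a * t - b * s) / (s * t)"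
      using x y by (simp add: field_simps)
    moreover have "x * y = (a * b) / (s * t)" "a * b \<in> R"
      using x y subring_mult[OF R] by auto
    ultimately show ?thesis
      using st localizationI by metis
  qed
  thus ?thesis
    using localization_superset subring_1[OF R] by (simp add: is_subring_def)
qed

lemma localization_common_denominator:
  assumes "finite I" "\<And>i. i \<in> I \<Longrightarrow> f i \<in> localization R v"
  shows "\<exists>s\<in>R - v. \<forall>i\<in>I. s * f i \<in> R"
  using assms
proof (induction I rule: finite_induct)
  case empty
  thus ?case
    using subring_1[OF prime_in_subring[OF v]] prime_in_1[OF v] by blast
next
  case (insert i I)
  then obtain s where s: "s \<in> R" "s \<notin> v" "\<forall>i\<in>I. s * f i \<in> R" by auto
  obtain a t where t: "f i = a / t" "a \<in> R" "t \<in> R" "t \<notin> v" "t \<noteq> 0"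
    using insert.prems[of i] by (auto elim: localizationE)
  note mult = subring_mult[OF prime_in_subring[OF v]]
  have "s * t * f j \<in> R" if "j \<in> insert i I" for j
  proof (cases "j = i")
    case True
    thus ?thesis using t s mult by simp
  next
    case False
    hence "t * (s * f j) \<in> R" using that s t mult by blast
    thus ?thesis by (simp add: mult_ac)
  qed
  thus ?case
    using prime_in_notin_mult[OF v s(1,2) t(3,4)] by blast
qed

end

lemma localization_mono:
  assumes "R \<subseteq> S" "w \<inter> R = v"
  shows "localization R v \<subseteq> localization S w"
  using assms unfolding localization_def by blast

section \<open>Change of coordinate\<close>

lemma coeff_twist: "coeff (twist u f) n = u * inverse u ^ n * coeff f n"
  by (simp add: twist_def coeff_pcompose_linear)

lemma twist_pcompose:
  assumes "u \<noteq> 0"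
  shows "twist u (f \<circ>\<^sub>p g) = twist u f \<circ>\<^sub>p twist u g"
proof -
  have "[:0, inverse u:] \<circ>\<^sub>p twist u g = g \<circ>\<^sub>p [:0, inverse u:]"
    using assms by (simp add: twist_def pcompose_pCons)
  thus ?thesis
    by (simp add: twist_def pcompose_smult flip: pcompose_assoc)
qed

lemma poly_twist:
  assumes "u \<noteq> 0"
  shows "poly (twist u f) (u * x) = u * poly f x"
  using assms by (simp add: twist_def poly_pcompose field_simps)

lemma degree_twist [simp]: "u \<noteq> 0 \<Longrightarrow> degree (twist u f) = degree f"
  by (simp add: twist_def degree_pcompose)

lemma tangent_twist [simp]: "u \<noteq> 0 \<Longrightarrow> tangent (twist u f) = tangent f"
  by (simp add: coeff_twist)

text \<open>The residue map is a homomorphism only on the local ring, its values elsewhere being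
  arbitrary. Every rule therefore carries membership conditions, and polynomials are reduced only if
  their coefficients lie in \<open>B\<close>.\<close>

locale partial_hom =
  fixes B :: "'b::field set" and red :: "'b \<Rightarrow> 'd::field"
  assumes B: "is_subring B"
    and red: "red \<in> Ring.ring_hom (subring_of B) ring_of_type_algebra"
begin

lemma red_add: "x \<in> B \<Longrightarrow> y \<in> B \<Longrightarrow> red (x + y) = red x + red y"
  and red_mult: "x \<in> B \<Longrightarrow> y \<in> B \<Longrightarrow> red (x * y) = red x * red y"
  and red_1: "red 1 = 1"
  using red by (auto simp: Ring.ring_hom_def ring_of_type_algebra_def)

lemma red_0 [simp]: "red 0 = 0"
  using red_add[of 0 0] subring_0[OF B] by (metis add.right_neutral add_left_cancel)

lemma red_uminus: "x \<in> B \<Longrightarrow> red (- x) = - red x"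
  using red_add[of x "- x"] subring_uminus[OF B] by (simp add: eq_neg_iff_add_eq_0 add.commute)

lemma red_sum: "(\<And>i. i \<in> I \<Longrightarrow> f i \<in> B) \<Longrightarrow> red (sum f I) = (\<Sum>i\<in>I. red (f i))"
  by (induction I rule: infinite_finite_induct) (auto simp: red_add subring_sum[OF B])

lemma red_unit: "x \<in> B \<Longrightarrow> inverse x \<in> B \<Longrightarrow> x \<noteq> 0 \<Longrightarrow> red x \<noteq> 0"
  using red_mult[of x "inverse x"] red_1 by auto

lemma coeff_red [simp]: "coeff (map_poly red f) n = red (coeff f n)"
  by (simp add: coeff_map_poly)

definition coeffs_in :: "'b poly \<Rightarrow> bool" where
  "coeffs_in f \<longleftrightarrow> (\<forall>n. coeff f n \<in> B)"

lemma coeffs_in_tau_polys: "f \<in> tau_polys q B \<Longrightarrow> coeffs_in f"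
  by (simp add: coeffs_in_def tau_polysD)

lemma coeffs_in_0 [simp]: "coeffs_in 0"
  using subring_0[OF B] by (simp add: coeffs_in_def)

lemma coeffs_in_pCons_iff: "coeffs_in (pCons a f) \<longleftrightarrow> a \<in> B \<and> coeffs_in f"
  by (auto simp: coeffs_in_def coeff_pCons split: nat.splits)

lemma coeffs_in_mult: "coeffs_in f \<Longrightarrow> coeffs_in g \<Longrightarrow> coeffs_in (f * g)"
  unfolding coeffs_in_def
  by (intro allI coeff_mult_semiring_closed[of B])
     (auto intro: subring_0[OF B] subring_add[OF B] subring_mult[OF B])

lemma coeffs_in_pcompose: "coeffs_in f \<Longrightarrow> coeffs_in g \<Longrightarrow> coeffs_in (f \<circ>\<^sub>p g)"
  unfolding coeffs_in_def
  by (intro allI coeff_pcompose_semiring_closed[of B])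
     (auto intro: subring_0[OF B] subring_add[OF B] subring_mult[OF B])

lemma red_poly_add: "coeffs_in f \<Longrightarrow> coeffs_in g \<Longrightarrow> map_poly red (f + g) = map_poly red f + map_poly red g"
  by (rule poly_eqI) (auto simp: red_add coeffs_in_def)

lemma red_poly_mult: "coeffs_in f \<Longrightarrow> coeffs_in g \<Longrightarrow> map_poly red (f * g) = map_poly red f * map_poly red g"
  by (rule poly_eqI) (auto simp: coeff_mult red_sum red_mult subring_mult[OF B] coeffs_in_def)

lemma red_poly_const: "map_poly red [:a:] = [:red a:]"
  by (rule poly_eqI) (auto simp: coeff_pCons split: nat.splits)

lemma red_poly_pcompose:
  "coeffs_in f \<Longrightarrow> coeffs_in g \<Longrightarrow> map_poly red (f \<circ>\<^sub>p g) = map_poly red f \<circ>\<^sub>p map_poly red g"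
proof (induction f)
  case (pCons a f)
  have coeffs_in: "coeffs_in [:a:]" "coeffs_in f" "coeffs_in (g * (f \<circ>\<^sub>p g))"
    using pCons.prems by (auto simp: coeffs_in_pCons_iff coeffs_in_mult coeffs_in_pcompose)
  hence "map_poly red (pCons a f \<circ>\<^sub>p g) = [:red a:] + map_poly red g * (map_poly red f \<circ>\<^sub>p map_poly red g)"
    using pCons by (simp add: pcompose_pCons red_poly_add red_poly_const red_poly_mult coeffs_in_pcompose)
  also have "map_poly red (pCons a f) = pCons (red a) (map_poly red f)"
    by (rule poly_eqI) (auto simp: coeff_pCons split: nat.splits)
  hence "[:red a:] + map_poly red g * (map_poly red f \<circ>\<^sub>p map_poly red g) =
    map_poly red (pCons a f) \<circ>\<^sub>p map_poly red g"
    by (simp add: pcompose_pCons)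
  finally show ?case .
qed simp

text \<open>The reduced product is still indexed by \<open>Y\<close> and not by the image of
  \<open>Y\<close>, so roots that become equal under \<open>red\<close> keep their
  multiplicity.\<close>

lemma red_poly_linear_factors:
  assumes "finite Y" "c \<in> B" "Y \<subseteq> B"
  shows "coeffs_in (smult c (\<Prod>x\<in>Y. [:- x, 1:])) \<and>
    map_poly red (smult c (\<Prod>x\<in>Y. [:- x, 1:])) = smult (red c) (\<Prod>x\<in>Y. [:- red x, 1:])"
  using assms(1,3)
proof (induction Y rule: finite_induct)
  case empty
  have "smult c 1 = [:c:]" by simp
  thus ?case using assms(2) by (auto simp: red_poly_const coeffs_in_pCons_iff)
next
  case (insert x Y)
  have coeffs_in: "coeffs_in [:- x, 1:]"
    using insert.prems subring_0[OF B] subring_1[OF B] subring_uminus[OF B] by (auto simp: coeffs_in_pCons_iff)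
  have "map_poly red [:- x, 1:] = [:- red x, 1:]"
    by (rule poly_eqI) (use insert.prems in \<open>auto simp: coeff_pCons red_1 red_uminus split: nat.splits\<close>)
  moreover have "smult c (\<Prod>y\<in>insert x Y. [:- y, 1:]) = [:- x, 1:] * smult c (\<Prod>y\<in>Y. [:- y, 1:])"
    using insert.hyps by simp
  moreover have "coeffs_in (smult c (\<Prod>y\<in>Y. [:- y, 1:]))"
    "map_poly red (smult c (\<Prod>y\<in>Y. [:- y, 1:])) = smult (red c) (\<Prod>y\<in>Y. [:- red y, 1:])"
    using insert by auto
  moreover have "smult (red c) (\<Prod>y\<in>insert x Y. [:- red y, 1:]) =
      [:- red x, 1:] * smult (red c) (\<Prod>y\<in>Y. [:- red y, 1:])"
    using insert.hyps by simp
  ultimately show ?case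
    using coeffs_in_mult[OF coeffs_in] red_poly_mult[OF coeffs_in] by (simp only: simp_thms)
qed

end

section \<open>Polynomials over a finite field\<close>

text \<open>For \<open>d = degree P\<close> these are representatives of A modulo P. The condition
  on coefficients admits the zero polynomial for every \<open>d\<close>.\<close>

definition reps :: "nat \<Rightarrow> 'a::zero poly set" where
  "reps d = {a. \<forall>i\<ge>d. coeff a i = 0}"

lemma card_reps: "card (reps d :: 'a::{finite,field} poly set) = CARD('a) ^ d"
proof (induction d)
  case 0
  have "reps 0 = {0 :: 'a poly}"
    by (auto simp: reps_def poly_eq_iff)
  thus ?case by simp
next
  case (Suc d)
  have "reps (Suc d) = case_prod pCons ` (UNIV \<times> (reps d :: 'a poly set))" (is "?L = ?R")
  proof
    show "?L \<subseteq> ?R"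
    proof
      fix a :: "'a poly" assume a: "a \<in> reps (Suc d)"
      obtain c b where "a = pCons c b" by (cases a) auto
      with a have "b \<in> reps d"
        by (auto simp: reps_def)
      thus "a \<in> ?R" using \<open>a = pCons c b\<close> by force
    qed
    show "?R \<subseteq> ?L"
      by (auto simp: reps_def coeff_pCons split: nat.splits)
  qed
  moreover have "inj_on (case_prod pCons) (UNIV \<times> (reps d :: 'a poly set))"
    by (auto simp: inj_on_def)
  ultimately show ?case
    using Suc by (simp add: card_image card_cartesian_product)
qed

lemma finite_reps: "finite (reps d :: 'a::{finite,field} poly set)"
  using card_reps[where 'a = 'a and d = d] card_field_gt_1[where 'a = 'a] card.infinite by fastforce

lemma mod_in_reps:
  fixes P :: "'a::field poly"
  assumes "degree P > 0"
  shows "a mod P \<in> reps (degree P)"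
proof -
  have "a mod P = 0 \<or> degree (a mod P) < degree P"
    using assms by (intro degree_mod_less) auto
  thus ?thesis by (auto simp: reps_def coeff_eq_0)
qed

lemma reps_eq_if_dvd:
  fixes P :: "'a::field poly"
  assumes "P dvd a - b" "a \<in> reps (degree P)" "b \<in> reps (degree P)"
  shows "a = b"
proof (rule ccontr)
  assume "a \<noteq> b"
  hence "degree P \<le> degree (a - b)"
    using assms(1) by (intro dvd_imp_degree_le) auto
  hence "coeff (a - b) (degree (a - b)) = 0"
    using assms(2,3) by (simp add: reps_def)
  thus False using \<open>a \<noteq> b\<close> by (metis leading_coeff_0_iff right_minus_eq)
qed

lemma prime_elem_degree_pos:
  fixes P :: "'a::field poly"
  assumes "prime_elem P"
  shows "degree P > 0"
proof (rule ccontr)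
  assume "\<not> degree P > 0"
  then obtain c where "P = [:c:]"
    by (auto elim: degree_eq_zeroE)
  thus False using assms by (auto simp: prime_elem_def is_unit_const_poly_iff)
qed

text \<open>Multiplication by \<open>a\<close> modulo P is injective on the finite set of
  representatives, hence surjective, so it takes the value 1.\<close>

lemma prime_elem_bezout:
  fixes P :: "'a::{finite,field} poly"
  assumes "prime_elem P" "\<not> P dvd a"
  obtains b c where "b * a + c * P = 1"
proof -
  note deg = prime_elem_degree_pos[OF assms(1)]
  define f where "f b = (b * a) mod P" for b
  have "inj_on f (reps (degree P))"
  proof (rule inj_onI)
    fix b b' assume b: "b \<in> reps (degree P)" "b' \<in> reps (degree P)" "f b = f b'"
    hence "P dvd (b - b') * a"
      by (simp add: f_def mod_eq_dvd_iff algebra_simps)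
    hence "P dvd b - b'"
      using assms by (simp add: prime_elem_dvd_mult_iff)
    thus "b = b'" using reps_eq_if_dvd b by blast
  qed
  moreover have "f ` reps (degree P) \<subseteq> reps (degree P)"
    using mod_in_reps[OF deg] by (auto simp: f_def)
  ultimately have "f ` reps (degree P) = reps (degree P)"
    using finite_reps endo_inj_surj by blast
  moreover have "1 \<in> reps (degree P)"
    using deg by (auto simp: reps_def)
  ultimately obtain b where "(b * a) mod P = 1"
    unfolding f_def by (metis (no_types, lifting) image_iff)
  hence "b * a + (- (b * a div P)) * P = 1"
    by (metis add.commute add_diff_cancel_left' diff_conv_add_uminus div_mult_mod_eq mult_minus_left)
  thus ?thesis using that by blast
qed

section \<open>Finite modules killed by a split prime\<close>

text \<open>Abstract form of the action of \<O> on the P-torsion \<open>M\<close>. Here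
  \<open>p\<close> is the image of P, \<open>A\<^sub>0\<close> that of the representatives of A
  modulo P, and \<open>n\<close> is q^d with d the degree of P. The assumption
  \<open>faithful\<close> says that the annihilator of \<open>M\<close> is contained in p
  \<O>.\<close>

locale split_torsion =
  fixes \<O> :: "'c::comm_ring_1 set" and act :: "'c \<Rightarrow> 'x::ab_group_add \<Rightarrow> 'x" and M :: "'x set"
    and p :: 'c and \<PP> \<PP>' A\<^sub>0 :: "'c set" and n :: nat
  assumes prime: "prime_in \<O> \<PP>" and prime': "prime_in \<O> \<PP>'" and ne: "\<PP> \<noteq> \<PP>'"
    and p: "p \<in> \<PP>" "p \<in> \<PP>'"
    and prod: "\<And>i j. i \<in> \<PP> \<Longrightarrow> j \<in> \<PP>' \<Longrightarrow> \<exists>g\<in>\<O>. i * j = p * g"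
    and M: "finite M" "0 \<in> M" "\<And>x y. x \<in> M \<Longrightarrow> y \<in> M \<Longrightarrow> x + y \<in> M"
    and act_closed: "\<And>f x. f \<in> \<O> \<Longrightarrow> x \<in> M \<Longrightarrow> act f x \<in> M"
    and act_add: "\<And>f g x. f \<in> \<O> \<Longrightarrow> g \<in> \<O> \<Longrightarrow> act (f + g) x = act f x + act g x"
    and act_mult: "\<And>f g x. f \<in> \<O> \<Longrightarrow> g \<in> \<O> \<Longrightarrow> act (f * g) x = act f (act g x)"
    and act_1: "\<And>x. act 1 x = x"
    and act_add_right: "\<And>f x y. f \<in> \<O> \<Longrightarrow> act f (x + y) = act f x + act f y"
    and act_p: "\<And>x. x \<in> M \<Longrightarrow> act p x = 0"
    and faithful: "\<And>f. f \<in> \<O> \<Longrightarrow> (\<And>x. x \<in> M \<Longrightarrow> act f x = 0) \<Longrightarrow> \<exists>g\<in>\<O>. f = p * g"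
    and A\<^sub>0: "A\<^sub>0 \<subseteq> \<O>" "card A\<^sub>0 = n"
    and A\<^sub>0_diff: "\<And>a b. a \<in> A\<^sub>0 \<Longrightarrow> b \<in> A\<^sub>0 \<Longrightarrow> a \<noteq> b \<Longrightarrow> a - b \<notin> \<PP> \<and> a - b \<notin> \<PP>'"
    and card_M: "card M = n ^ 2"
begin

text \<open>The setting is symmetric in the two primes, so every statement about one of them
  transfers to the other.\<close>

lemma swap: "split_torsion \<O> act M p \<PP>' \<PP> A\<^sub>0 n"
proof -
  have prod': "\<exists>g\<in>\<O>. i * j = p * g" if "i \<in> \<PP>'" "j \<in> \<PP>" for i j
    using prod[OF that(2,1)] by (simp add: mult.commute)
  have A\<^sub>0_diff': "a - b \<notin> \<PP>' \<and> a - b \<notin> \<PP>" if "a \<in> A\<^sub>0" "b \<in> A\<^sub>0" "a \<noteq> b" for a b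
    using A\<^sub>0_diff[OF that] by simp
  show ?thesis
    by unfold_locales (fact prime prime' ne[symmetric] p prod' M act_closed act_add act_mult act_1
      act_add_right act_p faithful A\<^sub>0 A\<^sub>0_diff' card_M)+
qed

lemmas \<O> = prime_in_subring[OF prime]
lemmas \<O>_closed = subring_0[OF \<O>] subring_1[OF \<O>] subring_add[OF \<O>] subring_diff[OF \<O>]
  subring_mult[OF \<O>] subring_power[OF \<O>] subring_uminus[OF \<O>]

lemma \<PP>_sub: "f \<in> \<PP> \<Longrightarrow> f \<in> \<O>" and \<PP>'_sub: "f \<in> \<PP>' \<Longrightarrow> f \<in> \<O>"
  using prime_in_subset[OF prime] prime_in_subset[OF prime'] by auto

lemma act_diff: "f \<in> \<O> \<Longrightarrow> g \<in> \<O> \<Longrightarrow> act (f - g) x = act f x - act g x"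
  using act_add[of "f - g" g x] by (simp add: \<O>_closed)

lemma act_0_right: "f \<in> \<O> \<Longrightarrow> act f 0 = 0"
  using act_add_right[of f 0 0] by simp

lemma act_p_mult: "g \<in> \<O> \<Longrightarrow> x \<in> M \<Longrightarrow> act (p * g) x = 0"
  using act_mult[of g p x] act_p[of x] \<PP>_sub[OF p(1)] act_0_right by (simp add: mult.commute)

text \<open>The powers of \<open>g\<close> act on the finite set \<open>M\<close>, so two of them
  act alike. Their difference then lies in p \<O>, hence in \<PP>, and g^i can be cancelled because
  \<PP> is prime.\<close>

lemma maximal:
  assumes g: "g \<in> \<O>" "g \<notin> \<PP>"
  obtains h where "h \<in> \<O>" "1 - h * g \<in> \<PP>"
proof -
  \<comment> \<open>Restriction to \<open>M\<close> makes the actions elements of a finite function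
    space.\<close>
  define F where "F i = restrict (act (g ^ i)) M" for i
  have "finite (M \<rightarrow>\<^sub>E M)"
    using M(1) by (intro finite_PiE) auto
  moreover have "range F \<subseteq> (M \<rightarrow>\<^sub>E M)"
    using act_closed \<O>_closed(6)[OF g(1)] by (auto simp: F_def)
  ultimately have "finite (range F)"
    by (rule rev_finite_subset)
  hence "\<not> inj F"
    using finite_imageD infinite_UNIV_nat by blast
  then obtain i' j' where ij': "F i' = F j'" "i' \<noteq> j'"
    by (auto simp: inj_on_def)
  define i j where "i = min i' j'" and "j = max i' j'"
  have ij: "i < j" "F i = F j"
    using ij' by (auto simp: i_def j_def min_def max_def)
  have "act (g ^ i - g ^ j) x = 0" if "x \<in> M" for x
    using fun_cong[OF ij(2), of x] that \<O>_closed(6)[OF g(1)] by (simp add: act_diff F_def)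
  moreover have "g ^ i - g ^ j \<in> \<O>"
    using g by (simp add: \<O>_closed)
  ultimately obtain k where k: "k \<in> \<O>" "g ^ i - g ^ j = p * k"
    using faithful[of "g ^ i - g ^ j"] by blast
  hence "g ^ i - g ^ j \<in> \<PP>"
    using prime_in_mult[OF prime k(1) p(1)] by (simp add: mult.commute)
  moreover have "g ^ i - g ^ j = g ^ i * (1 - g ^ (j - i - 1) * g)"
    using ij(1) by (simp add: right_diff_distrib flip: power_add power_Suc2 power_Suc)
  ultimately have "1 - g ^ (j - i - 1) * g \<in> \<PP>"
    using prime_in_prime[OF prime, of "g ^ i" "1 - g ^ (j - i - 1) * g"]
      prime_in_power[OF prime g(1), of i] g by (auto simp: \<O>_closed)
  moreover have "g ^ (j - i - 1) \<in> \<O>"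
    using g by (simp add: \<O>_closed)
  ultimately show ?thesis using that by blast
qed

lemma coprime_if_not_subset:
  assumes "\<not> \<PP>' \<subseteq> \<PP>"
  shows "\<exists>\<alpha>\<in>\<PP>. \<exists>\<alpha>'\<in>\<PP>'. \<alpha> + \<alpha>' = 1"
proof -
  obtain g where g: "g \<in> \<PP>'" "g \<notin> \<PP>"
    using assms by blast
  then obtain h where h: "h \<in> \<O>" "1 - h * g \<in> \<PP>"
    using maximal \<PP>'_sub by blast
  have "h * g \<in> \<PP>'"
    using prime_in_mult[OF prime' h(1) g(1)] .
  thus ?thesis using h(2) by (intro bexI[of _ "1 - h * g"] bexI[of _ "h * g"]) auto
qed

text \<open>As the primes differ, one of them is not contained in the other, and an element outside
  a maximal ideal generates the unit ideal with it.\<close>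

lemma coprime:
  obtains \<alpha> \<alpha>' where "\<alpha> \<in> \<PP>" "\<alpha>' \<in> \<PP>'" "\<alpha> + \<alpha>' = 1"
proof -
  interpret sw: split_torsion \<O> act M p \<PP>' \<PP> A\<^sub>0 n by (rule swap)
  show ?thesis
    using coprime_if_not_subset sw.coprime_if_not_subset ne that by (metis add.commute subset_antisym)
qed

definition tors :: "'c set \<Rightarrow> 'x set" where
  "tors I = {x \<in> M. \<forall>f\<in>I. act f x = 0}"

lemma tors_subset: "tors I \<subseteq> M"
  by (auto simp: tors_def)

text \<open>The product of the two primes lies in p \<O>, which kills \<open>M\<close>.\<close>

lemma act_in_tors:
  assumes "f \<in> \<PP>'" "x \<in> M"
  shows "act f x \<in> tors \<PP>"
proof -
  have "act i (act f x) = 0" if i: "i \<in> \<PP>" for i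
  proof -
    obtain g where "g \<in> \<O>" "i * f = p * g"
      using prod[OF i assms(1)] by blast
    thus ?thesis
      using act_mult[of i f x] act_p_mult assms(2) \<PP>_sub[OF i] \<PP>'_sub[OF assms(1)] by simp
  qed
  thus ?thesis
    using act_closed assms \<PP>'_sub by (auto simp: tors_def)
qed

text \<open>If \<open>f\<close> were outside \<PP>, some multiple \<open>h * f\<close> would be 1
  modulo \<PP> and hence act as the identity on \<open>x\<close>, while \<open>f\<close> kills
  \<open>x\<close>.\<close>

lemma annihilator:
  assumes "x \<in> tors \<PP>" "x \<noteq> 0" "f \<in> \<O>" "act f x = 0"
  shows "f \<in> \<PP>"
proof (rule ccontr)
  assume "f \<notin> \<PP>"
  then obtain h where h: "h \<in> \<O>" "1 - h * f \<in> \<PP>"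
    using maximal assms(3) by blast
  have "0 = act (1 - h * f) x"
    using assms(1) h(2) by (simp add: tors_def)
  also have "\<dots> = x"
    using assms h(1) by (simp add: \<O>_closed act_diff act_mult act_1 act_0_right)
  finally show False using assms(2) by simp
qed

lemma inj_orbit:
  assumes "x \<in> tors \<PP>" "x \<noteq> 0"
  shows "inj_on (\<lambda>a. act a x) A\<^sub>0"
proof (rule inj_onI, rule ccontr)
  fix a b assume ab: "a \<in> A\<^sub>0" "b \<in> A\<^sub>0" "act a x = act b x" "a \<noteq> b"
  hence "a \<in> \<O>" "b \<in> \<O>" using A\<^sub>0 by auto
  hence "a - b \<in> \<PP>"
    using ab(3) by (intro annihilator[OF assms]) (simp_all add: \<O>_closed act_diff)
  thus False using A\<^sub>0_diff ab by blast
qed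

text \<open>Otherwise \<alpha>' would kill \<open>M\<close>, because it maps \<open>M\<close> into
  the \<PP>-torsion. Faithfulness then puts \<alpha>' into p \<O> and so into \<PP>, against
  \<alpha> + \<alpha>' = 1.\<close>

lemma tors_nonzero: "\<exists>x\<in>tors \<PP>. x \<noteq> 0"
proof (rule ccontr)
  assume "\<not> (\<exists>x\<in>tors \<PP>. x \<noteq> 0)"
  hence tors0: "x = 0" if "x \<in> tors \<PP>" for x
    using that by blast
  obtain \<alpha> \<alpha>' where \<alpha>: "\<alpha> \<in> \<PP>" "\<alpha>' \<in> \<PP>'" "\<alpha> + \<alpha>' = 1" by (rule coprime)
  have "act \<alpha>' x = 0" if "x \<in> M" for x
    using tors0[OF act_in_tors[OF \<alpha>(2) that]] .
  then obtain g where "g \<in> \<O>" "\<alpha>' = p * g"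
    using faithful[OF \<PP>'_sub[OF \<alpha>(2)]] by blast
  hence "\<alpha>' \<in> \<PP>"
    using prime_in_mult[OF prime _ p(1), of g] by (simp add: mult.commute)
  thus False
    using prime_in_add[OF prime \<alpha>(1)] \<alpha>(3) prime_in_1[OF prime] by metis
qed

lemma orbit_subset:
  assumes "x \<in> tors \<PP>" "f \<in> \<O>"
  shows "act f x \<in> tors \<PP>"
proof -
  have "act i (act f x) = 0" if "i \<in> \<PP>" for i
  proof -
    have "act i (act f x) = act f (act i x)"
      using \<PP>_sub[OF that] assms(2) by (simp add: mult.commute flip: act_mult)
    thus ?thesis using assms that by (simp add: tors_def act_0_right)
  qed
  thus ?thesis using assms act_closed by (auto simp: tors_def)
qed

lemma card_tors_ge: "n \<le> card (tors \<PP>)"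
proof -
  obtain x where x: "x \<in> tors \<PP>" "x \<noteq> 0" using tors_nonzero by blast
  have "(\<lambda>a. act a x) ` A\<^sub>0 \<subseteq> tors \<PP>"
    using orbit_subset[OF x(1)] A\<^sub>0 by auto
  thus ?thesis
    using card_inj_on_le[OF inj_orbit[OF x]] finite_subset[OF tors_subset M(1)] A\<^sub>0(2) by blast
qed

lemma act_decomp: "\<alpha> \<in> \<PP> \<Longrightarrow> \<alpha>' \<in> \<PP>' \<Longrightarrow> \<alpha> + \<alpha>' = 1 \<Longrightarrow> x = act \<alpha> x + act \<alpha>' x"
  using act_add[of \<alpha> \<alpha>' x] \<PP>_sub \<PP>'_sub by (simp add: act_1)

text \<open>Addition embeds the product of the two torsion parts into \<open>M\<close>. Each part
  has at least \<open>n\<close> points and \<open>M\<close> has \<open>n ^ 2\<close>, so both bounds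
  are attained.\<close>

lemma card_tors: "card (tors \<PP>) = n"
proof -
  interpret sw: split_torsion \<O> act M p \<PP>' \<PP> A\<^sub>0 n by (rule swap)
  obtain \<alpha> \<alpha>' where \<alpha>: "\<alpha> \<in> \<PP>" "\<alpha>' \<in> \<PP>'" "\<alpha> + \<alpha>' = 1" by (rule coprime)
  \<comment> \<open>The element \<alpha>' is the projection onto the \<PP>-torsion: it is 1 modulo
    \<PP> and 0 modulo \<PP>'.\<close>
  have "act \<alpha>' (x + y) = x" if "x \<in> tors \<PP>" "y \<in> tors \<PP>'" for x y
  proof -
    have "act \<alpha>' y = 0" "act \<alpha> x = 0"
      using that \<alpha> by (auto simp: tors_def)
    thus ?thesis
      using act_decomp[OF \<alpha>, of x] act_add_right[OF \<PP>'_sub[OF \<alpha>(2)]] by simp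
  qed
  note left = this
  have "inj_on (\<lambda>(x, y). x + y) (tors \<PP> \<times> tors \<PP>')"
  proof (rule inj_onI, clarify)
    fix x y x' y' assume xy: "x \<in> tors \<PP>" "y \<in> tors \<PP>'" "x' \<in> tors \<PP>" "y' \<in> tors \<PP>'" "x + y = x' + y'"
    hence "x = x'"
      using left[OF xy(1,2)] left[OF xy(3,4)] by simp
    thus "x = x' \<and> y = y'" using xy(5) by simp
  qed
  moreover have "(\<lambda>(x, y). x + y) ` (tors \<PP> \<times> tors \<PP>') \<subseteq> M"
    using subsetD[OF tors_subset] by (auto intro!: M(3))
  ultimately have "card (tors \<PP> \<times> tors \<PP>') \<le> card M"
    using M(1) by (rule card_inj_on_le)
  hence "card (tors \<PP>) * card (tors \<PP>') \<le> n * n"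
    by (simp add: card_cartesian_product card_M power2_eq_square)
  moreover have "card (tors \<PP>) * n \<le> card (tors \<PP>) * card (tors \<PP>')"
    using sw.card_tors_ge by simp
  ultimately have "card (tors \<PP>) * n \<le> n * n" by linarith
  moreover have "n > 0"
    using card_M M(1,2) by (cases n) auto
  ultimately show ?thesis
    using card_tors_ge by simp
qed

lemma orbit_eq:
  assumes "x \<in> tors \<PP>" "x \<noteq> 0"
  shows "(\<lambda>a. act a x) ` A\<^sub>0 = tors \<PP>"
proof (rule card_subset_eq)
  show "(\<lambda>a. act a x) ` A\<^sub>0 \<subseteq> tors \<PP>"
    using orbit_subset[OF assms(1)] A\<^sub>0 by auto
  show "card ((\<lambda>a. act a x) ` A\<^sub>0) = card (tors \<PP>)"
    using card_image[OF inj_orbit[OF assms]] A\<^sub>0(2) card_tors by simp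
qed (use finite_subset[OF tors_subset M(1)] in auto)

text \<open>The orbit of a nonzero torsion point under \<open>A\<^sub>0\<close> is everything, so
  \<open>f\<close> acts on that point like some \<open>a\<close>; then \<open>f - a\<close>
  annihilates it.\<close>

lemma residue_rep:
  assumes "f \<in> \<O>"
  obtains a where "a \<in> A\<^sub>0" "f - a \<in> \<PP>"
proof -
  obtain x where x: "x \<in> tors \<PP>" "x \<noteq> 0" using tors_nonzero by blast
  obtain a where a: "a \<in> A\<^sub>0" "act f x = act a x"
    using orbit_subset[OF x(1) assms] orbit_eq[OF x] by (metis (no_types, lifting) image_iff)
  moreover have "a \<in> \<O>" using a A\<^sub>0 by auto
  ultimately have "f - a \<in> \<PP>"
    using assms by (intro annihilator[OF x]) (simp_all add: \<O>_closed act_diff)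
  thus ?thesis using that a by blast
qed

text \<open>A point of \<open>N\<close> outside the \<PP>-torsion has a nonzero component \<alpha> x
  in the \<PP>'-torsion. That component generates all of it, so \<open>N\<close> contains both
  summands of \<open>M\<close>.\<close>

lemma submodule_eq:
  assumes N: "N \<subseteq> M" "\<And>x y. x \<in> N \<Longrightarrow> y \<in> N \<Longrightarrow> x + y \<in> N" "\<And>f x. f \<in> \<O> \<Longrightarrow> x \<in> N \<Longrightarrow> act f x \<in> N"
    and tors: "tors \<PP> \<subseteq> N" "tors \<PP> \<noteq> N"
  shows "N = M"
proof -
  interpret sw: split_torsion \<O> act M p \<PP>' \<PP> A\<^sub>0 n by (rule swap)
  obtain x where x: "x \<in> N" "x \<notin> tors \<PP>"
    using tors by blast
  obtain \<alpha> \<alpha>' where \<alpha>: "\<alpha> \<in> \<PP>" "\<alpha>' \<in> \<PP>'" "\<alpha> + \<alpha>' = 1" by (rule coprime)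
  have y: "act \<alpha> x \<in> tors \<PP>'" "act \<alpha> x \<in> N"
    using sw.act_in_tors[OF \<alpha>(1)] N x(1) \<PP>_sub[OF \<alpha>(1)] by auto
  have "act \<alpha> x \<noteq> 0"
  proof
    assume "act \<alpha> x = 0"
    hence "x = act \<alpha>' x"
      using act_decomp[OF \<alpha>, of x] by simp
    thus False
      using act_in_tors[OF \<alpha>(2), of x] x N(1) by auto
  qed
  moreover have "(\<lambda>a. act a (act \<alpha> x)) ` A\<^sub>0 \<subseteq> N"
    using N(3)[OF _ y(2)] subsetD[OF A\<^sub>0(1)] by auto
  ultimately have tors': "tors \<PP>' \<subseteq> N"
    using sw.orbit_eq[OF y(1)] by simp
  have "z \<in> N" if "z \<in> M" for z
  proof -
    have "act \<alpha> z + act \<alpha>' z \<in> N"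
      using subsetD[OF tors' sw.act_in_tors[OF \<alpha>(1) that]] subsetD[OF tors(1) act_in_tors[OF \<alpha>(2) that]]
      by (rule N(2))
    thus ?thesis using act_decomp[OF \<alpha>, of z] by simp
  qed
  thus ?thesis using N(1) by blast
qed

end

text \<open>The orbit map f |-> f x of the generator \<open>x\<close> has kernel \<open>I\<close>.
  It is evaluated on a coset through a chosen representative, which is harmless since elements of
  \<open>I\<close> kill \<open>x\<close>.\<close>

lemma quotient_iso:
  fixes R I N :: "'c::field set"
  assumes I: "prime_in R I"
    and act: "\<And>f g. f \<in> R \<Longrightarrow> g \<in> R \<Longrightarrow> act (f + g) x = act f x + act g x"
      "\<And>f g. f \<in> R \<Longrightarrow> g \<in> R \<Longrightarrow> act (f * g) x = act f (act g x)"
    and ann: "\<And>f. f \<in> R \<Longrightarrow> act f x = 0 \<longleftrightarrow> f \<in> I"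
    and orbit: "(\<lambda>f. act f x) ` R = N"
  shows "iso_to_quotient R I act N"
proof -
  interpret primeideal I "subring_of R"
    using I primeideal_subring_of by blast
  note R = prime_in_subring[OF I]
  define coset where "coset f = I +>\<^bsub>subring_of R\<^esub> f" for f
  have coset: "coset f = {i + f |i. i \<in> I}" for f
    by (auto simp: coset_def a_r_coset_def' ring_of_type_algebra_def)
  have carrier: "carrier (subring_of R Quot I) = coset ` R"
    by (auto simp: FactRing_def A_RCOSETS_def' coset_def)
  have act_eq: "act f x = act g x" if fg: "f \<in> R" "g \<in> R" "f \<in> coset g" for f g
  proof -
    obtain i where i: "f = i + g" "i \<in> I"
      using fg(3) by (auto simp: coset)
    moreover have "i \<in> R" using i prime_in_subset[OF I] by auto
    ultimately show ?thesis using act(1)[of i g] ann[of i] fg by simp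
  qed
  define h where "h S = act (SOME f. f \<in> S) x" for S
  have self: "f \<in> coset f" for f
    using prime_in_0[OF I] by (auto simp: coset intro!: exI[of _ 0])
  have sub: "coset f \<subseteq> R" if "f \<in> R" for f
    using that prime_in_subset[OF I] subring_add[OF R] by (auto simp: coset)
  have h: "h (coset f) = act f x" if "f \<in> R" for f
  proof -
    have "(SOME g. g \<in> coset f) \<in> coset f"
      using self by (rule someI)
    thus ?thesis unfolding h_def using act_eq sub that by blast
  qed
  have "inj_on h (coset ` R)"
  proof (rule inj_onI, clarsimp simp: h)
    fix f g assume fg: "f \<in> R" "g \<in> R" "act f x = act g x"
    have "f - g \<in> R" by (rule subring_diff[OF R fg(1,2)])
    moreover from this have "act (f - g) x = 0"
      using act(1)[of "f - g" g] fg by simp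
    ultimately have d: "f - g \<in> I" using ann by blast
    have "coset f \<subseteq> coset g"
    proof
      fix y assume "y \<in> coset f"
      then obtain i where "y = i + f" "i \<in> I" by (auto simp: coset)
      moreover from this have "y = (i + (f - g)) + g" by simp
      ultimately show "y \<in> coset g" using prime_in_add[OF I _ d] unfolding coset by blast
    qed
    moreover have "coset g \<subseteq> coset f"
    proof
      fix y assume "y \<in> coset g"
      then obtain i where "y = i + g" "i \<in> I" by (auto simp: coset)
      moreover from this have "y = (i - (f - g)) + f" by simp
      ultimately show "y \<in> coset f" using prime_in_diff[OF I _ d] unfolding coset by blast
    qed
    ultimately show "coset f = coset g" by blast
  qed
  moreover have "h ` (coset ` R) = N"
    using orbit h by (auto simp: image_image)
  ultimately have "bij_betw h (carrier (subring_of R Quot I)) N"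
    unfolding carrier bij_betw_def by blast
  moreover have "coset f \<oplus>\<^bsub>subring_of R Quot I\<^esub> coset g = coset (f + g)" if "f \<in> R" "g \<in> R" for f g
    using a_rcos_sum[of f g] that unfolding coset_def
    by (simp add: FactRing_def) (simp add: ring_of_type_algebra_def)
  moreover have "coset f \<otimes>\<^bsub>subring_of R Quot I\<^esub> coset g = coset (f * g)" if "f \<in> R" "g \<in> R" for f g
    using rcoset_mult_add[of f g] that unfolding coset_def
    by (simp add: FactRing_def) (simp add: ring_of_type_algebra_def)
  ultimately show ?thesis
    unfolding iso_to_quotient_def carrier
    using h act subring_add[OF R] subring_mult[OF R]
    by (intro exI[of _ h]) (auto simp flip: coset_def)
qed

section \<open>Drinfeld modules over a global field\<close>

lemma Units_subring_of:
  assumes "x \<in> Units (subring_of B)"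
  shows "x \<in> B" "inverse x \<in> B" "x \<noteq> 0"
proof -
  obtain y where "x \<in> B" "y \<in> B" "y * x = 1"
    using assms by (auto simp: Units_def ring_of_type_algebra_def)
  moreover from this have "x \<noteq> 0" by auto
  moreover from calculation have "inverse x = y"
    by (metis inverse_unique mult.commute)
  ultimately show "x \<in> B" "inverse x \<in> B" "x \<noteq> 0" by auto
qed

lemma subfield_closed:
  assumes "subfield F (ring_of_type_algebra :: 'b::field ring)"
  shows "is_subring F" "x \<in> F \<Longrightarrow> inverse x \<in> F"
proof -
  interpret ring "ring_of_type_algebra :: 'b ring" ..
  have field: "field (subring_of F)"
    using subfield_iff(2)[OF assms] .
  then interpret Fd: field "subring_of F" .
  show F: "is_subring F"
    using Fd.cring_axioms cring_subring_of by blast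
  assume "x \<in> F"
  show "inverse x \<in> F"
  proof (cases "x = 0")
    case True
    thus ?thesis using subring_0[OF F] by simp
  next
    case False
    hence "x \<in> Units (subring_of F)"
      using Fd.field_Units \<open>x \<in> F\<close> by (simp add: ring_of_type_algebra_def)
    thus ?thesis using Units_subring_of by blast
  qed
qed

text \<open>Zorn's lemma for proper ideals. The last conclusion says that the quotient by
  \<open>m\<close> is a field, which is the form in which maximality is applied later.\<close>

lemma exists_maximal_ideal:
  assumes R: "is_subring R" and I: "I \<subseteq> R" "0 \<in> I" "1 \<notin> I"
    and diff: "\<And>x y. x \<in> I \<Longrightarrow> y \<in> I \<Longrightarrow> x - y \<in> I" and mult: "\<And>x y. x \<in> R \<Longrightarrow> y \<in> I \<Longrightarrow> x * y \<in> I"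
  obtains m where "prime_in R m" "I \<subseteq> m" "\<And>g. g \<in> R \<Longrightarrow> g \<notin> m \<Longrightarrow> \<exists>h\<in>R. 1 - h * g \<in> m"
proof -
  define \<A> where "\<A> = {J. I \<subseteq> J \<and> J \<subseteq> R \<and> 1 \<notin> J \<and> (\<forall>x\<in>J. \<forall>y\<in>J. x - y \<in> J) \<and> (\<forall>x\<in>R. \<forall>y\<in>J. x * y \<in> J)}"
  have "\<exists>m\<in>\<A>. \<forall>J\<in>\<A>. m \<subseteq> J \<longrightarrow> J = m"
  proof (rule subset_Zorn_nonempty)
    have "I \<in> \<A>" using I diff mult by (auto simp: \<A>_def)
    thus "\<A> \<noteq> {}" by auto
    fix C assume C: "C \<noteq> {}" "subset.chain \<A> C"
    hence sub: "C \<subseteq> \<A>" and chain: "\<And>J K. J \<in> C \<Longrightarrow> K \<in> C \<Longrightarrow> J \<subseteq> K \<or> K \<subseteq> J"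
      by (auto simp: subset_chain_def)
    have "x - y \<in> \<Union>C" if xy: "x \<in> \<Union>C" "y \<in> \<Union>C" for x y
    proof -
      obtain J J' where J: "J \<in> C" "x \<in> J" "J' \<in> C" "y \<in> J'" using xy by blast
      then obtain K where "K \<in> C" "x \<in> K" "y \<in> K"
        using chain[OF J(1,3)] by blast
      moreover from this have "x - y \<in> K"
        using sub by (auto simp: \<A>_def)
      ultimately show ?thesis by blast
    qed
    moreover have "x * y \<in> \<Union>C" if xy: "x \<in> R" "y \<in> \<Union>C" for x y
    proof -
      obtain K where "K \<in> C" "y \<in> K" using xy by blast
      moreover from this have "x * y \<in> K"
        using sub xy(1) by (auto simp: \<A>_def)
      ultimately show ?thesis by blast
    qed
    moreover have "I \<subseteq> \<Union>C" "\<Union>C \<subseteq> R" "1 \<notin> \<Union>C"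
      using C(1) sub by (fastforce simp: \<A>_def)+
    ultimately show "\<Union>C \<in> \<A>"
      unfolding \<A>_def by blast
  qed
  then obtain m where "m \<in> \<A>" and max: "\<And>J. J \<in> \<A> \<Longrightarrow> m \<subseteq> J \<Longrightarrow> J = m"
    by blast
  hence m: "I \<subseteq> m" "m \<subseteq> R" "1 \<notin> m" "\<And>x y. x \<in> m \<Longrightarrow> y \<in> m \<Longrightarrow> x - y \<in> m"
    "\<And>x y. x \<in> R \<Longrightarrow> y \<in> m \<Longrightarrow> x * y \<in> m"
    by (auto simp: \<A>_def)
  have m0: "0 \<in> m" using I m by auto
  have m_add: "x + y \<in> m" if "x \<in> m" "y \<in> m" for x y
    using m(4)[OF that(1) m(4)[OF m0 that(2)]] by simp
  have maximal: "\<exists>h\<in>R. 1 - h * g \<in> m" if g: "g \<in> R" "g \<notin> m" for g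
  proof -
    \<comment> \<open>The ideal generated by \<open>m\<close> and \<open>g\<close> is strictly
      larger than \<open>m\<close>, hence cannot be proper.\<close>
    define J where "J = {x + h * g |x h. x \<in> m \<and> h \<in> R}"
    have "m \<subseteq> J"
    proof
      fix x assume "x \<in> m"
      moreover have "x = x + 0 * g" by simp
      ultimately show "x \<in> J" unfolding J_def using subring_0[OF R] by blast
    qed
    have "g = 0 + 1 * g" by simp
    hence "g \<in> J"
      unfolding J_def using m0 subring_1[OF R] by blast
    have "J \<noteq> m" using \<open>g \<in> J\<close> g(2) by auto
    hence "J \<notin> \<A>" using max \<open>m \<subseteq> J\<close> by blast
    moreover have "I \<subseteq> J" using m(1) \<open>m \<subseteq> J\<close> by blast
    moreover have "J \<subseteq> R"
    proof
      fix y assume "y \<in> J"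
      then obtain x h where "y = x + h * g" "x \<in> m" "h \<in> R" by (auto simp: J_def)
      thus "y \<in> R"
        using subring_add[OF R subsetD[OF m(2)] subring_mult[OF R _ g(1)]] by simp
    qed
    moreover have "y - y' \<in> J" if yy: "y \<in> J" "y' \<in> J" for y y'
    proof -
      obtain x h x' h' where "y = x + h * g" "x \<in> m" "h \<in> R" "y' = x' + h' * g" "x' \<in> m" "h' \<in> R"
        using yy by (auto simp: J_def)
      moreover from this have "y - y' = (x - x') + (h - h') * g"
        by (simp add: algebra_simps)
      ultimately show ?thesis
        unfolding J_def using m(4) subring_diff[OF R] by blast
    qed
    moreover have "y * y' \<in> J" if yy: "y \<in> R" "y' \<in> J" for y y'
    proof -
      obtain x' h' where "y' = x' + h' * g" "x' \<in> m" "h' \<in> R"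
        using yy by (auto simp: J_def)
      moreover from this have "y * y' = y * x' + (y * h') * g"
        by (simp add: algebra_simps)
      ultimately show ?thesis
        unfolding J_def using m(5)[OF yy(1)] subring_mult[OF R yy(1)] by blast
    qed
    ultimately have "1 \<in> J"
      unfolding \<A>_def by blast
    then obtain x h where "1 = x + h * g" "x \<in> m" "h \<in> R" by (auto simp: J_def)
    thus ?thesis by (metis add_diff_cancel_right')
  qed
  have "x \<in> m \<or> y \<in> m" if xy: "x \<in> R" "y \<in> R" "x * y \<in> m" for x y
  proof (rule ccontr)
    assume "\<not> (x \<in> m \<or> y \<in> m)"
    then obtain h where h: "h \<in> R" "1 - h * x \<in> m"
      using maximal xy(1) by blast
    have "y * (1 - h * x) + h * (x * y) \<in> m"
      using m(5)[OF xy(2) h(2)] m(5)[OF h(1) xy(3)] by (rule m_add)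
    moreover have "y * (1 - h * x) + h * (x * y) = y"
      by (simp add: algebra_simps)
    ultimately show False using \<open>\<not> (x \<in> m \<or> y \<in> m)\<close> by simp
  qed
  hence "prime_in R m"
    using R m m0 by (auto simp: prime_in_def)
  thus ?thesis using that m(1) maximal by blast
qed

lemma frobenius_additive_A_emb:
  fixes \<iota> :: "'a::{finite,field} fls \<Rightarrow> 'c::field"
  assumes "\<iota> \<in> Ring.ring_hom ring_of_type_algebra ring_of_type_algebra"
  shows "frobenius_additive TYPE('c) CARD('a)"
proof (rule frobenius_additive_hom)
  interpret comm_ring_hom "A_emb \<iota>"
    using assms by (rule comm_ring_hom_A_emb)
  fix n assume "of_nat n = (0 :: 'a)"
  hence "(of_nat n :: 'a poly) = 0"
    by (simp add: of_nat_poly)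
  thus "of_nat n = (0 :: 'c)"
    by (metis hom_of_nat hom_zero)
qed

locale drinfeld_over =
  fixes \<iota> :: "'a::{finite,field} fls \<Rightarrow> 'c::alg_closed_field" and F :: "'c set"
    and \<phi> :: "'a poly \<Rightarrow> 'c poly"
  assumes \<iota>: "\<iota> \<in> Ring.ring_hom ring_of_type_algebra ring_of_type_algebra"
    and F: "subfield F ring_of_type_algebra"
    and \<phi>: "drinfeld_module (A_emb \<iota>) F 2 \<phi>"
begin

sublocale frobenius_additive "CARD('a)" "TYPE('c)"
  using frobenius_additive_A_emb[OF \<iota>] .

sublocale A: integral_over "A_emb \<iota>"
  using comm_ring_hom_A_emb[OF \<iota>] by (simp add: integral_over_def)

lemmas F_ring = subfield_closed(1)[OF F]
lemmas F_closed = subring_0[OF F_ring] subring_1[OF F_ring] subring_add[OF F_ring]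
  subring_diff[OF F_ring] subring_mult[OF F_ring] subring_power[OF F_ring] subfield_closed(2)[OF F]

abbreviation R where "R \<equiv> int_closure \<iota> F"
abbreviation Abar where "Abar \<equiv> int_closure \<iota> UNIV"

lemma int_closure_iff: "x \<in> int_closure \<iota> L \<longleftrightarrow> x \<in> L \<and> A.integral x"
  by (auto simp: int_closure_def A.integral_def)

lemma R_subset: "R \<subseteq> F" "R \<subseteq> Abar"
  by (auto simp: int_closure_iff)

lemma phi_tau: "\<phi> a \<in> tau_polys CARD('a) F"
  and phi_1: "\<phi> 1 = [:0, 1:]"
  and phi_add: "\<phi> (a + b) = \<phi> a + \<phi> b"
  and phi_mult: "\<phi> (a * b) = \<phi> a \<circ>\<^sub>p \<phi> b"
  and phi_tangent: "tangent (\<phi> a) = A_emb \<iota> a"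
  and phi_degree: "a \<noteq> 0 \<Longrightarrow> degree (\<phi> a) = CARD('a) ^ (2 * degree a)"
  using \<phi> by (auto simp: drinfeld_module_def)

lemma phi_0: "\<phi> 0 = 0"
  using phi_add[of 0 0] by (metis add.right_neutral add_left_cancel)

lemma phi_nonzero: "a \<noteq> 0 \<Longrightarrow> \<phi> a \<noteq> 0"
  using phi_degree[of a] q_pos by (metis degree_0 less_numeral_extra(3) zero_less_power)

section \<open>Integrality at a prime of R and good reduction\<close>

lemma localization_power:
  assumes v: "prime_in R v" and y: "y \<in> F" "y ^ n \<in> localization R v" "n > 0"
  shows "y \<in> localization R v"
proof -
  obtain a s where as: "y ^ n = a / s" "a \<in> R" "s \<in> R" "s \<notin> v" "s \<noteq> 0"
    using y(2) by (rule localizationE[OF v])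
  \<comment> \<open>With denominator \<open>s\<close>, the n-th power of \<open>s * y\<close> is
    integral, and so is \<open>s * y\<close>. This is the integral closedness of the local ring, for
    equations of the form Y^n = c.\<close>
  have "(s * y) ^ n = s ^ (n - 1) * a"
    using as y(3) by (cases n) (auto simp: power_mult_distrib)
  also have "\<dots> \<in> R"
    using as by (intro subring_mult subring_power prime_in_subring[OF v])
  finally have "A.integral (s * y)"
    using A.integral_of_power[of "s * y" n] y(3) by (simp add: int_closure_iff)
  moreover have "s * y \<in> F"
    using y(1) as(3) R_subset by (intro F_closed(5)) auto
  ultimately have "s * y \<in> R"
    by (simp add: int_closure_iff)
  from localizationI[OF v this as(3,4)] show ?thesis
    using as(5) by simp
qed

text \<open>After division by the unit leading coefficient, one common denominator \<open>s\<close>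
  outside \<open>v\<close> clears all coefficients, and scaling the root by \<open>s\<close> keeps
  the equation monic.\<close>

lemma root_integral_over_localization:
  assumes v: "prime_in R v" and f: "\<And>n. coeff f n \<in> localization R v"
    and lead: "inverse (lead_coeff f) \<in> localization R v" and "f \<noteq> 0" and root: "poly f y = 0"
  obtains s where "s \<in> R" "s \<notin> v" "s * y \<in> Abar"
proof -
  define n where "n = degree f"
  define g where "g = smult (inverse (lead_coeff f)) f"
  have gn: "coeff g n = 1" "degree g = n"
    using \<open>f \<noteq> 0\<close> by (auto simp: g_def n_def)
  have "coeff g i \<in> localization R v" for i
    using f lead subring_mult[OF is_subring_localization[OF v]] by (simp add: g_def)
  then obtain s where s: "s \<in> R - v" "\<forall>i\<in>{..n}. s * coeff g i \<in> R"
    using localization_common_denominator[OF v, of "{..n}" "coeff g"] by blast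
  note R = prime_in_subring[OF v]
  \<comment> \<open>This is chosen so that h(s X) = s^n g(X); the top coefficient stays 1, and each
    lower one carries at least one factor \<open>s\<close>.\<close>
  define h where "h = (\<Sum>i\<le>n. monom (s ^ (n - i) * coeff g i) i)"
  have coeff_h: "coeff h i = (if i \<le> n then s ^ (n - i) * coeff g i else 0)" for i
    by (simp add: h_def coeff_sum)
  have "degree h = n"
    using gn(1) by (intro antisym degree_le le_degree) (auto simp: coeff_h)
  have "coeff h i \<in> R" for i
  proof -
    consider "i = n" | "i > n" | "i < n" by linarith
    thus ?thesis
    proof cases
      case 3
      hence "n - i = Suc (n - i - 1)" by simp
      hence eq: "s ^ (n - i) * coeff g i = s ^ (n - i - 1) * (s * coeff g i)"
        by (metis mult.assoc power_Suc2)
      have "s ^ (n - i - 1) * (s * coeff g i) \<in> R"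
        by (rule subring_mult[OF R subring_power[OF R]]) (use 3 s in auto)
      thus ?thesis
        using 3 by (simp only: coeff_h eq) simp
    qed (auto simp: coeff_h gn subring_0[OF R] subring_1[OF R])
  qed
  moreover have "poly h (s * y) = s ^ n * poly g y"
  proof -
    have "poly h (s * y) = (\<Sum>i\<le>n. s ^ (n - i) * coeff g i * (s * y) ^ i)"
      by (simp add: h_def poly_sum poly_monom)
    also have "\<dots> = (\<Sum>i\<le>n. s ^ n * (coeff g i * y ^ i))"
    proof (rule sum.cong)
      fix i assume "i \<in> {..n}"
      hence "s ^ n = s ^ (n - i) * s ^ i"
        by (simp flip: power_add)
      thus "s ^ (n - i) * coeff g i * (s * y) ^ i = s ^ n * (coeff g i * y ^ i)"
        by (simp add: power_mult_distrib)
    qed simp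
    finally show ?thesis
      using gn(2) by (simp add: poly_altdef sum_distrib_left)
  qed
  hence "poly h (s * y) = 0"
    using root by (simp add: g_def)
  moreover have "lead_coeff h = 1"
    using gn(1) by (simp add: \<open>degree h = n\<close> coeff_h)
  ultimately have "A.integral (s * y)"
    using A.integral_root[of h] by (simp add: int_closure_iff)
  hence "s * y \<in> Abar"
    by (simp add: int_closure_iff)
  thus ?thesis using that[of s] s by simp
qed

lemma lead_coeff_twist:
  "u \<noteq> 0 \<Longrightarrow> lead_coeff (twist u (\<phi> a)) = u * inverse u ^ degree (\<phi> a) * lead_coeff (\<phi> a)"
  by (simp add: coeff_twist)

lemma lead_coeff_twist_ratio:
  assumes "a \<noteq> 0" "u \<noteq> 0" "u' \<noteq> 0"
  shows "lead_coeff (twist u' (\<phi> a)) = (u / u') ^ (degree (\<phi> a) - 1) * lead_coeff (twist u (\<phi> a))"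
proof -
  obtain m where m: "degree (\<phi> a) = Suc m"
    using phi_degree[OF assms(1)] q_pos by (metis gr0_implies_Suc zero_less_power)
  show ?thesis
    using assms unfolding lead_coeff_twist[OF assms(2)] lead_coeff_twist[OF assms(3)]
    by (simp add: m field_simps)
qed

lemma good_reductionE:
  assumes "good_reduction \<iota> F 2 \<phi> v"
  obtains u where "model_coord F (localization R v) \<phi> u"
    "\<And>a. a \<noteq> 0 \<Longrightarrow> lead_coeff (twist u (\<phi> a)) \<in> Units (subring_of (localization R v))"
  using assms unfolding good_reduction_def drinfeld_module_def model_coord_def by blast

text \<open>By minimality \<open>u / u'\<close> is integral for a coordinate \<open>u'\<close> of
  good reduction. The inverse of the leading coefficient for \<open>u\<close> is a power of this
  ratio times the corresponding inverse for \<open>u'\<close>.\<close>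

lemma minimal_coord_lead:
  assumes v: "prime_in R v" and good: "good_reduction \<iota> F 2 \<phi> v"
    and u: "minimal_coord F (localization R v) \<phi> u" and "a \<noteq> 0"
  shows "inverse (lead_coeff (twist u (\<phi> a))) \<in> localization R v"
proof -
  obtain u' where u': "model_coord F (localization R v) \<phi> u'"
    "lead_coeff (twist u' (\<phi> a)) \<in> Units (subring_of (localization R v))"
    using good_reductionE[OF good] \<open>a \<noteq> 0\<close> by metis
  note B = is_subring_localization[OF v]
  have nz: "u \<noteq> 0" "u' \<noteq> 0" "u / u' \<in> localization R v"
    using u u' by (auto simp: minimal_coord_def model_coord_def)
  have "inverse (lead_coeff (twist u (\<phi> a))) =
      (u / u') ^ (degree (\<phi> a) - 1) * inverse (lead_coeff (twist u' (\<phi> a)))"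
    using lead_coeff_twist_ratio[OF \<open>a \<noteq> 0\<close> nz(2,1)] by (simp add: power_inverse[symmetric] field_simps)
  thus ?thesis
    using subring_mult[OF B subring_power[OF B nz(3)] Units_subring_of(2)[OF u'(2)]] by simp
qed

section \<open>Points of the minimal model\<close>

lemma minimal_model_points_iff:
  assumes B: "is_subring B"
  shows "y \<in> minimal_model_points \<iota> F \<phi> B \<longleftrightarrow>
    (\<exists>Y c. finite Y \<and> Y \<subseteq> minimal_line \<iota> F \<phi> \<and> (\<forall>x\<in>Y. c x \<in> B) \<and> y = (\<Sum>x\<in>Y. c x * x))"
proof
  assume "y \<in> minimal_model_points \<iota> F \<phi> B"
  then obtain S where S: "finite S" "S \<subseteq> B \<times> minimal_line \<iota> F \<phi>" "y = (\<Sum>(b, x)\<in>S. b * x)"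
    by (auto simp: minimal_model_points_def)
  \<comment> \<open>Pairs with the same second component are merged, so that each element of the
    line occurs with a single coefficient.\<close>
  define c where "c x = (\<Sum>s\<in>{s \<in> S. snd s = x}. fst s)" for x
  have "y = (\<Sum>x\<in>snd ` S. \<Sum>s\<in>{s \<in> S. snd s = x}. fst s * snd s)"
    using S(1) by (simp add: S(3) case_prod_beta sum.image_gen[of S _ snd])
  also have "\<dots> = (\<Sum>x\<in>snd ` S. c x * x)"
    by (intro sum.cong) (auto simp: c_def sum_distrib_right)
  finally have "y = (\<Sum>x\<in>snd ` S. c x * x)" .
  moreover have "c x \<in> B" for x
    unfolding c_def using S(2) by (intro subring_sum[OF B]) auto
  ultimately show "\<exists>Y c. finite Y \<and> Y \<subseteq> minimal_line \<iota> F \<phi> \<and> (\<forall>x\<in>Y. c x \<in> B) \<and> y = (\<Sum>x\<in>Y. c x * x)"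
    using S by (intro exI[of _ "snd ` S"] exI[of _ c]) auto
next
  assume "\<exists>Y c. finite Y \<and> Y \<subseteq> minimal_line \<iota> F \<phi> \<and> (\<forall>x\<in>Y. c x \<in> B) \<and> y = (\<Sum>x\<in>Y. c x * x)"
  then obtain Y c where Y: "finite Y" "Y \<subseteq> minimal_line \<iota> F \<phi>" "\<forall>x\<in>Y. c x \<in> B" "y = (\<Sum>x\<in>Y. c x * x)"
    by blast
  have "y = (\<Sum>(b, x)\<in>(\<lambda>x. (c x, x)) ` Y. b * x)"
    using Y(4) by (subst sum.reindex) (auto simp: inj_on_def)
  thus "y \<in> minimal_model_points \<iota> F \<phi> B"
    unfolding minimal_model_points_def using Y by blast
qed

lemma minimal_model_points_diff:
  assumes B: "is_subring B"
    and "y \<in> minimal_model_points \<iota> F \<phi> B" "y' \<in> minimal_model_points \<iota> F \<phi> B"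
  shows "y - y' \<in> minimal_model_points \<iota> F \<phi> B"
proof -
  obtain Y c where Y: "finite Y" "Y \<subseteq> minimal_line \<iota> F \<phi>" "\<forall>x\<in>Y. c x \<in> B" "y = (\<Sum>x\<in>Y. c x * x)"
    using assms(2) unfolding minimal_model_points_iff[OF B] by blast
  obtain Y' c' where Y': "finite Y'" "Y' \<subseteq> minimal_line \<iota> F \<phi>" "\<forall>x\<in>Y'. c' x \<in> B" "y' = (\<Sum>x\<in>Y'. c' x * x)"
    using assms(3) unfolding minimal_model_points_iff[OF B] by blast
  define d where "d x = (if x \<in> Y then c x else 0) - (if x \<in> Y' then c' x else 0)" for x
  have "(\<Sum>x\<in>Y \<union> Y'. (if x \<in> Y then c x else 0) * x) = y"
    unfolding Y(4) using Y(1) Y'(1) by (intro sum.mono_neutral_cong_right) auto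
  moreover have "(\<Sum>x\<in>Y \<union> Y'. (if x \<in> Y' then c' x else 0) * x) = y'"
    unfolding Y'(4) using Y(1) Y'(1) by (intro sum.mono_neutral_cong_right) auto
  ultimately have "y - y' = (\<Sum>x\<in>Y \<union> Y'. d x * x)"
    by (simp only: d_def left_diff_distrib sum_subtractf)
  moreover have "d x \<in> B" for x
    unfolding d_def using Y(3) Y'(3) subring_0[OF B] by (intro subring_diff[OF B]) auto
  ultimately show ?thesis
    unfolding minimal_model_points_iff[OF B] using Y Y' by (intro exI[of _ "Y \<union> Y'"] exI[of _ d]) auto
qed

lemma minimal_model_points_mult:
  assumes B: "is_subring B" and "b \<in> B" "y \<in> minimal_model_points \<iota> F \<phi> B"
  shows "b * y \<in> minimal_model_points \<iota> F \<phi> B"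
proof -
  obtain Y c where Y: "finite Y" "Y \<subseteq> minimal_line \<iota> F \<phi>" "\<forall>x\<in>Y. c x \<in> B" "y = (\<Sum>x\<in>Y. c x * x)"
    using assms(3) unfolding minimal_model_points_iff[OF B] by blast
  have "b * y = (\<Sum>x\<in>Y. (b * c x) * x)"
    by (simp add: Y(4) sum_distrib_left mult.assoc)
  thus ?thesis
    unfolding minimal_model_points_iff[OF B] using Y subring_mult[OF B assms(2)]
    by (intro exI[of _ Y] exI[of _ "\<lambda>x. b * c x"]) auto
qed

lemma nonzero_prime_iff: "nonzero_prime R v \<longleftrightarrow> prime_in R v \<and> v \<noteq> {0}"
  by (simp add: nonzero_prime_def primeideal_subring_of)

text \<open>
  If \<open>u\<close> is a coordinate with good reduction at \<open>v\<close> and the leading coefficient of \<open>u \<phi>\<^sub>a u\<inverse>\<close> is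
  \<open>b / t\<close>, then \<open>t / u\<close> lies in the line of the minimal model and generates it at \<open>v\<close>: at every
  other prime, the power of \<open>t u' / u\<close> whose exponent is one less than the degree is integral.
\<close>
lemma minimal_line_generator:
  assumes good: "\<And>v'. nonzero_prime R v' \<Longrightarrow> good_reduction \<iota> F 2 \<phi> v'"
    and v: "nonzero_prime R v" and u: "model_coord F (localization R v) \<phi> u"
    and a: "degree a > 0" and lead: "lead_coeff (twist u (\<phi> a)) \<in> localization R v"
  obtains t where "t \<in> R" "t \<notin> v" "t / u \<in> minimal_line \<iota> F \<phi>"
proof -
  have v': "prime_in R v" using v nonzero_prime_iff by blast
  have u: "u \<in> F" "u \<noteq> 0"
    using u by (auto simp: model_coord_def)
  have "a \<noteq> 0" using a by auto
  obtain b t where bt: "lead_coeff (twist u (\<phi> a)) = b / t" "b \<in> R" "t \<in> R" "t \<notin> v" "t \<noteq> 0"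
    using lead by (rule localizationE[OF v'])
  define n where "n = degree (\<phi> a)"
  have "CARD('a) ^ 1 < CARD('a) ^ (2 * degree a)"
    using a q_gt_1 by (intro power_strict_increasing) auto
  hence n: "n \<ge> 2"
    using phi_degree[OF \<open>a \<noteq> 0\<close>] q_gt_1 by (simp add: n_def)
  have "t \<in> F"
    using bt(3) R_subset by auto
  hence "t / u \<in> F"
    using u by (simp add: F_closed divide_inverse)
  moreover have "u' * (t / u) \<in> localization R v''"
    if v'': "nonzero_prime R v''" and u': "minimal_coord F (localization R v'') \<phi> u'" for v'' u'
  proof (rule localization_power)
    show p: "prime_in R v''" using v'' nonzero_prime_iff by blast
    have u'F: "u' \<in> F" "u' \<noteq> 0"
      using u' by (auto simp: minimal_coord_def model_coord_def)
    thus "u' * (t / u) \<in> F"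
      using \<open>t / u \<in> F\<close> F_closed(5) by blast
    define l where "l = lead_coeff (twist u' (\<phi> a))"
    have "l \<noteq> 0"
      using phi_nonzero[OF \<open>a \<noteq> 0\<close>] u'F by (simp add: l_def coeff_twist)
    have "b / t = (u' / u) ^ (n - 1) * l"
      using lead_coeff_twist_ratio[OF \<open>a \<noteq> 0\<close> u'F(2) u(2)] bt(1) by (simp add: n_def l_def)
    hence "(u' / u) ^ (n - 1) = b / t * inverse l"
      using \<open>l \<noteq> 0\<close> by (simp add: field_simps)
    \<comment> \<open>Since the degree is at least 2, one factor \<open>t\<close> can be split off
      to cancel the denominator of \<open>b / t\<close>.\<close>
    moreover have "n - 1 = Suc (n - 2)"
      using n by simp
    hence "t ^ (n - 1) = t ^ (n - 2) * t"
      by (simp only: power_Suc2)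
    moreover have "(u' * (t / u)) ^ (n - 1) = t ^ (n - 1) * (u' / u) ^ (n - 1)"
      by (simp add: power_mult_distrib power_divide)
    ultimately have "(u' * (t / u)) ^ (n - 1) = t ^ (n - 2) * b * inverse l"
      using bt(5) by simp
    moreover have "inverse l \<in> localization R v''"
      unfolding l_def using minimal_coord_lead[OF p good[OF v''] u' \<open>a \<noteq> 0\<close>] .
    moreover have "t ^ (n - 2) * b \<in> localization R v''"
      using bt by (intro localization_superset[OF p] subring_mult subring_power prime_in_subring[OF p])
    ultimately show "(u' * (t / u)) ^ (n - 1) \<in> localization R v''"
      by (simp add: subring_mult[OF is_subring_localization[OF p]])
    show "n - 1 > 0" using n by simp
  qed
  ultimately have "t / u \<in> minimal_line \<iota> F \<phi>"
    unfolding minimal_line_def by blast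
  thus ?thesis using that bt by blast
qed

text \<open>A local-to-global argument: were the ideal \<open>I\<close> of multipliers bringing
  \<open>x\<close> into the model proper, it would lie in some maximal ideal \<open>m\<close>. At
  \<open>m\<close>, a generator \<open>t / u\<close> of the line and a denominator \<open>s\<close>
  of \<open>u * x\<close> yield the element \<open>t * s\<close> of \<open>I\<close> outside
  \<open>m\<close>.\<close>

lemma torsion_in_minimal_model_points:
  assumes good: "\<And>v'. nonzero_prime R v' \<Longrightarrow> good_reduction \<iota> F 2 \<phi> v'"
    and v0: "nonzero_prime R v0" and Abar: "is_subring Abar"
    and a: "degree a > 0" and x: "poly (\<phi> a) x = 0"
  shows "x \<in> minimal_model_points \<iota> F \<phi> Abar"
proof (rule ccontr)
  assume contra: "x \<notin> minimal_model_points \<iota> F \<phi> Abar"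
  define I where "I = {r \<in> R. r * x \<in> minimal_model_points \<iota> F \<phi> Abar}"
  have v0': "prime_in R v0" using v0 nonzero_prime_iff by blast
  note R = prime_in_subring[OF v0']
  have I: "I \<subseteq> R" "0 \<in> I" "1 \<notin> I"
    using contra subring_0[OF R] minimal_model_points_iff[OF Abar, of 0]
    by (auto simp: I_def intro!: exI[of _ "{}"])
  have I_diff: "r - s \<in> I" if "r \<in> I" "s \<in> I" for r s
    using that subring_diff[OF R] minimal_model_points_diff[OF Abar]
    by (simp add: I_def left_diff_distrib)
  have I_mult: "r * s \<in> I" if "r \<in> R" "s \<in> I" for r s
    using that subring_mult[OF R] minimal_model_points_mult[OF Abar] R_subset
    by (auto simp: I_def mult.assoc)
  obtain m where m: "prime_in R m" "I \<subseteq> m" "\<And>g. g \<in> R \<Longrightarrow> g \<notin> m \<Longrightarrow> \<exists>h\<in>R. 1 - h * g \<in> m"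
    using exists_maximal_ideal[OF R I I_diff I_mult] by metis
  \<comment> \<open>Good reduction is known at nonzero primes only. If {0} were maximal,
    \<open>R\<close> would be a field, but it contains the nonzero proper ideal
    \<open>v0\<close>.\<close>
  have "m \<noteq> {0}"
  proof
    assume m0: "m = {0}"
    obtain g where g: "g \<in> v0" "g \<noteq> 0"
      using v0 prime_in_0[OF v0'] nonzero_prime_iff by blast
    hence "g \<in> R" using prime_in_subset[OF v0'] by auto
    then obtain h where "h \<in> R" "1 - h * g = 0"
      using m(3) g m0 by blast
    hence "1 \<in> v0"
      using prime_in_mult[OF v0' _ g(1), of h] by simp
    thus False using prime_in_1[OF v0'] by simp
  qed
  hence nz: "nonzero_prime R m" using m(1) nonzero_prime_iff by blast
  have "a \<noteq> 0" using a by auto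
  obtain u where u: "model_coord F (localization R m) \<phi> u"
    and lead: "lead_coeff (twist u (\<phi> a)) \<in> Units (subring_of (localization R m))"
    using good_reductionE[OF good[OF nz]] \<open>a \<noteq> 0\<close> by metis
  have u0: "u \<noteq> 0" and tw: "twist u (\<phi> a) \<in> tau_polys CARD('a) (localization R m)"
    using u by (auto simp: model_coord_def)
  obtain t where t: "t \<in> R" "t \<notin> m" "t / u \<in> minimal_line \<iota> F \<phi>"
    using minimal_line_generator[OF good nz u a] Units_subring_of(1)[OF lead] by blast
  have "poly (twist u (\<phi> a)) (u * x) = 0"
    using x by (simp add: poly_twist[OF u0])
  moreover have "twist u (\<phi> a) \<noteq> 0"
    using Units_subring_of(3)[OF lead] by auto
  ultimately obtain s where s: "s \<in> R" "s \<notin> m" "s * (u * x) \<in> Abar"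
    using root_integral_over_localization[OF m(1) tau_polysD(1)[OF tw] Units_subring_of(2)[OF lead]] by blast
  have "t * s * x = (\<Sum>l\<in>{t / u}. (s * (u * x)) * l)"
    using u0 by (simp add: field_simps)
  hence "t * s * x \<in> minimal_model_points \<iota> F \<phi> Abar"
    unfolding minimal_model_points_iff[OF Abar] using s(3) t(3)
    by (intro exI[of _ "{t / u}"] exI[of _ "\<lambda>_. s * (u * x)"]) auto
  hence "t * s \<in> I"
    using subring_mult[OF R t(1) s(1)] by (simp add: I_def)
  thus False
    using m(2) prime_in_notin_mult[OF m(1) t(1,2) s(1,2)] by blast
qed

lemma card_torsion:
  assumes "a \<noteq> 0"
  shows "card {x. poly (\<phi> a) x = 0} = CARD('a) ^ (2 * degree a)"
    and "\<phi> a = smult (lead_coeff (\<phi> a)) (\<Prod>x\<in>{x. poly (\<phi> a) x = 0}. [:- x, 1:])"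
proof -
  have "pderiv (\<phi> a) = [:A_emb \<iota> a:]" "A_emb \<iota> a \<noteq> 0"
    using pderiv_tau[OF phi_tau[of a]] phi_tangent assms A_emb_eq_0_iff[OF \<iota>] by auto
  from card_roots_separable[OF this] show "card {x. poly (\<phi> a) x = 0} = CARD('a) ^ (2 * degree a)"
    "\<phi> a = smult (lead_coeff (\<phi> a)) (\<Prod>x\<in>{x. poly (\<phi> a) x = 0}. [:- x, 1:])"
    using phi_degree[OF assms] by auto
qed

end

section \<open>Reduction of endomorphisms and torsion points\<close>

text \<open>The two bijections express that the endomorphism rings over F and over R are both \<O>,
  read off on the tangent space. The prime \<open>w\<close> above \<open>v\<close> serves to reduce
  points that are not defined over F.\<close>

locale cm_reduction = drinfeld_over \<iota> F \<phi>
  for \<iota> :: "'a::{finite,field} fls \<Rightarrow> 'c::alg_closed_field" and F and \<phi> +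
  fixes \<O> v w :: "'c set" and P :: "'a poly" and u :: 'c and red :: "'c \<Rightarrow> 'a alg_closure"
  assumes \<O>: "is_subring \<O>"
    and bij: "bij_betw tangent (End_over F \<phi>) \<O>"
    and bij_minimal: "bij_betw tangent (End_minimal_model \<iota> F \<phi>) \<O>"
    and P: "prime_elem P"
    and v: "prime_in R v" and v_P: "A_emb \<iota> P \<in> v"
    and w: "prime_in Abar w" and w_v: "w \<inter> R = v"
    and red_hom: "red \<in> Ring.ring_hom (subring_of (localization Abar w)) ring_of_type_algebra"
    and u: "minimal_coord F (localization R v) \<phi> u"
    and good: "\<And>v'. nonzero_prime R v' \<Longrightarrow> good_reduction \<iota> F 2 \<phi> v'"
begin

abbreviation d where "d \<equiv> degree P"
abbreviation B where "B \<equiv> localization R v"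
abbreviation Bw where "Bw \<equiv> localization Abar w"
abbreviation p where "p \<equiv> A_emb \<iota> P"

lemma P_nonzero: "P \<noteq> 0" and d_pos: "d > 0"
  using P prime_elem_degree_pos by auto

lemma nonzero_prime_v: "nonzero_prime R v"
  using v v_P P_nonzero A_emb_eq_0_iff[OF \<iota>] by (auto simp: nonzero_prime_iff)

sublocale red: partial_hom Bw red
  by unfold_locales (fact is_subring_localization[OF w] red_hom)+

lemma B_subset: "B \<subseteq> Bw"
  using localization_mono[OF R_subset(2) w_v] .

lemma u_nonzero: "u \<noteq> 0"
  using u by (auto simp: minimal_coord_def model_coord_def)

lemmas \<O>_closed = subring_0[OF \<O>] subring_1[OF \<O>] subring_add[OF \<O>] subring_diff[OF \<O>]
  subring_mult[OF \<O>] subring_power[OF \<O>]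

section \<open>The endomorphism ring and its reduction\<close>

lemma End_tau: "f \<in> End_over F \<phi> \<Longrightarrow> f \<in> tau_polys CARD('a) F"
  and End_commute: "f \<in> End_over F \<phi> \<Longrightarrow> f \<circ>\<^sub>p \<phi> a = \<phi> a \<circ>\<^sub>p f"
  by (auto simp: End_over_def)

lemma End_diff:
  assumes "f \<in> End_over F \<phi>" "g \<in> End_over F \<phi>"
  shows "f - g \<in> End_over F \<phi>"
  using assms tau_polys_diff[OF F_ring] tau_pcompose_diff[OF phi_tau]
  by (simp add: End_over_def pcompose_diff)

lemma End_pcompose:
  assumes "f \<in> End_over F \<phi>" "g \<in> End_over F \<phi>"
  shows "f \<circ>\<^sub>p g \<in> End_over F \<phi>"
proof -
  have "f \<circ>\<^sub>p g \<circ>\<^sub>p \<phi> a = \<phi> a \<circ>\<^sub>p (f \<circ>\<^sub>p g)" for a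
    using assms by (metis End_commute pcompose_assoc)
  thus ?thesis
    using tau_polys_pcompose[OF F_ring End_tau[OF assms(1)] End_tau[OF assms(2)]]
    by (simp add: End_over_def)
qed

lemma phi_in_End: "\<phi> a \<in> End_over F \<phi>"
  using phi_tau by (simp add: End_over_def mult.commute flip: phi_mult)

lemma endo_in: "\<alpha> \<in> \<O> \<Longrightarrow> endo F \<phi> \<alpha> \<in> End_over F \<phi>"
  unfolding endo_def using bij_betw_the_inv_into[OF bij] by (rule bij_betwE[rule_format])

lemma tangent_endo: "\<alpha> \<in> \<O> \<Longrightarrow> tangent (endo F \<phi> \<alpha>) = \<alpha>"
  unfolding endo_def by (rule f_the_inv_into_f_bij_betw[OF bij]) auto

lemma endo_tangent: "f \<in> End_over F \<phi> \<Longrightarrow> endo F \<phi> (tangent f) = f"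
  unfolding endo_def using bij by (auto simp: bij_betw_def intro: the_inv_into_f_f)

lemma tangent_in: "f \<in> End_over F \<phi> \<Longrightarrow> tangent f \<in> \<O>"
  using bij by (auto simp: bij_betw_def)

lemma endo_tau: "\<alpha> \<in> \<O> \<Longrightarrow> endo F \<phi> \<alpha> \<in> tau_polys CARD('a) F"
  using End_tau endo_in by blast

lemma endo_coeff_0: "\<alpha> \<in> \<O> \<Longrightarrow> coeff (endo F \<phi> \<alpha>) 0 = 0"
  using tau_polys_coeff_0[OF q_pos endo_tau] .

text \<open>Both sides are endomorphisms with the same tangent, and an endomorphism is determined by
  its tangent; \<open>endo_mult\<close> follows in the same way.\<close>

lemma endo_diff:
  assumes "\<alpha> \<in> \<O>" "\<beta> \<in> \<O>"
  shows "endo F \<phi> (\<alpha> - \<beta>) = endo F \<phi> \<alpha> - endo F \<phi> \<beta>"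
  using endo_tangent[OF End_diff[OF endo_in[OF assms(1)] endo_in[OF assms(2)]]] assms
  by (simp add: tangent_endo del: One_nat_def)

lemma endo_mult:
  assumes "\<alpha> \<in> \<O>" "\<beta> \<in> \<O>"
  shows "endo F \<phi> (\<alpha> * \<beta>) = endo F \<phi> \<alpha> \<circ>\<^sub>p endo F \<phi> \<beta>"
  using endo_tangent[OF End_pcompose[OF endo_in[OF assms(1)] endo_in[OF assms(2)]]] assms
  by (simp add: tangent_endo tangent_pcompose[OF endo_coeff_0] del: One_nat_def)

lemma endo_A: "A_emb \<iota> a \<in> \<O>" "endo F \<phi> (A_emb \<iota> a) = \<phi> a"
  using tangent_in[OF phi_in_End] endo_tangent[OF phi_in_End] by (simp_all only: phi_tangent)

lemma endo_add:
  assumes "\<alpha> \<in> \<O>" "\<beta> \<in> \<O>"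
  shows "endo F \<phi> (\<alpha> + \<beta>) = endo F \<phi> \<alpha> + endo F \<phi> \<beta>"
  using endo_diff[of "\<alpha> + \<beta>" \<beta>] assms by (simp add: \<O>_closed)

lemma endo_1: "endo F \<phi> 1 = [:0, 1:]"
  using endo_A(2)[of 1] by (simp add: phi_1)

text \<open>An endomorphism over F shares its tangent with one of the minimal model, and the tangent
  map is injective on the larger ring.\<close>

lemma End_minimal_eq: "End_minimal_model \<iota> F \<phi> = End_over F \<phi>"
proof
  show sub: "End_minimal_model \<iota> F \<phi> \<subseteq> End_over F \<phi>"
    by (auto simp: End_minimal_model_def)
  show "End_over F \<phi> \<subseteq> End_minimal_model \<iota> F \<phi>"
  proof
    fix f assume f: "f \<in> End_over F \<phi>"
    then obtain g where g: "g \<in> End_minimal_model \<iota> F \<phi>" "tangent g = tangent f"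
      using bij_minimal tangent_in by (metis bij_betw_def imageE)
    hence "g = f"
      using endo_tangent f sub by (metis subsetD)
    thus "f \<in> End_minimal_model \<iota> F \<phi>" using g by simp
  qed
qed

lemma twist_endo_tau: "\<alpha> \<in> \<O> \<Longrightarrow> twist u (endo F \<phi> \<alpha>) \<in> tau_polys CARD('a) B"
proof -
  assume "\<alpha> \<in> \<O>"
  hence "endo F \<phi> \<alpha> \<in> End_minimal_model \<iota> F \<phi>"
    using endo_in by (simp add: End_minimal_eq)
  thus ?thesis
    using nonzero_prime_v u unfolding End_minimal_model_def by blast
qed

abbreviation r where "r \<alpha> \<equiv> red_tau red u (endo F \<phi> \<alpha>)"

lemma coeffs_in_twist: "\<alpha> \<in> \<O> \<Longrightarrow> red.coeffs_in (twist u (endo F \<phi> \<alpha>))"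
  using red.coeffs_in_tau_polys[OF tau_polys_mono[OF B_subset twist_endo_tau]] .

lemma coeff_r_0: "\<alpha> \<in> \<O> \<Longrightarrow> coeff (r \<alpha>) 0 = 0"
  using tau_polys_coeff_0[OF q_pos twist_endo_tau] by (simp add: red_tau_def)

lemma r_mult:
  assumes "\<alpha> \<in> \<O>" "\<beta> \<in> \<O>"
  shows "r (\<alpha> * \<beta>) = r \<alpha> \<circ>\<^sub>p r \<beta>"
  using assms by (simp add: red_tau_def endo_mult twist_pcompose[OF u_nonzero] red.red_poly_pcompose coeffs_in_twist)

lemma r_add:
  assumes "\<alpha> \<in> \<O>" "\<beta> \<in> \<O>"
  shows "r (\<alpha> + \<beta>) = r \<alpha> + r \<beta>"
proof -
  have "twist u (endo F \<phi> (\<alpha> + \<beta>)) = twist u (endo F \<phi> \<alpha>) + twist u (endo F \<phi> \<beta>)"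
    using assms by (intro poly_eqI) (simp add: endo_add coeff_twist algebra_simps)
  thus ?thesis
    using assms by (simp add: red_tau_def red.red_poly_add coeffs_in_twist)
qed

lemma tangent_r_1: "tangent (r 1) = 1"
  using u_nonzero by (simp add: red_tau_def endo_1 coeff_twist red.red_1)

lemma degree_r: "degree (r \<alpha>) \<le> degree (endo F \<phi> \<alpha>)"
  unfolding red_tau_def using degree_map_poly_le[of red "twist u (endo F \<phi> \<alpha>)"] u_nonzero by simp

lemma lead_P: "lead_coeff (twist u (\<phi> P)) \<in> B" "inverse (lead_coeff (twist u (\<phi> P))) \<in> B"
  "lead_coeff (twist u (\<phi> P)) \<noteq> 0"
proof -
  show "lead_coeff (twist u (\<phi> P)) \<in> B"
    using tau_polysD(1)[OF twist_endo_tau[OF endo_A(1)], of P] by (simp add: endo_A)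
  show "inverse (lead_coeff (twist u (\<phi> P))) \<in> B"
    by (rule minimal_coord_lead[OF v good[OF nonzero_prime_v] u P_nonzero])
  show "lead_coeff (twist u (\<phi> P)) \<noteq> 0"
    using phi_nonzero[OF P_nonzero] u_nonzero by (simp add: coeff_twist)
qed

text \<open>
  Comparing the leading coefficients in \<open>f \<phi>\<^sub>P = \<phi>\<^sub>P f\<close> shows that the leading coefficient of an
  endomorphism \<open>f\<close> is a unit, so reduction is injective on endomorphisms.
\<close>
lemma r_eq_0_imp:
  assumes "\<alpha> \<in> \<O>" "r \<alpha> = 0"
  shows "\<alpha> = 0"
proof (rule ccontr)
  assume "\<alpha> \<noteq> 0"
  define f where "f = twist u (endo F \<phi> \<alpha>)"
  define g where "g = twist u (\<phi> P)"
  have "f \<noteq> 0"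
    using tangent_endo[OF assms(1)] \<open>\<alpha> \<noteq> 0\<close> tangent_twist[OF u_nonzero, of "endo F \<phi> \<alpha>"]
    by (auto simp: f_def)
  have f: "f \<in> tau_polys CARD('a) B"
    unfolding f_def by (rule twist_endo_tau[OF assms(1)])
  have deg_g: "degree g = CARD('a) ^ (2 * d)"
    using phi_degree[OF P_nonzero] u_nonzero by (simp add: g_def)
  obtain i where deg_f: "degree f = CARD('a) ^ i"
    using tau_polys_degree[OF f \<open>f \<noteq> 0\<close>] .
  have pos: "degree f > 0" "degree g > 0"
    using deg_f deg_g q_pos by simp_all
  \<comment> \<open>After cancelling one factor of each leading coefficient, that of
    \<open>f\<close> must still occur with positive exponent, so that it divides a power of the unit
    \<open>lead_coeff g\<close>.\<close>
  have deg_g_gt: "degree g \<ge> 2"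
    using d_pos q_gt_1 one_less_power[of "CARD('a)" "2 * d"] by (simp add: deg_g)
  have "f \<circ>\<^sub>p g = g \<circ>\<^sub>p f"
    using End_commute[OF endo_in[OF assms(1)], of P]
    by (simp add: f_def g_def flip: twist_pcompose[OF u_nonzero])
  hence "lead_coeff f * lead_coeff g ^ degree f = lead_coeff g * lead_coeff f ^ degree g"
    using lead_coeff_comp[OF pos(2), of f] lead_coeff_comp[OF pos(1), of g] by simp
  moreover have "lead_coeff f \<noteq> 0" using \<open>f \<noteq> 0\<close> by simp
  moreover have "lead_coeff g \<noteq> 0" using lead_P(3) by (simp add: g_def)
  moreover define k l where "k = degree f - 1" and "l = degree g - 2"
  have "degree f = Suc k" "degree g = Suc (Suc l)"
    using pos deg_g_gt by (auto simp: k_def l_def)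
  ultimately have "lead_coeff g ^ k = lead_coeff f ^ l * lead_coeff f"
    by (simp add: mult_ac del: leading_coeff_0_iff)
  hence "inverse (lead_coeff f) = lead_coeff f ^ l * inverse (lead_coeff g) ^ k"
    using \<open>lead_coeff f \<noteq> 0\<close> \<open>lead_coeff g \<noteq> 0\<close>
    by (simp add: field_simps power_inverse del: leading_coeff_0_iff)
  moreover have "lead_coeff f \<in> B"
    using tau_polysD(1)[OF f] .
  moreover note B = is_subring_localization[OF v]
  ultimately have "inverse (lead_coeff f) \<in> B"
    using lead_P(2) by (simp add: g_def subring_mult[OF B] subring_power[OF B])
  hence "red (lead_coeff f) \<noteq> 0"
    using red.red_unit \<open>lead_coeff f \<in> B\<close> \<open>lead_coeff f \<noteq> 0\<close> B_subset by (metis subsetD)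
  hence "coeff (r \<alpha>) (degree f) \<noteq> 0"
    by (simp add: red_tau_def f_def)
  thus False using assms(2) by simp
qed

section \<open>The P-torsion and its reduction\<close>

definition T where "T = {x. poly (\<phi> P) x = 0}"

lemma minimal_model_torsion_eq: "minimal_model_torsion \<iota> F \<phi> P = T"
  using torsion_in_minimal_model_points[OF good nonzero_prime_v prime_in_subring[OF w] d_pos]
  by (auto simp: minimal_model_torsion_def T_def)

lemma finite_T: "finite T"
  unfolding T_def using phi_nonzero[OF P_nonzero] by (rule poly_roots_finite)

text \<open>The scaled point is a root of a polynomial over the local ring at \<open>v\<close> with
  unit leading coefficient. A denominator in \<open>R\<close> outside \<open>v\<close> is also
  outside \<open>w\<close>.\<close>

lemma integral_point:
  assumes "x \<in> T"
  shows "u * x \<in> Bw"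
proof -
  have "poly (twist u (\<phi> P)) (u * x) = 0"
    using assms by (simp add: T_def poly_twist[OF u_nonzero])
  moreover have "twist u (\<phi> P) \<noteq> 0"
    using lead_P(3) by auto
  moreover have "coeff (twist u (\<phi> P)) n \<in> B" for n
    using tau_polysD(1)[OF twist_endo_tau[OF endo_A(1)], of P] by (simp add: endo_A)
  ultimately obtain s where s: "s \<in> R" "s \<notin> v" "s * (u * x) \<in> Abar"
    using root_integral_over_localization[OF v _ lead_P(2)] by blast
  hence "s \<in> Abar" "s \<notin> w"
    using R_subset w_v by auto
  from localizationI[OF w s(3) this] show ?thesis
    using s(2) prime_in_0[OF v] by (auto simp: field_simps split: if_splits)
qed

lemma twist_P_factors:
  "twist u (\<phi> P) = smult (lead_coeff (twist u (\<phi> P))) (\<Prod>y\<in>(\<lambda>x. u * x) ` T. [:- y, 1:])"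
proof -
  define g where "g = twist u (\<phi> P)"
  have pd: "pderiv g = [:p:]"
    unfolding g_def using pderiv_tau[OF twist_endo_tau[OF endo_A(1)], of P] u_nonzero phi_tangent[of P]
    by (simp add: endo_A del: One_nat_def)
  have "p \<noteq> 0"
    using P_nonzero A_emb_eq_0_iff[OF \<iota>] by simp
  have "{y. poly g y = 0} = (\<lambda>x. u * x) ` T"
  proof
    show "{y. poly g y = 0} \<subseteq> (\<lambda>x. u * x) ` T"
    proof
      fix y assume "y \<in> {y. poly g y = 0}"
      hence "u * poly (\<phi> P) (y / u) = 0"
        using poly_twist[OF u_nonzero, of "\<phi> P" "y / u"] u_nonzero by (simp add: g_def)
      hence "y / u \<in> T" using u_nonzero by (simp add: T_def)
      thus "y \<in> (\<lambda>x. u * x) ` T" using u_nonzero by (intro image_eqI[of _ _ "y / u"]) auto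
    qed
    show "(\<lambda>x. u * x) ` T \<subseteq> {y. poly g y = 0}"
      by (auto simp: g_def T_def poly_twist[OF u_nonzero])
  qed
  thus ?thesis
    using card_roots_separable(2)[OF pd \<open>p \<noteq> 0\<close>] by (simp add: g_def)
qed

text \<open>The product runs over the roots before reduction, hence it records how many of them
  reduce to the same point.\<close>

lemma r_P: "r p = smult (red (lead_coeff (twist u (\<phi> P)))) (\<Prod>y\<in>(\<lambda>x. u * x) ` T. [:- red y, 1:])"
proof -
  have "map_poly red (smult (lead_coeff (twist u (\<phi> P))) (\<Prod>y\<in>(\<lambda>x. u * x) ` T. [:- y, 1:])) =
    smult (red (lead_coeff (twist u (\<phi> P)))) (\<Prod>y\<in>(\<lambda>x. u * x) ` T. [:- red y, 1:])"
    using finite_T integral_point lead_P(1) B_subset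
    by (intro conjunct2[OF red.red_poly_linear_factors]) auto
  thus ?thesis
    unfolding red_tau_def endo_A(2) by (subst twist_P_factors)
qed

text \<open>The reduced polynomial splits into factors belonging to the reduced torsion points, so
  it has no other roots.\<close>

lemma reduction_surjective:
  "red_point red u ` minimal_model_torsion \<iota> F \<phi> P = fibre_torsion red u \<phi> P"
proof -
  have nz: "red (lead_coeff (twist u (\<phi> P))) \<noteq> 0"
    using red.red_unit lead_P B_subset by blast
  have "poly (r p) y = 0 \<longleftrightarrow> (\<exists>x\<in>T. y = red (u * x))" for y
    unfolding r_P using nz finite_T by (auto simp: poly_prod)
  thus ?thesis
    by (auto simp: minimal_model_torsion_eq fibre_torsion_def red_point_def endo_A)
qed

text \<open>Evaluation is composition with a constant polynomial, so the compatibility of reduction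
  with composition applies.\<close>

lemma red_poly_eval:
  assumes "\<alpha> \<in> \<O>" "u * x \<in> Bw"
  shows "red (u * poly (endo F \<phi> \<alpha>) x) = poly (r \<alpha>) (red (u * x))"
proof -
  have ci: "red.coeffs_in [:u * x:]"
    using assms(2) by (simp add: red.coeffs_in_pCons_iff)
  have "map_poly red (twist u (endo F \<phi> \<alpha>) \<circ>\<^sub>p [:u * x:]) = r \<alpha> \<circ>\<^sub>p [:red (u * x):]"
    using red.red_poly_pcompose[OF coeffs_in_twist[OF assms(1)] ci] by (simp add: red_tau_def red.red_poly_const)
  thus ?thesis
    by (simp add: pcompose_pCons_0 poly_twist[OF u_nonzero] red.red_poly_const)
qed

abbreviation act where "act \<alpha> \<equiv> poly (endo F \<phi> \<alpha>)"

text \<open>The essential point is faithfulness: an endomorphism killing \<open>T\<close> factors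
  through the separable polynomial \<open>\<phi> P\<close>, and the left factor is itself an
  endomorphism.\<close>

lemma split_torsion:
  assumes prime: "prime_in \<O> \<PP>" "prime_in \<O> \<PP>'" and ne: "\<PP> \<noteq> \<PP>'" and p: "p \<in> \<PP>" "p \<in> \<PP>'"
    and prod: "\<And>i j. i \<in> \<PP> \<Longrightarrow> j \<in> \<PP>' \<Longrightarrow> \<exists>g\<in>\<O>. i * j = p * g"
  shows "split_torsion \<O> act T p \<PP> \<PP>' (A_emb \<iota> ` reps d) (CARD('a) ^ d)"
proof
  have diff: "A_emb \<iota> a - A_emb \<iota> b \<notin> Q"
    if Q: "prime_in \<O> Q" "p \<in> Q" and ab: "a \<in> reps d" "b \<in> reps d" "a \<noteq> b" for a b Q
  proof
    assume "A_emb \<iota> a - A_emb \<iota> b \<in> Q"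
    moreover have "\<not> P dvd a - b"
      using reps_eq_if_dvd ab by blast
    then obtain h k where "h * (a - b) + k * P = 1"
      by (rule prime_elem_bezout[OF P])
    hence "A_emb \<iota> h * (A_emb \<iota> a - A_emb \<iota> b) + A_emb \<iota> k * p = 1"
      by (metis A.hom_add A.hom_minus A.hom_mult A.hom_one)
    ultimately have "1 \<in> Q"
      using prime_in_add[OF Q(1) prime_in_mult[OF Q(1) endo_A(1)[of h]] prime_in_mult[OF Q(1) endo_A(1)[of k] Q(2)]]
      by metis
    thus False using prime_in_1[OF Q(1)] by simp
  qed
  show "prime_in \<O> \<PP>" "prime_in \<O> \<PP>'" "\<PP> \<noteq> \<PP>'" "p \<in> \<PP>" "p \<in> \<PP>'" by fact+
  show "\<exists>g\<in>\<O>. i * j = p * g" if "i \<in> \<PP>" "j \<in> \<PP>'" for i j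
    using prod that .
  show "finite T" by (rule finite_T)
  show "0 \<in> T"
    using tau_polys_poly_0[OF q_pos phi_tau] by (simp add: T_def)
  show "x + y \<in> T" if "x \<in> T" "y \<in> T" for x y
    using that tau_poly_add[OF phi_tau] by (simp add: T_def)
  show "act f x \<in> T" if "f \<in> \<O>" "x \<in> T" for f x
  proof -
    have "poly (\<phi> P) (act f x) = act f (poly (\<phi> P) x)"
      using End_commute[OF endo_in[OF that(1)], of P] by (metis poly_pcompose)
    thus ?thesis
      using that tau_polys_poly_0[OF q_pos endo_tau[OF that(1)]] by (simp add: T_def)
  qed
  show "act (f + g) x = act f x + act g x" if "f \<in> \<O>" "g \<in> \<O>" for f g x
    using that by (simp add: endo_add)
  show "act (f * g) x = act f (act g x)" if "f \<in> \<O>" "g \<in> \<O>" for f g x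
    using that by (simp add: endo_mult poly_pcompose)
  show "act 1 x = x" for x
    by (simp add: endo_1)
  show "act f (x + y) = act f x + act f y" if "f \<in> \<O>" for f x y
    using tau_poly_add[OF endo_tau[OF that]] .
  show "act p x = 0" if "x \<in> T" for x
    using that by (simp add: endo_A T_def)
  show "\<exists>g\<in>\<O>. f = p * g" if f: "f \<in> \<O>" "\<And>x. x \<in> T \<Longrightarrow> act f x = 0" for f
  proof -
    obtain g where g: "g \<in> tau_polys CARD('a) F" "endo F \<phi> f = g \<circ>\<^sub>p \<phi> P"
    proof (rule tau_factor_through[OF F_ring _ endo_tau[OF f(1)] phi_tau phi_nonzero[OF P_nonzero]])
      show "card {x. poly (\<phi> P) x = 0} = degree (\<phi> P)"
        using card_torsion(1)[OF P_nonzero] phi_degree[OF P_nonzero] by simp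
      show "inverse x \<in> F" if "x \<in> F" for x
        using that by (rule F_closed)
      show "act f x = 0" if "poly (\<phi> P) x = 0" for x
        using f(2) that by (simp add: T_def)
    qed
    \<comment> \<open>Composition with \<open>\<phi> P\<close> on the right can be cancelled, and
      after it both sides agree because \<open>f\<close> and \<open>\<phi> P\<close> commute with
      \<open>\<phi> a\<close>.\<close>
    have "g \<circ>\<^sub>p \<phi> a = \<phi> a \<circ>\<^sub>p g" for a
    proof -
      have "(g \<circ>\<^sub>p \<phi> a - \<phi> a \<circ>\<^sub>p g) \<circ>\<^sub>p \<phi> P = g \<circ>\<^sub>p \<phi> P \<circ>\<^sub>p \<phi> a - \<phi> a \<circ>\<^sub>p (g \<circ>\<^sub>p \<phi> P)"
        using End_commute[OF phi_in_End, of a P] by (simp add: pcompose_diff flip: pcompose_assoc)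
      also have "\<dots> = 0"
        using End_commute[OF endo_in[OF f(1)], of a] g(2) by simp
      finally show ?thesis
        using phi_degree[OF P_nonzero] q_pos by (simp add: pcompose_eq_0_iff)
    qed
    hence gE: "g \<in> End_over F \<phi>"
      using g(1) by (simp add: End_over_def)
    have "f = tangent (g \<circ>\<^sub>p \<phi> P)"
      using tangent_endo[OF f(1)] g(2) by simp
    also have "\<dots> = p * tangent g"
      using tangent_pcompose[OF tau_polys_coeff_0[OF q_pos phi_tau], of g P] phi_tangent[of P]
      by (simp add: mult.commute)
    finally show ?thesis using tangent_in[OF gE] by blast
  qed
  show "A_emb \<iota> ` reps d \<subseteq> \<O>"
    using endo_A(1) by blast
  have "inj (A_emb \<iota>)"
    using A_emb_eq_0_iff[OF \<iota>] A.hom_minus by (intro injI) (metis eq_iff_diff_eq_0)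
  thus "card (A_emb \<iota> ` reps d) = CARD('a) ^ d"
    by (simp add: card_image card_reps inj_on_subset)
  show "a - b \<notin> \<PP> \<and> a - b \<notin> \<PP>'" if ab: "a \<in> A_emb \<iota> ` reps d" "b \<in> A_emb \<iota> ` reps d" "a \<noteq> b" for a b
    using ab diff[OF prime(1) p(1)] diff[OF prime(2) p(2)] by blast
  show "card T = (CARD('a) ^ d)\<^sup>2"
    using card_torsion(1)[OF P_nonzero] by (simp add: T_def mult.commute flip: power_mult)
qed

section \<open>The kernel of reduction\<close>

lemma dvd_of_prime_in:
  assumes "prime_in \<O> Q" "p \<in> Q" "A_emb \<iota> a \<in> Q"
  shows "P dvd a"
proof (rule ccontr)
  assume "\<not> P dvd a"
  then obtain h k where "h * a + k * P = 1"
    by (rule prime_elem_bezout[OF P])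
  hence "A_emb \<iota> h * A_emb \<iota> a + A_emb \<iota> k * p = 1"
    by (metis A.hom_add A.hom_mult A.hom_one)
  hence "1 \<in> Q"
    using prime_in_add[OF assms(1) prime_in_mult[OF assms(1) endo_A(1)[of h] assms(3)]
        prime_in_mult[OF assms(1) endo_A(1)[of k] assms(2)]] by simp
  thus False using prime_in_1[OF assms(1)] by simp
qed

text \<open>
  If all points of \<open>T\<close> reduce to \<open>0\<close>, then \<open>r p\<close> is a multiple of \<open>\<tau>\<^bsup>2d\<^esup>\<close>. For \<open>\<alpha>\<close> reducing to a
  separable endomorphism, any \<open>f\<close> with \<open>\<alpha>\<^sup>m f \<in> p\<^sup>m \<O>\<close> then reduces to a right multiple of
  \<open>\<tau>\<^bsup>2dm\<^esup>\<close>. As \<open>\<alpha> \<in> \<PP>\<close>, every element of \<open>\<O>\<close> has this property up to some \<open>a \<in> A\<close> of degree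
  less than \<open>dm\<close>; the degree of \<open>\<alpha> - a\<close> is then too small, so \<open>\<alpha> = a\<close>.
\<close>
lemma not_all_reduce_to_0_aux:
  assumes split: "split_torsion \<O> act T p \<PP> \<PP>' (A_emb \<iota> ` reps d) (CARD('a) ^ d)"
    and zero: "\<And>x. x \<in> T \<Longrightarrow> red (u * x) = 0"
    and \<alpha>: "\<alpha> \<in> \<PP>" "\<alpha>' \<in> \<PP>'" "\<alpha> + \<alpha>' = 1" and tangent: "tangent (r \<alpha>) \<noteq> 0"
  shows False
proof -
  interpret split_torsion \<O> act T p \<PP> \<PP>' "A_emb \<iota> ` reps d" "CARD('a) ^ d" by (rule split)
  interpret sw: split_torsion \<O> act T p \<PP>' \<PP> "A_emb \<iota> ` reps d" "CARD('a) ^ d" by (rule swap)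
  have \<alpha>_O: "\<alpha> \<in> \<O>" and p_O: "p \<in> \<O>"
    using \<alpha>(1) \<PP>_sub p(1) by auto
  note cl = \<O>_closed \<alpha>_O p_O endo_A(1)
  obtain c where c: "r p = smult c (monom 1 (CARD('a) ^ (2 * d)))"
  proof -
    have "(\<Prod>y\<in>(\<lambda>x. u * x) ` T. [:- red y, 1:]) = (\<Prod>y\<in>(\<lambda>x. u * x) ` T. [:0, 1:])"
      using zero by (intro prod.cong) auto
    also have "\<dots> = monom 1 (card ((\<lambda>x. u * x) ` T))"
      by (simp add: monom_altdef)
    also have "card ((\<lambda>x. u * x) ` T) = CARD('a) ^ (2 * d)"
      using u_nonzero card_torsion(1)[OF P_nonzero] by (subst card_image) (auto simp: inj_on_def T_def)
    finally show ?thesis using that r_P by metis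
  qed
  \<comment> \<open>Composing with \<open>r p\<close> on the left raises to the power q^(2d), up to
    a constant. The base case asks for one factor X, supplied by the vanishing constant
    term.\<close>
  have r_p_power: "monom 1 (CARD('a) ^ (2 * d * m)) dvd r (p ^ m)" for m
  proof (induction m)
    case 0
    have "monom (1 :: 'a alg_closure) 1 = [:0, 1:]"
      by (simp add: monom_altdef)
    moreover have "[:0, 1:] dvd r 1"
      using coeff_r_0[OF \<O>_closed(2)] by (metis minus_zero poly_0_coeff_0 poly_eq_0_iff_dvd)
    ultimately show ?case by simp
  next
    case (Suc m)
    have "r (p ^ Suc m) = smult c (r (p ^ m) ^ (CARD('a) ^ (2 * d)))"
      using r_mult[of p "p ^ m"]
      by (simp add: cl c pcompose_smult monom_altdef pcompose_hom.hom_power pcompose_pCons)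
    moreover have "monom 1 (CARD('a) ^ (2 * d * m)) ^ (CARD('a) ^ (2 * d)) dvd r (p ^ m) ^ (CARD('a) ^ (2 * d))"
      using Suc by (rule dvd_power_same)
    moreover have "monom 1 (CARD('a) ^ (2 * d * m)) ^ (CARD('a) ^ (2 * d)) = monom (1 :: 'a alg_closure) (CARD('a) ^ (2 * d * Suc m))"
      by (simp add: monom_power add.commute flip: power_add)
    ultimately show ?case by (metis dvd_smult)
  qed
  have tangent_power: "tangent (r (\<alpha> ^ m)) \<noteq> 0" for m
  proof (induction m)
    case 0
    thus ?case using tangent_r_1 by simp
  next
    case (Suc m)
    have "tangent (r (\<alpha> ^ Suc m)) = tangent (r \<alpha>) * tangent (r (\<alpha> ^ m))"
      using tangent_pcompose[OF coeff_r_0, of "\<alpha> ^ m" "r \<alpha>"] r_mult[of \<alpha> "\<alpha> ^ m"] by (simp add: cl)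
    thus ?case using Suc tangent by simp
  qed
  \<comment> \<open>The reduction of \<alpha>^m has nonzero tangent, so it can be cancelled from the
    left without changing the order at 0.\<close>
  have dvd: "monom 1 (CARD('a) ^ (2 * d * m)) dvd r f" if f: "f \<in> \<O>" "g \<in> \<O>" "\<alpha> ^ m * f = p ^ m * g" for f g m
  proof -
    have "r (\<alpha> ^ m) \<circ>\<^sub>p r f = r (p ^ m) \<circ>\<^sub>p r g"
      using r_mult[of "\<alpha> ^ m" f] r_mult[of "p ^ m" g] f by (simp add: cl)
    hence "monom 1 (CARD('a) ^ (2 * d * m)) dvd r (\<alpha> ^ m) \<circ>\<^sub>p r f"
      using monom_dvd_pcompose_left[OF r_p_power coeff_r_0[OF f(2)], of m] by simp
    thus ?thesis
      using monom_dvd_pcompose_cancel[OF coeff_r_0 tangent_power coeff_r_0] f(1) by (simp add: cl)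
  qed
  have "1 - \<alpha> = \<alpha>'" using \<alpha>(3) by (simp add: algebra_simps)
  have \<alpha>_power: "1 - \<alpha> ^ m \<in> \<PP>'" for m
  proof (induction m)
    case 0
    thus ?case using prime_in_0[OF prime'] by simp
  next
    case (Suc m)
    have "1 - \<alpha> ^ Suc m = \<alpha>' + \<alpha> * (1 - \<alpha> ^ m)"
      unfolding \<open>1 - \<alpha> = \<alpha>'\<close>[symmetric] by (simp add: algebra_simps)
    thus ?case
      using prime_in_add[OF prime' \<alpha>(2) prime_in_mult[OF prime' \<alpha>_O Suc]] by simp
  qed
  \<comment> \<open>This finds the \<PP>'-adic expansion of \<open>f\<close> digit by digit: the new
    digit \<open>b\<close> agrees modulo \<PP>' with \<open>g\<close>, and \<alpha>^m is 1 modulo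
    \<PP>'. Multiplying the error by \<alpha> from \<PP> then yields the next factor
    \<open>p\<close>.\<close>
  have approx: "\<exists>a. \<exists>g\<in>\<O>. \<alpha> ^ m * (f - A_emb \<iota> a) = p ^ m * g" if f: "f \<in> \<O>" for f m
  proof (induction m)
    case 0
    show ?case using f by (intro exI[of _ 0] bexI[of _ f]) auto
  next
    case (Suc m)
    then obtain a g where g: "g \<in> \<O>" "\<alpha> ^ m * (f - A_emb \<iota> a) = p ^ m * g" by blast
    obtain b where b: "g - A_emb \<iota> b \<in> \<PP>'"
      using sw.residue_rep[OF g(1)] by blast
    have "(g - A_emb \<iota> b) + A_emb \<iota> b * (1 - \<alpha> ^ m) \<in> \<PP>'"
      using prime_in_add[OF prime' b prime_in_mult[OF prime' endo_A(1) \<alpha>_power]] .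
    then obtain h where h: "h \<in> \<O>" "\<alpha> * ((g - A_emb \<iota> b) + A_emb \<iota> b * (1 - \<alpha> ^ m)) = p * h"
      using prod[OF \<alpha>(1)] by blast
    have "\<alpha> ^ Suc m * (f - A_emb \<iota> (a + P ^ m * b)) =
        \<alpha> * (\<alpha> ^ m * (f - A_emb \<iota> a)) - \<alpha> * \<alpha> ^ m * p ^ m * A_emb \<iota> b"
      by (simp add: A.hom_add A.hom_mult A.hom_power algebra_simps)
    also have "\<dots> = p ^ m * (\<alpha> * ((g - A_emb \<iota> b) + A_emb \<iota> b * (1 - \<alpha> ^ m)))"
      unfolding g(2) by (simp add: algebra_simps)
    also have "\<dots> = p ^ Suc m * h"
      unfolding h(2) by simp
    finally show ?case using h(1) by blast
  qed
  \<comment> \<open>Large enough that m < 2^m puts the degree of the endomorphism \<alpha> below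
    q^(2dm).\<close>
  define m where "m = Suc (degree (endo F \<phi> \<alpha>))"
  obtain a g where g: "g \<in> \<O>" "\<alpha> ^ m * (\<alpha> - A_emb \<iota> a) = p ^ m * g"
    using approx[OF \<alpha>_O, of m] by blast
  \<comment> \<open>Reducing the approximation modulo P^m changes it by a multiple of
    \<open>p ^ m\<close>, which the congruence absorbs, and bounds the degree of
    \<open>\<phi> b\<close>.\<close>
  define b where "b = a mod P ^ m"
  define k where "k = a div P ^ m"
  have "a = k * P ^ m + b" by (simp only: b_def k_def div_mult_mod_eq)
  hence "\<alpha> - A_emb \<iota> b = (\<alpha> - A_emb \<iota> a) + p ^ m * A_emb \<iota> k"
    by (simp add: A.hom_add A.hom_mult A.hom_power)
  hence "\<alpha> ^ m * (\<alpha> - A_emb \<iota> b) = p ^ m * (g + \<alpha> ^ m * A_emb \<iota> k)"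
    using g(2) by (simp add: distrib_left) (simp add: algebra_simps)
  from dvd[OF _ _ this] have dvd_r: "monom 1 (CARD('a) ^ (2 * d * m)) dvd r (\<alpha> - A_emb \<iota> b)"
    using g(1) by (simp add: cl)
  have "degree (r (\<alpha> - A_emb \<iota> b)) < CARD('a) ^ (2 * d * m)"
  proof -
    have "2 * d * m > 0" using d_pos by (simp add: m_def)
    have "m < 2 ^ m" by simp
    also have "\<dots> \<le> CARD('a) ^ m"
      using q_gt_1 by (intro power_mono) auto
    also have "\<dots> \<le> CARD('a) ^ (2 * d * m)"
      using q_gt_1 d_pos by (intro power_increasing) auto
    finally have "degree (endo F \<phi> \<alpha>) < CARD('a) ^ (2 * d * m)"
      by (simp add: m_def)
    moreover have "degree (\<phi> b) < CARD('a) ^ (2 * d * m)"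
    proof (cases "b = 0")
      case True
      thus ?thesis using q_pos by (simp add: phi_0)
    next
      case False
      have "degree (P ^ m) = d * m"
        using P_nonzero by (simp add: degree_power_eq mult.commute)
      hence "degree b < d * m"
        using degree_mod_less'[of "P ^ m" a] False P_nonzero by (simp add: b_def)
      thus ?thesis
        using q_gt_1 by (auto simp: phi_degree[OF False] intro!: power_strict_increasing)
    qed
    moreover have "endo F \<phi> (\<alpha> - A_emb \<iota> b) = endo F \<phi> \<alpha> - \<phi> b"
      by (simp add: endo_diff endo_A \<alpha>_O)
    ultimately show ?thesis
      using degree_r[of "\<alpha> - A_emb \<iota> b"] degree_diff_le_max[of "endo F \<phi> \<alpha>" "\<phi> b"] by simp
  qed
  hence "r (\<alpha> - A_emb \<iota> b) = 0"
    using monom_dvd_imp_eq_0[OF dvd_r] by blast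
  hence "\<alpha> = A_emb \<iota> b"
    using r_eq_0_imp[of "\<alpha> - A_emb \<iota> b"] by (simp add: cl)
  \<comment> \<open>An element of A in \<PP> is divisible by P, so \<alpha> also lies in \<PP>',
    contrary to coprimality.\<close>
  hence "P dvd b"
    using dvd_of_prime_in[OF prime p(1)] \<alpha>(1) by simp
  then obtain b' where "b = b' * P"
    by (metis dvd_def mult.commute)
  hence "\<alpha> \<in> \<PP>'"
    using prime_in_mult[OF prime' endo_A(1) p(2), of b'] \<open>\<alpha> = A_emb \<iota> b\<close> by (simp add: A.hom_mult)
  hence "1 \<in> \<PP>'"
    using prime_in_add[OF prime' _ \<alpha>(2)] \<alpha>(3) by metis
  thus False using prime_in_1[OF prime'] by simp
qed

text \<open>The tangents of the reductions of \<alpha> and \<alpha>' add up to 1, so at least one is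
  nonzero; by symmetry it may belong to either prime.\<close>

lemma not_all_reduce_to_0:
  assumes split: "split_torsion \<O> act T p \<PP> \<PP>' (A_emb \<iota> ` reps d) (CARD('a) ^ d)"
  shows "\<exists>x\<in>T. red (u * x) \<noteq> 0"
proof (rule ccontr)
  assume "\<not> (\<exists>x\<in>T. red (u * x) \<noteq> 0)"
  hence zero: "red (u * x) = 0" if "x \<in> T" for x using that by blast
  interpret split_torsion \<O> act T p \<PP> \<PP>' "A_emb \<iota> ` reps d" "CARD('a) ^ d" by (rule split)
  obtain \<alpha> \<alpha>' where \<alpha>: "\<alpha> \<in> \<PP>" "\<alpha>' \<in> \<PP>'" "\<alpha> + \<alpha>' = 1" by (rule coprime)
  have "tangent (r \<alpha>) + tangent (r \<alpha>') = 1"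
    using r_add[OF \<PP>_sub[OF \<alpha>(1)] \<PP>'_sub[OF \<alpha>(2)]] \<alpha>(3) tangent_r_1 by simp
  hence "tangent (r \<alpha>) \<noteq> 0 \<or> tangent (r \<alpha>') \<noteq> 0" by auto
  thus False
    using not_all_reduce_to_0_aux[OF split zero \<alpha>]
      not_all_reduce_to_0_aux[OF swap zero \<alpha>(2,1)] \<alpha>(3) by (auto simp: add.commute)
qed

text \<open>Since \<pi> kills the \<PP>-torsion and reduces to an injective power map, the kernel
  contains this torsion. It is a proper submodule, so the two agree, and any nonzero point generates
  it with annihilator \<PP>.\<close>

lemma kernel_iso:
  assumes split: "split_torsion \<O> act T p \<PP> \<PP>' (A_emb \<iota> ` reps d) (CARD('a) ^ d)"
    and \<pi>: "\<pi> \<in> \<PP>" "r \<pi> = monom 1 k" "k > 0"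
  shows "iso_to_quotient \<O> \<PP> (\<lambda>\<alpha>. poly (endo F \<phi> \<alpha>))
    {x \<in> minimal_model_torsion \<iota> F \<phi> P. red_point red u x = 0}"
proof -
  interpret split_torsion \<O> act T p \<PP> \<PP>' "A_emb \<iota> ` reps d" "CARD('a) ^ d" by (rule split)
  define N where "N = {x \<in> T. red (u * x) = 0}"
  have "tors \<PP> \<subseteq> N"
  proof
    fix x assume x: "x \<in> tors \<PP>"
    hence "x \<in> T" "act \<pi> x = 0"
      using tors_subset \<pi>(1) by (auto simp: tors_def)
    hence "poly (r \<pi>) (red (u * x)) = 0"
      using red_poly_eval[OF \<PP>_sub[OF \<pi>(1)] integral_point, of x] by simp
    hence "red (u * x) = 0"
      using \<pi>(3) by (simp add: \<pi>(2) poly_monom)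
    thus "x \<in> N" using \<open>x \<in> T\<close> by (simp add: N_def)
  qed
  moreover have "N \<noteq> T"
    using not_all_reduce_to_0[OF split] by (auto simp: N_def)
  moreover have "x + y \<in> N" if "x \<in> N" "y \<in> N" for x y
    using that M(3) red.red_add[of "u * x" "u * y"] integral_point
    by (simp add: N_def distrib_left)
  moreover have "act f x \<in> N" if "f \<in> \<O>" "x \<in> N" for f x
    using that act_closed red_poly_eval[OF that(1) integral_point, of x] coeff_r_0[OF that(1)]
    by (simp add: N_def poly_0_coeff_0)
  ultimately have N: "tors \<PP> = N"
    using submodule_eq[of N] by (auto simp: N_def)
  obtain x where x: "x \<in> tors \<PP>" "x \<noteq> 0" using tors_nonzero by blast
  have "iso_to_quotient \<O> \<PP> act (tors \<PP>)"
  proof (rule quotient_iso[OF prime])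
    show "act (f + g) x = act f x + act g x" if "f \<in> \<O>" "g \<in> \<O>" for f g
      using act_add[OF that] .
    show "act (f * g) x = act f (act g x)" if "f \<in> \<O>" "g \<in> \<O>" for f g
      using act_mult[OF that] .
    show "act f x = 0 \<longleftrightarrow> f \<in> \<PP>" if "f \<in> \<O>" for f
      using annihilator[OF x that] x(1) by (auto simp: tors_def)
    show "(\<lambda>f. act f x) ` \<O> = tors \<PP>"
    proof
      show "(\<lambda>f. act f x) ` \<O> \<subseteq> tors \<PP>"
        using orbit_subset[OF x(1)] by blast
      show "tors \<PP> \<subseteq> (\<lambda>f. act f x) ` \<O>"
        using orbit_eq[OF x] A\<^sub>0(1) by blast
    qed
  qed
  thus ?thesis
    by (simp add: N N_def minimal_model_torsion_eq red_point_def)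
qed

end

section \<open>Passage from the hypotheses to the abstract module setting\<close>

theorem theoremA4:
  fixes \<iota> :: "'a::{finite,field} fls \<Rightarrow> 'c::{alg_closed_field,complete_space}"
    and K F \<PP> \<PP>' v w :: "'c set"
    and \<phi> \<psi> :: "'a poly \<Rightarrow> 'c poly"
    and P :: "'a poly"
    and c u \<pi> :: 'c
    and red :: "'c \<Rightarrow> 'a alg_closure"
  assumes "odd CARD('a)"
    and "C_infinity \<iota>"
    and "imaginary_quadratic \<iota> K"
    and "finite_ext_k \<iota> F"
    and "drinfeld_module (A_emb \<iota>) F 2 \<phi>"
    and "lattice_drinfeld_module \<iota> 2 (int_closure \<iota> K) \<psi>"
    and "c \<noteq> 0" and "\<And>a. \<phi> a = twist c (\<psi> a)"
    and "\<And>v'. nonzero_prime (int_closure \<iota> F) v' \<Longrightarrow> good_reduction \<iota> F 2 \<phi> v'"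
    and "bij_betw tangent (End_over F \<phi>) (int_closure \<iota> K)"
    and "bij_betw tangent (End_minimal_model \<iota> F \<phi>) (int_closure \<iota> K)"
    and "prime_elem P"
    and "primeideal \<PP> (subring_of (int_closure \<iota> K))"
    and "primeideal \<PP>' (subring_of (int_closure \<iota> K))"
    and "cgenideal (subring_of (int_closure \<iota> K)) (A_emb \<iota> P)
           = ideal_prod (subring_of (int_closure \<iota> K)) \<PP> \<PP>'"
    and "\<PP> \<noteq> \<PP>'"
    and "primeideal v (subring_of (int_closure \<iota> F))"
    and "{a. A_emb \<iota> a \<in> v} = {a. P dvd a}"
    and "primeideal w (subring_of (int_closure \<iota> UNIV))"
    and "w \<inter> int_closure \<iota> F = v"
    and "residue_map \<iota> w red"
    and "minimal_coord F (localization (int_closure \<iota> F) v) \<phi> u"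
    and "\<pi> \<in> int_closure \<iota> K"
    and "red_tau red u (endo F \<phi> \<pi>) = frobenius_endo \<iota> F v red"
    and "\<pi> \<in> \<PP>"
  shows "red_point red u ` minimal_model_torsion \<iota> F \<phi> P = fibre_torsion red u \<phi> P \<and>
         iso_to_quotient (int_closure \<iota> K) \<PP> (\<lambda>\<alpha>. poly (endo F \<phi> \<alpha>))
           {x \<in> minimal_model_torsion \<iota> F \<phi> P. red_point red u x = 0}"
proof -
  have hom: "\<iota> \<in> Ring.ring_hom ring_of_type_algebra ring_of_type_algebra"
    using assms(2) by (simp add: C_infinity_def)
  define \<O> where "\<O> = int_closure \<iota> K"
  interpret drinfeld_over \<iota> F \<phi>
    using hom assms(4,5) by (simp add: drinfeld_over.intro finite_ext_k_def)
  have prime: "prime_in \<O> \<PP>" "prime_in \<O> \<PP>'"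
    using assms(13,14) by (simp_all add: primeideal_subring_of \<O>_def)
  interpret cm_reduction \<iota> F \<phi> \<O> v w P u red
  proof
    show "is_subring \<O>" using prime_in_subring[OF prime(1)] .
    show "bij_betw tangent (End_over F \<phi>) \<O>" "bij_betw tangent (End_minimal_model \<iota> F \<phi>) \<O>"
      using assms(10,11) by (simp_all add: \<O>_def)
    show "prime_in (int_closure \<iota> F) v" "prime_in (int_closure \<iota> UNIV) w"
      using assms(17,19) by (simp_all add: primeideal_subring_of)
    have "P \<in> {a. A_emb \<iota> a \<in> v}"
      unfolding assms(18) by simp
    thus "A_emb \<iota> P \<in> v" by simp
    show "red \<in> Ring.ring_hom (subring_of (localization (int_closure \<iota> UNIV) w)) ring_of_type_algebra"
      using assms(21) by (simp add: residue_map_def)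
  qed (fact assms)+
  define p where "p = A_emb \<iota> P"
  have cgen: "cgenideal (subring_of \<O>) p = {x * p |x. x \<in> \<O>}"
    by (simp add: cgenideal_def ring_of_type_algebra_def)
  \<comment> \<open>Products of elements of the two primes lie in their ideal product, which is the
    principal ideal of \<open>p\<close>.\<close>
  have prod: "\<exists>g\<in>\<O>. i * j = p * g" if "i \<in> \<PP>" "j \<in> \<PP>'" for i j
  proof -
    have "i * j \<in> ideal_prod (subring_of \<O>) \<PP> \<PP>'"
      using ideal_prod.prod[OF that, of "subring_of \<O>"] by (simp add: ring_of_type_algebra_def)
    thus ?thesis
      using assms(15) cgen by (auto simp: \<O>_def p_def mult.commute)
  qed
  \<comment> \<open>Conversely, the generator \<open>p\<close> lies in the ideal product and hence
    in both primes.\<close>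
  have "p \<in> ideal_prod (subring_of \<O>) \<PP> \<PP>'"
    using assms(15) cgen subring_1[OF prime_in_subring[OF prime(1)]]
    by (auto simp: \<O>_def p_def intro!: exI[of _ 1])
  moreover have "ideal_prod (subring_of \<O>) \<PP> \<PP>' \<subseteq> \<PP> \<inter> \<PP>'"
  proof
    fix x assume "x \<in> ideal_prod (subring_of \<O>) \<PP> \<PP>'"
    thus "x \<in> \<PP> \<inter> \<PP>'"
    proof (induction rule: ideal_prod.induct)
      case (prod i j)
      hence "j * i \<in> \<PP>" "i * j \<in> \<PP>'"
        using prime_in_mult[OF prime(1)] prime_in_mult[OF prime(2)]
          prime_in_subset[OF prime(1)] prime_in_subset[OF prime(2)] by blast+
      thus ?case by (simp add: ring_of_type_algebra_def mult.commute)
    next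
      case (sum x y)
      thus ?case
        using prime_in_add[OF prime(1)] prime_in_add[OF prime(2)] by (simp add: ring_of_type_algebra_def)
    qed
  qed
  ultimately have "p \<in> \<PP>" "p \<in> \<PP>'" by auto
  hence split: "split_torsion \<O> act T p \<PP> \<PP>' (A_emb \<iota> ` reps (degree P)) (CARD('a) ^ degree P)"
    unfolding p_def using prod by (intro split_torsion prime assms(16)) (simp_all add: p_def)
  have "r \<pi> = monom 1 (CARD('a) ^ residue_degree \<iota> F v red)"
    using assms(24) by (simp add: frobenius_endo_def)
  from kernel_iso[OF split[unfolded p_def] assms(25) this] show ?thesis
    using reduction_surjective q_pos by (simp add: \<O>_def)
qed

end
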